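(* Let $m,n\ge 2$ be integers and $\mathcal{T}=(t_{i_1\ldots i_m})\in\mathbb{T}(\mathbb{C}^n,m)$. For each eigenvalue $\lambda_i\in\sigma(\mathcal{T})$ let $m_i$ be its algebraic multiplicity. Then (i) $\displaystyle\sum_{\lambda_i\in\sigma(\mathcal{T})}m_i\lambda_i=(m-1)^{n-1}\sum_{i=1}^nt_{ii\ldots i}=\mathrm{Tr}_1(\mathcal{T})$, and (ii) $\displaystyle\prod_{\lambda_i\in\sigma(\mathcal{T})}\lambda_i^{m_i}=\mathrm{Edet}(\mathcal{T})$.
   Context: $\mathbb{T}(\mathbb{C}^n,m)$ is the space of $m$-th order $n$-dimensional complex tensors $\mathcal{T}=(t_{i_1\ldots i_m})$, $1\le i_1,\ldots,i_m\le n$. $\mathcal{E}$ is the identity tensor: $e_{i_1\ldots i_m}=1$ if $i_1=\cdots=i_m$ and $0$ otherwise. For $\mathbf{x}\in\mathbb{C}^n$, $\mathcal{T}\mathbf{x}^{m-1}\in\mathbb{C}^n$ has $i$-th entry $\sum_{i_2,\ldots,i_m=1}^n t_{ii_2\ldots i_m}x_{i_2}\cdots x_{i_m}$. The resultant $\mathrm{Res}$ of $n$ homogeneous polynomials in $n$ variables, each of degree $m-1$, is the irreducible polynomial in their coefficients that vanishes if and only if the polynomials have a common zero in $\mathbb{C}^n\setminus\{\mathbf{0}\}$, normalized by $\mathrm{Res}(x_1^{m-1},\ldots,x_n^{m-1})=1$. $\mathrm{Edet}(\mathcal{T})$ is the resultant of the $n$ components of $\mathcal{T}\mathbf{x}^{m-1}$.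 $\lambda\in\mathbb{C}$ is an eigenvalue of $\mathcal{T}$ if $(\lambda\mathcal{E}-\mathcal{T})\mathbf{x}^{m-1}=\mathbf{0}$ has a solution $\mathbf{x}\in\mathbb{C}^n\setminus\{\mathbf{0}\}$; $\sigma(\mathcal{T})$ is the set of (distinct) eigenvalues; the algebraic multiplicity of an eigenvalue is its multiplicity as a root of the characteristic polynomial $\psi(\lambda)=\mathrm{Edet}(\lambda\mathcal{E}-\mathcal{T})$. The first trace is $\mathrm{Tr}_1(\mathcal{T}):=(m-1)^{n-1}\sum_{i=1}^n\frac{\hat g_i}{(m-1)!}\mathrm{Tr}(A^{m-1})$, where $A=(a_{ij})$ is an $n\times n$ matrix of independent variables and $\hat g_i:=\sum_{i_2,\ldots,i_m=1}^n t_{ii_2\ldots i_m}\frac{\partial}{\partial a_{ii_2}}\cdots\frac{\partial}{\partial a_{ii_m}}$. *)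

theory Defs
  imports
    "HOL-Library.Poly_Mapping"
    "HOL-Computational_Algebra.Polynomial"
    "Jordan_Normal_Form.Matrix"
begin

section \<open>Multivariate polynomials\<close>

text \<open>Exponent vectors are finitely supported maps from variables to natural numbers; a
  polynomial maps exponent vectors to coefficients, and its product is the convolution product
  of the library.\<close>

type_synonym ('v, 'a) mpoly = "('v \<Rightarrow>\<^sub>0 nat) \<Rightarrow>\<^sub>0 'a"

definition mpvar :: "'v \<Rightarrow> ('v, 'a::comm_semiring_1) mpoly" where
  "mpvar v = Poly_Mapping.single (Poly_Mapping.single v 1) 1"

definition mpconst :: "'a \<Rightarrow> ('v, 'a::comm_semiring_1) mpoly" where
  "mpconst c = Poly_Mapping.single 0 c"

definition mpvars :: "('v, 'a::zero) mpoly \<Rightarrow> 'v set" where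
  "mpvars p = (\<Union>k\<in>Poly_Mapping.keys p. Poly_Mapping.keys k)"

definition mpeval :: "('v \<Rightarrow> 'a) \<Rightarrow> ('v, 'a::comm_semiring_1) mpoly \<Rightarrow> 'a" where
  "mpeval a p = (\<Sum>k\<in>Poly_Mapping.keys p. Poly_Mapping.lookup p k *
     (\<Prod>v\<in>Poly_Mapping.keys k. a v ^ Poly_Mapping.lookup k v))"

text \<open>Formal partial derivative. When the exponent of \<open>v\<close> is 0, the truncated subtraction
  is harmless because the coefficient is 0.\<close>

definition mppderiv :: "'v \<Rightarrow> ('v, 'a::comm_semiring_1) mpoly \<Rightarrow> ('v, 'a) mpoly" where
  "mppderiv v p = (\<Sum>k\<in>Poly_Mapping.keys p. Poly_Mapping.single (k - Poly_Mapping.single v 1)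
     (of_nat (Poly_Mapping.lookup k v) * Poly_Mapping.lookup p k))"

text \<open>Exponent vectors of the monomials of degree \<open>d\<close> in the variables \<open>0, \<dots>, n - 1\<close>.\<close>

definition deg_monomials :: "nat \<Rightarrow> nat \<Rightarrow> (nat \<Rightarrow>\<^sub>0 nat) set" where
  "deg_monomials n d = {k. Poly_Mapping.keys k \<subseteq> {..<n} \<and> (\<Sum>v<n. Poly_Mapping.lookup k v) = d}"

text \<open>As usual, the zero polynomial counts as homogeneous of every degree.\<close>

definition homogeneous_poly :: "nat \<Rightarrow> nat \<Rightarrow> (nat, 'a::zero) mpoly \<Rightarrow> bool" where
  "homogeneous_poly n d p \<longleftrightarrow> Poly_Mapping.keys p \<subseteq> deg_monomials n d"

section \<open>The resultant of \<open>n\<close> homogeneous polynomials of degree \<open>d\<close> in \<open>n\<close> variables\<close>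

text \<open>The resultant is a polynomial in indeterminates indexed by pairs \<open>(i, k)\<close>, where
  \<open>(i, k)\<close> stands for the coefficient of the monomial \<open>k\<close> in the \<open>i\<close>-th polynomial.\<close>

definition system_coeffs :: "(nat \<Rightarrow> (nat, 'a::zero) mpoly) \<Rightarrow> nat \<times> (nat \<Rightarrow>\<^sub>0 nat) \<Rightarrow> 'a" where
  "system_coeffs F = (\<lambda>(i, k). Poly_Mapping.lookup (F i) k)"

definition is_resultant ::
  "nat \<Rightarrow> nat \<Rightarrow> (nat \<times> (nat \<Rightarrow>\<^sub>0 nat), complex) mpoly \<Rightarrow> bool" where
  "is_resultant n d R \<longleftrightarrow>
     mpvars R \<subseteq> {..<n} \<times> deg_monomials n d \<and>
     irreducible R \<and>
     (\<forall>F. (\<forall>i<n. homogeneous_poly n d (F i)) \<longrightarrow>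
        (mpeval (system_coeffs F) R = 0 \<longleftrightarrow>
          (\<exists>x\<in>carrier_vec n. x \<noteq> 0\<^sub>v n \<and> (\<forall>i<n. mpeval (\<lambda>j. x $ j) (F i) = 0)))) \<and>
     mpeval (system_coeffs (\<lambda>i. mpvar i ^ d)) R = 1"

definition resultant_poly :: "nat \<Rightarrow> nat \<Rightarrow> (nat \<times> (nat \<Rightarrow>\<^sub>0 nat), complex) mpoly" where
  "resultant_poly n d = (THE R. is_resultant n d R)"

definition Res :: "nat \<Rightarrow> nat \<Rightarrow> (nat \<Rightarrow> (nat, complex) mpoly) \<Rightarrow> complex" where
  "Res n d F = mpeval (system_coeffs F) (resultant_poly n d)"

section \<open>Tensors\<close>

text \<open>A tensor of order \<open>m\<close> and dimension \<open>n\<close> is given by its entries \<open>T is\<close> at the index lists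
  \<open>is\<close> of length \<open>m\<close> over \<open>{0, \<dots>, n - 1}\<close>; all other values of \<open>T\<close> are irrelevant.\<close>

type_synonym 'a tensor = "nat list \<Rightarrow> 'a"

definition index_lists :: "nat \<Rightarrow> nat \<Rightarrow> nat list set" where
  "index_lists n k = {js. length js = k \<and> set js \<subseteq> {..<n}}"

definition id_tensor :: "'a::zero_neq_one tensor" where
  "id_tensor is = (if \<forall>i\<in>set is. \<forall>j\<in>set is. i = j then 1 else 0)"

text \<open>The vector \<open>T x\<^sup>m\<^sup>-\<^sup>1\<close>; it makes sense over every commutative semiring, in particular
  for a vector of indeterminates.\<close>

definition tensor_apply :: "nat \<Rightarrow> nat \<Rightarrow> 'a::comm_semiring_1 tensor \<Rightarrow> 'a vec \<Rightarrow> 'a vec" where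
  "tensor_apply m n T x =
     vec n (\<lambda>i. \<Sum>js\<in>index_lists n (m - 1). T (i # js) * (\<Prod>j\<leftarrow>js. x $ j))"

definition tensor_forms ::
  "nat \<Rightarrow> nat \<Rightarrow> 'a::comm_semiring_1 tensor \<Rightarrow> nat \<Rightarrow> (nat, 'a) mpoly" where
  "tensor_forms m n T i = tensor_apply m n (\<lambda>is. mpconst (T is)) (vec n mpvar) $ i"

definition Edet :: "nat \<Rightarrow> nat \<Rightarrow> complex tensor \<Rightarrow> complex" where
  "Edet m n T = Res n (m - 1) (tensor_forms m n T)"

definition shifted_tensor :: "complex \<Rightarrow> complex tensor \<Rightarrow> complex tensor" where
  "shifted_tensor l T = (\<lambda>is. l * id_tensor is - T is)"

definition tensor_eigenvalue :: "nat \<Rightarrow> nat \<Rightarrow> complex tensor \<Rightarrow> complex \<Rightarrow> bool" where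
  "tensor_eigenvalue m n T l \<longleftrightarrow>
     (\<exists>x\<in>carrier_vec n. x \<noteq> 0\<^sub>v n \<and> tensor_apply m n (shifted_tensor l T) x = 0\<^sub>v n)"

definition tensor_spectrum :: "nat \<Rightarrow> nat \<Rightarrow> complex tensor \<Rightarrow> complex set" where
  "tensor_spectrum m n T = {l. tensor_eigenvalue m n T l}"

text \<open>\<open>\<lambda>l. Edet m n (shifted_tensor l T)\<close> is a polynomial function, and the characteristic
  polynomial is the univariate polynomial that induces it.\<close>

definition tensor_charpoly :: "nat \<Rightarrow> nat \<Rightarrow> complex tensor \<Rightarrow> complex poly" where
  "tensor_charpoly m n T = (THE p. \<forall>l. poly p l = Edet m n (shifted_tensor l T))"

definition alg_mult :: "nat \<Rightarrow> nat \<Rightarrow> complex tensor \<Rightarrow> complex \<Rightarrow> nat" where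
  "alg_mult m n T l = order l (tensor_charpoly m n T)"

section \<open>The first trace\<close>

text \<open>The matrix \<open>A\<close> of independent variables \<open>a\<^sub>i\<^sub>j\<close>, the variable being indexed by the pair
  \<open>(i, j)\<close>.\<close>

definition var_mat :: "nat \<Rightarrow> (nat \<times> nat, 'a::comm_semiring_1) mpoly mat" where
  "var_mat n = mat n n mpvar"

definition mat_trace :: "'a::comm_monoid_add mat \<Rightarrow> 'a" where
  "mat_trace M = (\<Sum>i<dim_row M. M $$ (i, i))"

definition g_hat :: "nat \<Rightarrow> nat \<Rightarrow> complex tensor \<Rightarrow> nat \<Rightarrow>
    (nat \<times> nat, complex) mpoly \<Rightarrow> (nat \<times> nat, complex) mpoly" where
  "g_hat m n T i p =
     (\<Sum>js\<in>index_lists n (m - 1). mpconst (T (i # js)) * foldr (\<lambda>j. mppderiv (i, j)) js p)"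

text \<open>Applying \<open>g_hat\<close> to a polynomial yields a polynomial in the \<open>a\<^sub>i\<^sub>j\<close>, so the first trace is
  defined as such. (It is a constant, because \<open>g_hat\<close> has order \<open>m - 1\<close> and the trace of
  \<open>A\<^sup>m\<^sup>-\<^sup>1\<close> is homogeneous of degree \<open>m - 1\<close>.)\<close>

definition Tr1 :: "nat \<Rightarrow> nat \<Rightarrow> complex tensor \<Rightarrow> (nat \<times> nat, complex) mpoly" where
  "Tr1 m n T = mpconst ((of_nat m - 1) ^ (n - 1)) *
     (\<Sum>i<n. mpconst (1 / fact (m - 1)) * g_hat m n T i (mat_trace (var_mat n ^\<^sub>m (m - 1))))"

end

(* The resultant is constructed as a generator of the ideal P of all polynomials in the coefficients
   of n forms of degree d in n variables that vanish on every system with a nontrivial zero.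

   P is prime, because any two such systems lie on a common rational curve of such systems, and no
   nonzero element of P omits the coefficient of x_n^d in the last form, because the other n - 1 forms
   are unconstrained. Since polynomial rings over a field are factorial, an element R of minimal degree
   in P is irreducible and generates P. By the Nullstellensatz a system without nontrivial zeros is
   detected by a Macaulay-type determinant in P, hence the zero set of R consists exactly of the systems
   with a nontrivial zero; an irreducible polynomial with that zero set lies in P and so is unique up to scaling.

   R divides Macaulay's determinants, which bounds its degree in the coefficients of each form by
   d^(n-1); an explicit cyclic system with d^(n-1) values of a parameter for which it has a zero shows
   that this degree is attained. So R is homogeneous of degree N = n d^(n-1), and the characteristic
   polynomial psi(l) = R(l E - T) equals l^N g(1/l) with g(e) = R(E - e T). The product of the roots of psi is
   (-1)^N R(-T) = R(T), and their sum is - g'(0). Finally, adding to E a multiple of a monomial other than x_j^d in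
   row j never creates a zero, so R is constant along this direction and only the diagonal
   entries of T contribute to g'(0). *)

theory Submission
  imports
    Defs
    "HOL-Library.Product_Lexorder"
    "HOL-Computational_Algebra.Fundamental_Theorem_Algebra"
    "HOL-Analysis.Continuum_Not_Denumerable"
    "Jordan_Normal_Form.Char_Poly"
begin

section \<open>Substitution into multivariate polynomials\<close>

text \<open>\<open>Res\<close> is accessible only through a definite description fixing zero set,
  irreducibility and normalisation. Degrees are not part of it and a zero set alone does not reveal
  them, so every quantitative fact about R is drawn from divisibility in P. That R generates P is
  where dimension theory would normally enter. Elimination replaces it: an element of P not
  divisible by R could be combined with R into a nonzero element of P that omits the coefficient of
  x_n^d in the last form. Scaling one form by u preserves solvability, so it turns R into a multiple
  of R, and scaling back shows that the factor is a constant k(u). Its value is found on a diagonal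
  system, where a Macaulay determinant is a power of u. The polynomial g is used beside psi because
  what is computed about R near E is first order information at e = 0, and g(0) = 1 already forces
  psi to be monic of degree N. Limits are never taken: a polynomial in one parameter that vanishes
  off 0 vanishes at 0, and one without a root is constant.\<close>

abbreviation pkeys :: "('k \<Rightarrow>\<^sub>0 'a::zero) \<Rightarrow> 'k set" where "pkeys \<equiv> Poly_Mapping.keys"
abbreviation plookup :: "('k \<Rightarrow>\<^sub>0 'a::zero) \<Rightarrow> 'k \<Rightarrow> 'a" where "plookup \<equiv> Poly_Mapping.lookup"
abbreviation psingle :: "'k \<Rightarrow> 'a::zero \<Rightarrow> 'k \<Rightarrow>\<^sub>0 'a" where "psingle \<equiv> Poly_Mapping.single"

definition moneval :: "('v \<Rightarrow> 'b::comm_semiring_1) \<Rightarrow> ('v \<Rightarrow>\<^sub>0 nat) \<Rightarrow> 'b" where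
  "moneval s k = (\<Prod>v\<in>pkeys k. s v ^ plookup k v)"

text \<open>Evaluation, splitting off a variable, grading and rescaling of coefficients are all
  instances, so multiplicativity is proved once, for any coefficient homomorphism
  \<open>f\<close>.\<close>

definition mpsubst :: "('a::comm_semiring_1 \<Rightarrow> 'b::comm_semiring_1) \<Rightarrow> ('v \<Rightarrow> 'b) \<Rightarrow> ('v, 'a) mpoly \<Rightarrow> 'b" where
  "mpsubst f s p = (\<Sum>k\<in>pkeys p. f (plookup p k) * moneval s k)"

lemma mpeval_eq_mpsubst: "mpeval a = mpsubst (\<lambda>c. c) a"
  by (intro ext) (simp add: mpeval_def mpsubst_def moneval_def)

lemma moneval_superset:
  assumes "finite A" "pkeys k \<subseteq> A"
  shows "moneval s k = (\<Prod>v\<in>A. s v ^ plookup k v)"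
  unfolding moneval_def using assms
  by (intro prod.mono_neutral_left) (auto simp: in_keys_iff)

lemma moneval_zero [simp]: "moneval s 0 = 1"
  by (simp add: moneval_def)

lemma moneval_single [simp]: "moneval s (psingle v e) = s v ^ e"
  by (simp add: moneval_def)

lemma moneval_add: "moneval s (k + l) = moneval s k * moneval s l"
proof -
  let ?A = "pkeys k \<union> pkeys l"
  have "moneval s (k + l) = (\<Prod>v\<in>?A. s v ^ plookup (k + l) v)"
    by (rule moneval_superset) (auto dest: subsetD[OF Poly_Mapping.keys_add])
  also have "\<dots> = (\<Prod>v\<in>?A. s v ^ plookup k v) * (\<Prod>v\<in>?A. s v ^ plookup l v)"
    by (simp add: lookup_add power_add prod.distrib)
  also have "\<dots> = moneval s k * moneval s l"
    by (simp add: moneval_superset[of ?A])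
  finally show ?thesis .
qed

lemma moneval_cong: "(\<And>v. v \<in> pkeys k \<Longrightarrow> s v = t v) \<Longrightarrow> moneval s k = moneval t k"
  by (simp add: moneval_def)

lemma poly_mapping_sum_single: "(\<Sum>k\<in>pkeys p. psingle k (plookup p k)) = p"
proof (rule poly_mapping_eqI)
  fix l
  have "plookup (\<Sum>k\<in>pkeys p. psingle k (plookup p k)) l = (\<Sum>k\<in>pkeys p. if k = l then plookup p k else 0)"
    by (simp add: lookup_sum lookup_single when_def)
  also have "\<dots> = plookup p l"
    by (simp add: in_keys_iff)
  finally show "plookup (\<Sum>k\<in>pkeys p. psingle k (plookup p k)) l = plookup p l" .
qed

context comm_semiring_hom
begin

lemma mpsubst_superset:
  assumes "finite A" "pkeys p \<subseteq> A"
  shows "mpsubst hom s p = (\<Sum>k\<in>A. hom (plookup p k) * moneval s k)"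
  unfolding mpsubst_def using assms
  by (intro sum.mono_neutral_left) (auto simp: in_keys_iff)

lemma mpsubst_add: "mpsubst hom s (p + q) = mpsubst hom s p + mpsubst hom s q"
proof -
  let ?A = "pkeys p \<union> pkeys q"
  have "mpsubst hom s (p + q) = (\<Sum>k\<in>?A. hom (plookup (p + q) k) * moneval s k)"
    by (rule mpsubst_superset) (auto dest: subsetD[OF Poly_Mapping.keys_add])
  then show ?thesis
    by (simp add: lookup_add hom_add algebra_simps sum.distrib mpsubst_superset[of ?A])
qed

lemma mpsubst_zero: "mpsubst hom s 0 = 0"
  by (simp add: mpsubst_def)

lemma mpsubst_sum: "mpsubst hom s (\<Sum>i\<in>I. g i) = (\<Sum>i\<in>I. mpsubst hom s (g i))"
  by (induction I rule: infinite_finite_induct) (simp_all add: mpsubst_zero mpsubst_add)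

lemma mpsubst_single: "mpsubst hom s (psingle k c) = hom c * moneval s k"
  by (cases "c = 0") (auto simp: mpsubst_def)

lemma mpsubst_const: "mpsubst hom s (mpconst c) = hom c"
  by (simp add: mpconst_def mpsubst_single)

lemma mpsubst_var: "mpsubst hom s (mpvar v) = s v"
  by (simp add: mpvar_def mpsubst_single)

lemma mpsubst_mult: "mpsubst hom s (p * q) = mpsubst hom s p * mpsubst hom s q"
proof -
  have "mpsubst hom s (p * q) = mpsubst hom s ((\<Sum>k\<in>pkeys p. psingle k (plookup p k)) * (\<Sum>l\<in>pkeys q. psingle l (plookup q l)))"
    by (simp add: poly_mapping_sum_single)
  also have "\<dots> = (\<Sum>k\<in>pkeys p. \<Sum>l\<in>pkeys q. hom (plookup p k) * moneval s k * (hom (plookup q l) * moneval s l))"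
    by (simp add: sum_product mpsubst_sum mult_single mpsubst_single moneval_add hom_mult ac_simps)
  also have "\<dots> = mpsubst hom s p * mpsubst hom s q"
    by (simp add: mpsubst_def sum_product)
  finally show ?thesis .
qed

lemma mpsubst_one: "mpsubst hom s 1 = 1"
  using mpsubst_single[of s 0 1] by simp

lemma comm_semiring_hom_mpsubst: "comm_semiring_hom (mpsubst hom s)"
  by unfold_locales (simp_all add: mpsubst_zero mpsubst_one mpsubst_add mpsubst_mult)

end

lemma mpsubst_cong: "(\<And>v. v \<in> mpvars p \<Longrightarrow> s v = t v) \<Longrightarrow> mpsubst f s p = mpsubst f t p"
  unfolding mpsubst_def mpvars_def by (intro sum.cong refl arg_cong2[of _ _ _ _ "(*)"] moneval_cong) auto

lemma (in comm_semiring_hom) hom_mpsubst: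
  "hom (mpsubst f s p) = mpsubst (\<lambda>c. hom (f c)) (\<lambda>v. hom (s v)) p"
  by (simp add: mpsubst_def moneval_def hom_sum hom_mult hom_prod hom_power)

lemma comm_semiring_hom_id: "comm_semiring_hom (\<lambda>c::'a::comm_semiring_1. c)"
  by unfold_locales auto

lemma comm_semiring_hom_mpconst: "comm_semiring_hom mpconst"
  by unfold_locales (simp_all add: mpconst_def mult_single single_add)

lemma comm_semiring_hom_pconst: "comm_semiring_hom (\<lambda>c::'a::comm_semiring_1. [:c:])"
  by unfold_locales (simp_all add: one_pCons mult.commute)

lemma comm_semiring_hom_comp:
  assumes "comm_semiring_hom g" "comm_semiring_hom f"
  shows "comm_semiring_hom (\<lambda>x. g (f x))"
proof -
  interpret g: comm_semiring_hom g by fact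
  interpret f: comm_semiring_hom f by fact
  show ?thesis by unfold_locales (simp_all add: f.hom_add g.hom_add f.hom_mult g.hom_mult)
qed

interpretation mpeval: comm_semiring_hom "mpeval a"
  unfolding mpeval_eq_mpsubst
  by (rule comm_semiring_hom.comm_semiring_hom_mpsubst[OF comm_semiring_hom_id])

interpretation mpeval_ring: comm_ring_hom "mpeval (a :: 'v \<Rightarrow> 'a::comm_ring_1)" ..

lemma mpeval_const [simp]: "mpeval a (mpconst c) = c"
  and mpeval_var [simp]: "mpeval a (mpvar v) = a v"
  and mpeval_single: "mpeval a (psingle k c) = c * moneval a k"
  unfolding mpeval_eq_mpsubst
  by (simp_all add: comm_semiring_hom.mpsubst_const comm_semiring_hom.mpsubst_var
      comm_semiring_hom.mpsubst_single comm_semiring_hom_id)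

lemma mpeval_cong: "(\<And>v. v \<in> mpvars p \<Longrightarrow> a v = b v) \<Longrightarrow> mpeval a p = mpeval b p"
  unfolding mpeval_eq_mpsubst by (rule mpsubst_cong)

lemma moneval_mpvar: "moneval mpvar k = psingle k (1::'a::comm_semiring_1)"
proof -
  have "(\<Prod>v\<in>A. psingle (psingle v 1) (1::'a) ^ plookup k v) = psingle (\<Sum>v\<in>A. psingle v (plookup k v)) 1"
    if "finite A" for A using that
  proof (induction A)
    case (insert x A)
    have "psingle (psingle x 1) (1::'a) ^ e = psingle (psingle x e) 1" for e :: nat
      by (induction e) (simp_all add: mult_single flip: single_add)
    with insert show ?case by (simp add: mult_single)
  qed simp
  then show ?thesis
    by (simp add: moneval_def mpvar_def poly_mapping_sum_single)
qed

lemma mpsubst_mpvar [simp]: "mpsubst mpconst mpvar p = p"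
proof -
  have "mpsubst mpconst mpvar p = (\<Sum>k\<in>pkeys p. psingle k (plookup p k))"
    unfolding mpsubst_def by (simp add: moneval_mpvar mpconst_def mult_single)
  then show ?thesis by (simp add: poly_mapping_sum_single)
qed

text \<open>Writing \<open>p\<close> as a sum of products of constants and its own variables keeps
  the variable case inside \<open>mpvars p\<close>, which claims about the occurring variables
  require.\<close>

lemma mpoly_induct [case_names const var add mult]:
  assumes "\<And>c. P (mpconst c)" "\<And>v. v \<in> mpvars p \<Longrightarrow> P (mpvar v)"
    "\<And>p q. P p \<Longrightarrow> P q \<Longrightarrow> P (p + q)" "\<And>p q. P p \<Longrightarrow> P q \<Longrightarrow> P (p * q)"
  shows "P p"
proof -
  have z: "P 0" "P 1" using assms(1)[of 0] assms(1)[of 1] by (simp_all add: mpconst_def)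
  have pow: "P (mpvar v ^ e)" if "v \<in> mpvars p" for v and e :: nat
    using z assms(2)[OF that] by (induction e) (auto intro: assms(4))
  have mon: "P (moneval mpvar k)" if "k \<in> pkeys p" for k
  proof -
    have "P (\<Prod>v\<in>A. mpvar v ^ plookup k v)" if "finite A" "A \<subseteq> pkeys k" for A
      using that
    proof (induction A)
      case (insert v A)
      then have "v \<in> mpvars p" using \<open>k \<in> pkeys p\<close> by (auto simp: mpvars_def)
      with insert show ?case by (auto intro!: assms(4) pow)
    qed (use z in simp)
    then show ?thesis by (simp add: moneval_def)
  qed
  have "P (\<Sum>k\<in>A. mpconst (plookup p k) * moneval mpvar k)" if "finite A" "A \<subseteq> pkeys p" for A
    using that
    by (induction A) (auto intro!: z assms(1,3,4) mon)
  from this[of "pkeys p"] have "P (mpsubst mpconst mpvar p)" by (simp add: mpsubst_def)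
  then show ?thesis by simp
qed

subsection \<open>Occurring variables\<close>

lemma mpvars_const [simp]: "mpvars (mpconst c) = {}"
  by (auto simp: mpvars_def mpconst_def)

lemma mpvars_zero [simp]: "mpvars 0 = {}" and mpvars_one [simp]: "mpvars 1 = {}"
  by (auto simp: mpvars_def)

lemma mpvars_var [simp]: "mpvars (mpvar v :: ('v, 'a::comm_semiring_1) mpoly) = {v}"
  by (auto simp: mpvars_def mpvar_def)

lemma finite_mpvars [simp]: "finite (mpvars p)"
  by (auto simp: mpvars_def)

lemma mpvars_add: "mpvars (p + q) \<subseteq> mpvars p \<union> mpvars q"
  using Poly_Mapping.keys_add[of p q] by (auto simp: mpvars_def)

lemma mpvars_mult: "mpvars (p * q) \<subseteq> mpvars p \<union> mpvars q"
proof
  fix v assume "v \<in> mpvars (p * q)"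
  then obtain k where k: "k \<in> pkeys (p * q)" "v \<in> pkeys k" by (auto simp: mpvars_def)
  from k(1) obtain a b where "a \<in> pkeys p" "b \<in> pkeys q" "k = a + b"
    using Poly_Mapping.keys_mult[of p q] by blast
  with k(2) show "v \<in> mpvars p \<union> mpvars q"
    using Poly_Mapping.keys_add[of a b] by (auto simp: mpvars_def)
qed

lemma mpvars_uminus [simp]: "mpvars (- p :: ('v, 'a::ab_group_add) mpoly) = mpvars p"
  by (auto simp: mpvars_def in_keys_iff)

lemma mpvars_diff: "mpvars (p - q :: ('v, 'a::ab_group_add) mpoly) \<subseteq> mpvars p \<union> mpvars q"
  using mpvars_add[of p "- q"] by simp

lemma mpvars_power: "mpvars (p ^ e) \<subseteq> mpvars p"
  by (induction e) (auto dest!: subsetD[OF mpvars_mult])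

lemma mpvars_sum: "(\<And>i. i \<in> I \<Longrightarrow> mpvars (g i) \<subseteq> B) \<Longrightarrow> mpvars (\<Sum>i\<in>I. g i) \<subseteq> B"
  by (induction I rule: infinite_finite_induct) (auto dest!: subsetD[OF mpvars_add])

lemma mpvars_prod: "(\<And>i. i \<in> I \<Longrightarrow> mpvars (g i) \<subseteq> B) \<Longrightarrow> mpvars (\<Prod>i\<in>I. g i) \<subseteq> B"
  by (induction I rule: infinite_finite_induct) (auto dest!: subsetD[OF mpvars_mult])

lemma mpvars_empty_imp_const:
  assumes "mpvars p = {}" shows "p = mpconst (plookup p 0)"
proof (rule poly_mapping_eqI)
  fix k
  show "plookup p k = plookup (mpconst (plookup p 0)) k"
  proof (cases "k = 0")
    case False
    then have "pkeys k \<noteq> {}" by simp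
    then have "k \<notin> pkeys p" using assms by (auto simp: mpvars_def)
    with False show ?thesis by (simp add: mpconst_def lookup_single in_keys_iff)
  qed (simp add: mpconst_def)
qed

subsection \<open>Splitting off a variable and gradings\<close>

text \<open>The coefficients stay in the same polynomial type, so variables can be adjoined one by
  one without changing types; that the coefficients are free of \<open>x\<close> is
  \<open>mpvars_coeff_mpsplit\<close>.\<close>

definition mpsplit :: "'v \<Rightarrow> ('v, 'a::comm_semiring_1) mpoly \<Rightarrow> ('v, 'a) mpoly poly" where
  "mpsplit x = mpsubst (\<lambda>c. [:mpconst c:]) (\<lambda>v. if v = x then [:0, 1:] else [:mpvar v:])"

text \<open>Coefficient \<open>e\<close> is the component of weighted degree \<open>e\<close>;
  setting the grading variable to 1 gives back \<open>p\<close>.\<close>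

definition mpgrade :: "('v \<Rightarrow> nat) \<Rightarrow> ('v, 'a::comm_semiring_1) mpoly \<Rightarrow> ('v, 'a) mpoly poly" where
  "mpgrade w = mpsubst (\<lambda>c. [:mpconst c:]) (\<lambda>v. monom (mpvar v) (w v))"

lemma comm_semiring_hom_pmpconst: "comm_semiring_hom (\<lambda>c. [:mpconst c:])"
  by (rule comm_semiring_hom_comp[OF comm_semiring_hom_pconst comm_semiring_hom_mpconst])

interpretation mpsplit: comm_semiring_hom "mpsplit x"
  unfolding mpsplit_def
  by (rule comm_semiring_hom.comm_semiring_hom_mpsubst[OF comm_semiring_hom_pmpconst])

interpretation mpsplit_ring: comm_ring_hom "mpsplit (x::'v) :: ('v, 'a::comm_ring_1) mpoly \<Rightarrow> _" ..

interpretation mpgrade: comm_semiring_hom "mpgrade w"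
  unfolding mpgrade_def
  by (rule comm_semiring_hom.comm_semiring_hom_mpsubst[OF comm_semiring_hom_pmpconst])

interpretation mpgrade_ring: comm_ring_hom "mpgrade w :: ('v, 'a::comm_ring_1) mpoly \<Rightarrow> _" ..

lemma mpsplit_const [simp]: "mpsplit x (mpconst c) = [:mpconst c:]"
  and mpsplit_var: "mpsplit x (mpvar v) = (if v = x then [:0, 1:] else [:mpvar v:])"
  and mpgrade_const [simp]: "mpgrade w (mpconst c) = [:mpconst c:]"
  and mpgrade_var: "mpgrade w (mpvar v) = monom (mpvar v) (w v)"
  unfolding mpsplit_def mpgrade_def
  by (simp_all add: comm_semiring_hom.mpsubst_const[OF comm_semiring_hom_pmpconst] 
      comm_semiring_hom.mpsubst_var[OF comm_semiring_hom_pmpconst])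

lemma comm_semiring_hom_poly: "comm_semiring_hom (\<lambda>p. poly p a)"
  by unfold_locales simp_all

lemma poly_mpsplit [simp]: "poly (mpsplit x p) (mpvar x) = p"
proof -
  have "poly (mpsplit x p) (mpvar x) = mpsubst mpconst mpvar p"
    unfolding mpsplit_def comm_semiring_hom.hom_mpsubst[OF comm_semiring_hom_poly]
    by (rule arg_cong2[of _ _ _ _ "\<lambda>f g. mpsubst f g p"]) auto
  then show ?thesis by simp
qed

lemma poly_mpgrade [simp]: "poly (mpgrade w p) 1 = p"
  unfolding mpgrade_def comm_semiring_hom.hom_mpsubst[OF comm_semiring_hom_poly]
  by (simp add: poly_monom)

lemma mpsplit_free: "x \<notin> mpvars p \<Longrightarrow> mpsplit x p = [:p:]"
proof -
  assume x: "x \<notin> mpvars p"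
  have "mpsplit x p = mpsubst (\<lambda>c. [:mpconst c:]) (\<lambda>v. [:mpvar v:]) p"
    unfolding mpsplit_def by (rule mpsubst_cong) (use x in auto)
  also have "\<dots> = [:mpsubst mpconst mpvar p:]"
    by (simp only: comm_semiring_hom.hom_mpsubst[OF comm_semiring_hom_pconst])
  finally show ?thesis by simp
qed

lemma mpvars_coeff_mult_le:
  assumes "\<And>i. mpvars (coeff p i) \<subseteq> B" "\<And>i. mpvars (coeff q i) \<subseteq> B"
  shows "mpvars (coeff (p * q) i) \<subseteq> B"
  unfolding coeff_mult by (rule mpvars_sum) (use assms mpvars_mult in fast)

lemma mpvars_coeff_mpsplit:
  fixes p :: "('v, 'a::comm_semiring_1) mpoly"
  shows "mpvars (coeff (mpsplit x p) i) \<subseteq> mpvars p - {x}"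
proof -
  have "\<forall>i. mpvars (coeff (mpsplit x p) i) \<subseteq> mpvars p - {x}" 
  proof (rule mpoly_induct[where P = "\<lambda>q. \<forall>i. mpvars (coeff (mpsplit x q) i) \<subseteq> mpvars p - {x}"])
    fix q r :: "('v, 'a) mpoly"
    assume *: "\<forall>i. mpvars (coeff (mpsplit x q) i) \<subseteq> mpvars p - {x}"
       "\<forall>i. mpvars (coeff (mpsplit x r) i) \<subseteq> mpvars p - {x}"
    then show "\<forall>i. mpvars (coeff (mpsplit x (q + r)) i) \<subseteq> mpvars p - {x}"
      by (auto simp: mpsplit.hom_add intro!: order_trans[OF mpvars_add] Un_least)
    show "\<forall>i. mpvars (coeff (mpsplit x (q * r)) i) \<subseteq> mpvars p - {x}"
      unfolding mpsplit.hom_mult using * by (intro allI mpvars_coeff_mult_le) auto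
  qed (auto simp: mpsplit_var coeff_pCons split: nat.splits)
  then show ?thesis by blast
qed

lemma degree_mpsplit_eq_0_iff: "degree (mpsplit x p) = 0 \<longleftrightarrow> x \<notin> mpvars p"
proof
  assume "degree (mpsplit x p) = 0"
  then obtain a where a: "mpsplit x p = [:a:]" by (meson degree_eq_zeroE)
  then have "p = a" using poly_mpsplit[of x p] by simp
  then show "x \<notin> mpvars p" using a mpvars_coeff_mpsplit[of x p 0] by auto
qed (simp add: mpsplit_free)

lemma mpsplit_eq_0_iff [simp]: "mpsplit x p = 0 \<longleftrightarrow> p = 0"
  using poly_mpsplit[of x p] by (auto simp del: poly_mpsplit)

lemma mpgrade_eq_0_iff [simp]: "mpgrade w p = 0 \<longleftrightarrow> p = 0"
  using poly_mpgrade[of w p] by (auto simp del: poly_mpgrade)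

lemma comm_semiring_hom_poly_map:
  assumes "comm_semiring_hom h"
  shows "comm_semiring_hom (\<lambda>q. poly (map_poly h q) y)"
proof -
  interpret h: comm_semiring_hom h by fact
  interpret hp: map_poly_comm_semiring_hom h ..
  show ?thesis by unfold_locales (simp_all add: hp.hom_add hp.hom_mult)
qed

lemma mpeval_mpsplit: "mpeval (a(x := s)) p = poly (map_poly (mpeval a) (mpsplit x p)) s"
proof -
  have "poly (map_poly (mpeval a) (mpsplit x p)) s =
      mpsubst (\<lambda>c. poly (map_poly (mpeval a) [:mpconst c:]) s)
        (\<lambda>v. poly (map_poly (mpeval a) (if v = x then [:0, 1:] else [:mpvar v:])) s) p"
    unfolding mpsplit_def
    by (rule comm_semiring_hom.hom_mpsubst[OF comm_semiring_hom_poly_map]) (rule mpeval.comm_semiring_hom_axioms)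
  also have "\<dots> = mpeval (a(x := s)) p"
    unfolding mpeval_eq_mpsubst[of "a(x := s)"]
    by (rule arg_cong2[of _ _ _ _ "\<lambda>f g. mpsubst f g p"]) (auto simp: mpeval.map_poly_pCons_hom)
  finally show ?thesis by simp
qed

lemma mpeval_mpgrade: "mpeval (\<lambda>v. s ^ w v * b v) p = poly (map_poly (mpeval b) (mpgrade w p)) s"
proof -
  have "poly (map_poly (mpeval b) (mpgrade w p)) s =
      mpsubst (\<lambda>c. poly (map_poly (mpeval b) [:mpconst c:]) s)
        (\<lambda>v. poly (map_poly (mpeval b) (monom (mpvar v) (w v))) s) p"
    unfolding mpgrade_def
    by (rule comm_semiring_hom.hom_mpsubst[OF comm_semiring_hom_poly_map]) (rule mpeval.comm_semiring_hom_axioms)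
  also have "\<dots> = mpeval (\<lambda>v. s ^ w v * b v) p"
    unfolding mpeval_eq_mpsubst[of "\<lambda>v. s ^ w v * b v"]
    by (rule arg_cong2[of _ _ _ _ "\<lambda>f g. mpsubst f g p"]) (auto simp: map_poly_monom poly_monom mpeval.map_poly_pCons_hom mult.commute)
  finally show ?thesis by simp
qed

lemma mpeval_mpsubst: "mpeval a (mpsubst mpconst t p) = mpeval (\<lambda>v. mpeval a (t v)) p"
  unfolding mpeval.hom_mpsubst mpeval_eq_mpsubst[of "\<lambda>v. mpeval a (t v)"] by simp

section \<open>Unique factorization\<close>

text \<open>Occurrence of \<open>x\<close> means positive degree in \<open>x\<close>, and degrees
  add in a domain. The linear order on the variables supplies the domain instance of the polynomial
  type.\<close>

lemma mpvars_mult_eq: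
  fixes p q :: "('v::linorder, 'a::idom) mpoly"
  assumes "p \<noteq> 0" "q \<noteq> 0"
  shows "mpvars (p * q) = mpvars p \<union> mpvars q"
proof -
  have "x \<in> mpvars (p * q) \<longleftrightarrow> x \<in> mpvars p \<union> mpvars q" for x
    using assms degree_mult_eq[of "mpsplit x p" "mpsplit x q"]
      degree_mpsplit_eq_0_iff[of x p] degree_mpsplit_eq_0_iff[of x q] degree_mpsplit_eq_0_iff[of x "p * q"]
    by (auto simp: mpsplit.hom_mult)
  then show ?thesis by blast
qed

lemma mpvars_dvd:
  fixes p q :: "('v::linorder, 'a::idom) mpoly"
  assumes "p dvd q" "q \<noteq> 0"
  shows "mpvars p \<subseteq> mpvars q"
  using assms by (auto elim!: dvdE simp: mpvars_mult_eq)

abbreviation mpdeg :: "('v, 'a::comm_semiring_1) mpoly \<Rightarrow> nat" where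
  "mpdeg p \<equiv> degree (mpgrade (\<lambda>_. Suc 0) p)"

lemma mpdeg_mult:
  fixes p q :: "('v::linorder, 'a::idom) mpoly"
  assumes "p \<noteq> 0" "q \<noteq> 0"
  shows "mpdeg (p * q) = mpdeg p + mpdeg q"
  using assms by (simp add: mpgrade.hom_mult degree_mult_eq)

text \<open>The graded polynomial is constant, so its value at 1, which is \<open>p\<close>, equals
  its value at 0, where all variables have been replaced by 0.\<close>

lemma mpdeg_eq_0_imp_const:
  fixes p :: "('v, 'a::comm_semiring_1) mpoly"
  assumes "mpdeg p = 0" shows "\<exists>c. p = mpconst c"
proof -
  from assms obtain a where a: "mpgrade (\<lambda>_. Suc 0) p = [:a:]" by (meson degree_eq_zeroE)
  have "poly (mpgrade (\<lambda>_. Suc 0) p) 0 = mpsubst mpconst (\<lambda>_. mpconst 0) p"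
    unfolding mpgrade_def comm_semiring_hom.hom_mpsubst[OF comm_semiring_hom_poly]
    by (rule arg_cong2[of _ _ _ _ "\<lambda>f g. mpsubst f g p"]) (auto simp: poly_monom mpconst_def)
  also have "\<dots> = mpconst (mpsubst (\<lambda>c. c) (\<lambda>_. 0) p)"
    by (simp add: comm_semiring_hom.hom_mpsubst[OF comm_semiring_hom_mpconst])
  finally show ?thesis
    using a poly_mpgrade[of "\<lambda>_. Suc 0" p] by (auto intro: sym)
qed

lemma mpconst_eq_0_iff [simp]: "mpconst c = 0 \<longleftrightarrow> c = 0"
  by (metis comm_semiring_hom_mpconst mpeval_const mpeval.hom_zero mpconst_def single_zero)

lemma mpconst_one [simp]: "mpconst 1 = 1"
  by (simp add: mpconst_def)

lemma mpconst_mult: "mpconst (a * b) = mpconst a * mpconst b"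
  by (simp add: mpconst_def mult_single)

lemma mpvar_neq_0 [simp]: "(mpvar v :: ('v, 'a::comm_semiring_1) mpoly) \<noteq> 0"
  by (metis mpvars_var mpvars_zero insert_not_empty)

lemma mp_unit_iff:
  fixes p :: "('v::linorder, 'a::field) mpoly"
  shows "p dvd 1 \<longleftrightarrow> p \<noteq> 0 \<and> mpdeg p = 0"
proof
  assume "p dvd 1"
  then obtain q where q: "1 = p * q" by (auto elim: dvdE)
  then have "p \<noteq> 0" "q \<noteq> 0" by auto
  with mpdeg_mult[of p q] q show "p \<noteq> 0 \<and> mpdeg p = 0" by (simp add: mpgrade.hom_one flip: q)
next
  assume *: "p \<noteq> 0 \<and> mpdeg p = 0"
  then obtain c where "p = mpconst c" using mpdeg_eq_0_imp_const by blast
  with * have "1 = p * mpconst (inverse c)" by (simp flip: mpconst_mult)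
  then show "p dvd 1" by (rule dvdI)
qed

lemma mp_unitE:
  fixes p :: "('v::linorder, 'a::field) mpoly"
  assumes "p dvd 1" obtains c where "p = mpconst c" "c \<noteq> 0"
  using assms mpdeg_eq_0_imp_const[of p] unfolding mp_unit_iff by fastforce

text \<open>Induction on the number of occurring variables: the leading coefficient in
  \<open>x\<close> has fewer of them and is nonzero somewhere, and the univariate polynomial that
  remains has finitely many roots.\<close>

lemma mpeval_all_zero:
  fixes p :: "('v::linorder, 'a::{idom, ring_char_0}) mpoly"
  assumes "\<And>a. mpeval a p = 0"
  shows "p = 0"
proof (rule ccontr)
  assume "p \<noteq> 0"
  have "\<exists>a. mpeval a p \<noteq> 0" if "p \<noteq> 0" for p :: "('v, 'a) mpoly"
    using that
  proof (induction "card (mpvars p)" arbitrary: p rule: less_induct)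
    case less
    show ?case
    proof (cases "mpvars p = {}")
      case True
      from mpvars_empty_imp_const[OF True] less.prems show ?thesis by (metis mpeval_const mpconst_eq_0_iff)
    next
      case False
      then obtain x where x: "x \<in> mpvars p" by auto
      define l where "l = lead_coeff (mpsplit x p)"
      have "mpvars l \<subseteq> mpvars p - {x}" unfolding l_def by (rule mpvars_coeff_mpsplit)
      with x have "mpvars l \<subset> mpvars p" by auto
      then have "card (mpvars l) < card (mpvars p)" by (simp add: psubset_card_mono)
      moreover have "l \<noteq> 0" using less.prems by (simp add: l_def)
      ultimately obtain a where a: "mpeval a l \<noteq> 0" using less.hyps by blast
      have "coeff (map_poly (mpeval a) (mpsplit x p)) (degree (mpsplit x p)) = mpeval a l"
        by (simp add: coeff_map_poly l_def)
      with a have "map_poly (mpeval a) (mpsplit x p) \<noteq> 0" by (metis coeff_0)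
      then have "finite {s. poly (map_poly (mpeval a) (mpsplit x p)) s = 0}" by (rule poly_roots_finite)
      then obtain s where "poly (map_poly (mpeval a) (mpsplit x p)) s \<noteq> 0"
        using infinite_UNIV_char_0 by (metis (mono_tags, lifting) UNIV_eq_I mem_Collect_eq)
      then show ?thesis by (metis mpeval_mpsplit)
    qed
  qed
  with \<open>p \<noteq> 0\<close> assms show False by blast
qed

lemma mpoly_eqI:
  fixes p q :: "('v::linorder, 'a::{idom, ring_char_0}) mpoly"
  assumes "\<And>c. mpeval c p = mpeval c q" shows "p = q"
  using mpeval_all_zero[of "p - q"] assms by (simp add: mpeval_ring.hom_minus)

section \<open>Pseudo-division with respect to one variable\<close>

abbreviation degx :: "'v \<Rightarrow> ('v, 'a::comm_semiring_1) mpoly \<Rightarrow> nat" where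
  "degx x p \<equiv> degree (mpsplit x p)"

abbreviation lcx :: "'v \<Rightarrow> ('v, 'a::comm_semiring_1) mpoly \<Rightarrow> ('v, 'a) mpoly" where
  "lcx x p \<equiv> lead_coeff (mpsplit x p)"

lemma lcx_free: "x \<notin> mpvars (lcx x p)" "mpvars (lcx x p) \<subseteq> mpvars p - {x}"
  using mpvars_coeff_mpsplit[of x p] by auto

lemma mpsplit_lcx [simp]: "mpsplit x (lcx x p) = [:lcx x p:]"
  by (rule mpsplit_free) (rule lcx_free)

lemma mpsplit_self_power: "mpsplit x (mpvar x ^ e) = monom 1 e"
proof -
  have "mpsplit x (mpvar x ^ e) = [:0, 1:] ^ e"
    by (simp add: mpsplit.hom_power mpsplit_var)
  then show ?thesis by (simp add: monom_altdef)
qed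

text \<open>Cross-multiplying by the leading coefficients cancels the top power of \<open>x\<close>
  without any division in the coefficient ring.\<close>

lemma degx_reduce:
  fixes f h :: "('v, 'a::comm_ring_1) mpoly"
  assumes "degx x h \<le> degx x f"
  defines "r \<equiv> lcx x h * f - lcx x f * mpvar x ^ (degx x f - degx x h) * h"
  shows "r = 0 \<or> degx x r < degx x f"
proof -
  have "mpsplit x r = Polynomial.smult (lcx x h) (mpsplit x f) - Polynomial.smult (lcx x f) (monom 1 (degx x f - degx x h) * mpsplit x h)"
    unfolding r_def by (simp add: mpsplit_ring.hom_minus mpsplit.hom_mult mpsplit_self_power)
  moreover have "degree (monom 1 (degx x f - degx x h) * mpsplit x h) \<le> degx x f"
    using assms(1) degree_mult_le[of "monom 1 (degx x f - degx x h)" "mpsplit x h"] degree_monom_le[of "1::('v,'a) mpoly" "degx x f - degx x h"]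
    by linarith
  moreover have "coeff (monom 1 (degx x f - degx x h) * mpsplit x h) (degx x f) = lcx x h"
    using assms(1) by (simp add: coeff_monom_mult)
  ultimately have "degree (mpsplit x r) \<le> degx x f" "coeff (mpsplit x r) (degx x f) = 0"
    by (auto intro!: degree_diff_le order_trans[OF degree_smult_le] simp: mult.commute)
  then show ?thesis using eq_zero_or_degree_less[of "mpsplit x r" "degx x f"] by auto
qed

text \<open>Replaces Euclidean division over the field of fractions. By minimality of
  \<open>h\<close>, pseudo-division inside \<open>I\<close> cannot stop at a nonzero remainder, and
  the accumulated multiplier is a power of the leading coefficient of \<open>h\<close>, hence
  nonzero and free of \<open>x\<close>.\<close>

lemma minimal_degx_pseudo_dvd:
  fixes h :: "('v::linorder, 'a::idom) mpoly"
  assumes "h \<in> I" "h \<noteq> 0" and min: "\<And>e. e \<in> I \<Longrightarrow> e \<noteq> 0 \<Longrightarrow> degx x h \<le> degx x e"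
    and vars: "\<And>e. e \<in> I \<Longrightarrow> mpvars e \<subseteq> W" "x \<in> W"
    and closed: "\<And>c d e. mpvars c \<subseteq> W \<Longrightarrow> mpvars d \<subseteq> W \<Longrightarrow> e \<in> I \<Longrightarrow> c * e - d * h \<in> I"
    and "e \<in> I"
  shows "\<exists>a. a \<noteq> 0 \<and> mpvars a \<subseteq> W - {x} \<and> h dvd a * e"
  using \<open>e \<in> I\<close>
proof (induction "degx x e" arbitrary: e rule: less_induct)
  case less
  show ?case
  proof (cases "e = 0")
    case True
    then show ?thesis by (intro exI[of _ 1]) auto
  next
    case False
    define d where "d = lcx x e * mpvar x ^ (degx x e - degx x h)"
    define r where "r = lcx x h * e - d * h"
    have vd: "mpvars d \<subseteq> W"
      unfolding d_def using vars less.prems lcx_free[of x e]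
      by (intro order_trans[OF mpvars_mult] Un_least order_trans[OF mpvars_power]) auto
    have vh: "mpvars (lcx x h) \<subseteq> W - {x}" using vars assms(1) lcx_free[of x h] by blast
    have "r \<in> I" unfolding r_def using vd vh less.prems by (intro closed) auto
    moreover have "r = 0 \<or> degx x r < degx x e"
      unfolding r_def d_def by (rule degx_reduce) (rule min[OF less.prems False])
    ultimately obtain a where a: "a \<noteq> 0" "mpvars a \<subseteq> W - {x}" "h dvd a * r"
    proof (cases "r = 0")
      case True
      show ?thesis by (rule that[of 1]) (auto simp: True)
    next
      case False
      with \<open>r = 0 \<or> _\<close> \<open>r \<in> I\<close> less.hyps[of r] show ?thesis using that by blast
    qed
    have "(a * lcx x h) * e = a * r + a * d * h" by (simp add: r_def algebra_simps)
    with a(3) have "h dvd (a * lcx x h) * e" by simp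
    moreover have "a * lcx x h \<noteq> 0" using a assms(2) by simp
    moreover have "mpvars (a * lcx x h) \<subseteq> W - {x}"
      using a vh by (intro order_trans[OF mpvars_mult] Un_least)
    ultimately show ?thesis by blast
  qed
qed

text \<open>Gauss's argument by leading coefficients in \<open>x\<close>: \<open>q\<close> divides
  their product, hence one of them, and subtracting the corresponding leading term keeps
  divisibility while lowering the degree.\<close>

lemma gauss_lemma_step:
  fixes q :: "('v::linorder, 'a::idom) mpoly"
  assumes q: "q \<noteq> 0" "mpvars q \<subseteq> V" "x \<notin> V"
    and prime: "\<And>f g. mpvars f \<subseteq> V \<Longrightarrow> mpvars g \<subseteq> V \<Longrightarrow> q dvd f * g \<Longrightarrow> q dvd f \<or> q dvd g"
    and fg: "mpvars f \<subseteq> insert x V" "mpvars g \<subseteq> insert x V" "q dvd f * g"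
  shows "q dvd f \<or> q dvd g"
  using fg
proof (induction "degx x f + degx x g" arbitrary: f g rule: less_induct)
  case less
  have main: "q dvd f \<or> q dvd g" if lc: "q dvd lcx x f" and nz: "f \<noteq> 0" "g \<noteq> 0"
      and fg: "mpvars f \<subseteq> insert x V" "mpvars g \<subseteq> insert x V" "q dvd f * g"
      and IH: "\<And>f'. degx x f' < degx x f \<Longrightarrow> mpvars f' \<subseteq> insert x V \<Longrightarrow> q dvd f' * g \<Longrightarrow> q dvd f' \<or> q dvd g"
    for f g
  proof -
    define t where "t = lcx x f * mpvar x ^ degx x f"
    define f' where "f' = f - t"
    have t: "q dvd t" using lc by (simp add: t_def)
    have "f' = 0 \<or> degx x f' < degx x f"
      using degx_reduce[of x 1 f] by (simp add: f'_def t_def mpsplit.hom_one)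
    moreover have "mpvars f' \<subseteq> insert x V"
      unfolding f'_def t_def using fg(1) lcx_free[of x f]
      by (intro order_trans[OF mpvars_diff] order_trans[OF mpvars_mult] Un_least order_trans[OF mpvars_power]) auto
    moreover have "q dvd f' * g" using t fg(3) by (simp add: f'_def left_diff_distrib)
    ultimately have "q dvd f' \<or> q dvd g" using IH by auto
    moreover have "q dvd f" if "q dvd f'"
      using dvd_add[OF that t] by (simp add: f'_def)
    ultimately show ?thesis by blast
  qed
  show ?case
  proof (cases "f = 0 \<or> g = 0")
    case False
    then have nz: "f \<noteq> 0" "g \<noteq> 0" by auto
    from less.prems(3) obtain w where w: "f * g = q * w" by (auto elim: dvdE)
    then have "mpsplit x f * mpsplit x g = mpsplit x q * mpsplit x w"
      by (metis mpsplit.hom_mult)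
    moreover have "x \<notin> mpvars q" using q by auto
    ultimately have "mpsplit x f * mpsplit x g = [:q:] * mpsplit x w" by (simp add: mpsplit_free)
    from arg_cong[OF this, of lead_coeff] have "lcx x f * lcx x g = q * lcx x w"
      unfolding lead_coeff_mult by simp
    then have "q dvd lcx x f * lcx x g" by simp
    then have "q dvd lcx x f \<or> q dvd lcx x g"
      using less.prems lcx_free[of x f] lcx_free[of x g] by (intro prime) auto
    then show ?thesis
    proof
      assume lc: "q dvd lcx x f"
      show ?thesis
      proof (rule main[OF lc nz less.prems])
        fix f' assume "degx x f' < degx x f" "mpvars f' \<subseteq> insert x V" "q dvd f' * g"
        then show "q dvd f' \<or> q dvd g" using less.prems(2) by (intro less.hyps) auto
      qed
    next
      assume lc: "q dvd lcx x g"
      have "q dvd g \<or> q dvd f"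
      proof (rule main[OF lc nz(2,1) less.prems(2,1)])
        fix g' assume "degx x g' < degx x g" "mpvars g' \<subseteq> insert x V" "q dvd g' * f"
        then have "q dvd f \<or> q dvd g'" using less.prems(1) by (intro less.hyps) (auto simp: mult.commute)
        then show "q dvd g' \<or> q dvd f" by blast
      qed (use less.prems(3) in \<open>simp add: mult.commute\<close>)
      then show ?thesis by blast
    qed
  qed auto
qed

section \<open>Irreducible polynomials are prime\<close>

lemma irreducible_factor_exists:
  fixes a :: "('v::linorder, 'a::field) mpoly"
  assumes "a \<noteq> 0" "\<not> a dvd 1"
  shows "\<exists>q. irreducible q \<and> q dvd a"
  using assms
proof (induction "mpdeg a" arbitrary: a rule: less_induct)
  case less
  show ?case
  proof (cases "irreducible a")
    case False
    with less.prems obtain u v where uv: "a = u * v" "\<not> u dvd 1" "\<not> v dvd 1"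
      unfolding irreducible_def by blast
    with less.prems have nz: "u \<noteq> 0" "v \<noteq> 0" by auto
    with uv(3) have "mpdeg v > 0" by (simp add: mp_unit_iff)
    with nz have "mpdeg u < mpdeg a" by (simp add: uv(1) mpdeg_mult)
    with less.hyps nz uv obtain q where "irreducible q" "q dvd u" by blast
    then show ?thesis by (auto simp: uv(1))
  qed auto
qed

text \<open>Drives the inductions in which a multiplier free of \<open>x\<close> is used up one
  irreducible factor at a time.\<close>

lemma irreducible_factor_cases:
  fixes a :: "('v::linorder, 'a::field) mpoly"
  assumes "a \<noteq> 0" "mpvars a \<subseteq> V"
  obtains "a dvd 1" | q a' where "irreducible q" "a = q * a'" "a' \<noteq> 0" "mpvars q \<subseteq> V" "mpvars a' \<subseteq> V" "mpdeg a' < mpdeg a"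
proof (cases "a dvd 1")
  case False
  with irreducible_factor_exists assms(1) obtain q where q: "irreducible q" "q dvd a" by blast
  then obtain a' where a': "a = q * a'" by (auto elim: dvdE)
  have nz: "q \<noteq> 0" "a' \<noteq> 0" using assms(1) a' by auto
  then have "mpvars q \<subseteq> V" "mpvars a' \<subseteq> V" using assms(2) by (auto simp: a' mpvars_mult_eq)
  moreover have "mpdeg q > 0" using q(1) nz by (auto simp: irreducible_def mp_unit_iff)
  then have "mpdeg a' < mpdeg a" using nz by (simp add: a' mpdeg_mult)
  ultimately show ?thesis using that q a' nz by blast
qed

text \<open>The cofactor of a nonunit divisor of \<open>p\<close> is a unit, hence a constant, and
  cannot supply the variable \<open>x\<close>.\<close>

lemma not_dvd_irreducible_free:
  fixes p :: "('v::linorder, 'a::field) mpoly"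
  assumes "irreducible p" "x \<in> mpvars p" "\<not> q dvd 1" "x \<notin> mpvars q"
  shows "\<not> q dvd p"
proof
  assume "q dvd p"
  then obtain c where c: "p = q * c" by (auto elim: dvdE)
  with assms have "c dvd 1" by (auto simp: irreducible_def)
  then have "mpvars c = {}" by (elim mp_unitE) auto
  with c assms(2,4) mpvars_mult[of q c] show False by auto
qed

text \<open>The induction step of factoriality: \<open>x\<close> is the new variable and occurs in
  \<open>p\<close>, while \<open>prime\<close> provides the irreducible polynomials without
  \<open>x\<close> as primes of the larger ring.\<close>

locale prime_step =
  fixes V :: "'v::linorder set" and x :: 'v and p :: "('v, 'a::field) mpoly"
  assumes x: "x \<notin> V" and p: "irreducible p" "x \<in> mpvars p" "mpvars p \<subseteq> insert x V"
    and prime: "\<And>q f g :: ('v, 'a) mpoly. irreducible q \<Longrightarrow> mpvars q \<subseteq> V \<Longrightarrow> mpvars f \<subseteq> insert x V \<Longrightarrow> mpvars g \<subseteq> insert x V \<Longrightarrow>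
        q dvd f * g \<Longrightarrow> q dvd f \<or> q dvd g"
begin

lemma p_nz: "p \<noteq> 0" using p by auto

text \<open>Each irreducible factor \<open>q\<close> of \<open>a\<close> is prime and does not
  divide \<open>p\<close>, so it divides the cofactor \<open>u\<close> in
  \<open>a * h = p * u\<close> and can be cancelled; in the end only a unit is left of
  \<open>a\<close>.\<close>

lemma dvd_cancel_free:
  assumes "a \<noteq> 0" "mpvars a \<subseteq> V" "mpvars h \<subseteq> insert x V" "p dvd a * h"
  shows "p dvd h"
  using assms
proof (induction "mpdeg a" arbitrary: a rule: less_induct)
  case less
  show ?case
  proof (cases "h = 0")
    case False
    from less.prems(4) obtain u where u: "a * h = p * u" by (auto elim: dvdE)
    with False less.prems(1) have "u \<noteq> 0" by auto
    then have vu: "mpvars u \<subseteq> insert x V"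
      using mpvars_mult_eq[OF p_nz, of u] mpvars_mult[of a h] less.prems unfolding u[symmetric] by blast
    show ?thesis
      using less.prems(1,2)
    proof (cases rule: irreducible_factor_cases)
      case 1
      then obtain c where c: "1 = a * c" by (auto elim: dvdE)
      have "h = (a * h) * c" using c by (metis mult.commute mult.left_commute mult_1)
      then have "h = p * (u * c)" using u by (simp add: mult.assoc)
      then show ?thesis by simp
    next
      case (2 q a')
      have "q dvd p * u" using u 2(2) by (metis dvd_triv_left mult.assoc)
      moreover have "\<not> q dvd p"
        by (rule not_dvd_irreducible_free[OF p(1,2)]) (use 2 x in \<open>auto simp: irreducible_def\<close>)
      ultimately have "q dvd u" using prime[OF 2(1,4) p(3) vu] by blast
      then obtain u' where "u = q * u'" by (auto elim: dvdE)
      with u 2 have "q * (a' * h) = q * (p * u')" by (simp add: ac_simps)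
      moreover have "q \<noteq> 0" using 2 by auto
      ultimately have "p dvd a' * h" by simp
      with less.hyps[of a'] 2 less.prems show ?thesis by blast
    qed
  qed auto
qed

text \<open>The irreducible factors of \<open>a\<close> are cancelled against \<open>h\<close> or
  \<open>v\<close>. They omit \<open>x\<close>, so the variable stays in \<open>h\<close>; finally
  \<open>p\<close> is \<open>h\<close> times a cofactor, which is a unit because \<open>h\<close> is
  not.\<close>

lemma dvd_of_mult_eq_free_mult:
  assumes "a \<noteq> 0" "mpvars a \<subseteq> V" "h * v = a * p" "x \<in> mpvars h" "mpvars h \<subseteq> insert x V"
    "mpvars v \<subseteq> insert x V"
  shows "p dvd h"
  using assms
proof (induction "mpdeg a" arbitrary: a h v rule: less_induct)
  case less
  have nz: "h \<noteq> 0" "v \<noteq> 0" using less.prems(1,3) p_nz by (metis mult_eq_0_iff)+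
  show ?case
    using less.prems(1,2)
  proof (cases rule: irreducible_factor_cases)
    case 1
    then obtain c where c: "1 = a * c" by (auto elim: dvdE)
    have "p = (h * v) * c" using c less.prems(3) by (metis mult.commute mult.left_commute mult_1)
    then have pe: "p = h * (v * c)" by (simp add: ac_simps)
    with p(1) have "h dvd 1 \<or> v * c dvd 1" unfolding irreducible_def by blast
    moreover have "\<not> h dvd 1" using less.prems(4) by (auto elim: mp_unitE)
    ultimately have "v * c dvd 1" by blast
    then obtain e where "1 = v * c * e" by (rule dvdE)
    then have "h = p * e" unfolding pe by (metis mult.assoc mult_1_right)
    then show ?thesis by simp
  next
    case (2 q a')
    have "q dvd h * v" using less.prems(3) 2 by (simp add: mult.assoc)
    then have "q dvd h \<or> q dvd v" using prime[OF 2(1,4)] less.prems by blast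
    then show ?thesis
    proof
      assume "q dvd h"
      then obtain h' where h': "h = q * h'" by (auto elim: dvdE)
      with nz have nz': "h' \<noteq> 0" "q \<noteq> 0" by auto
      have "q * (h' * v) = q * (a' * p)" using less.prems(3) by (simp add: h' 2(2) ac_simps)
      then have "h' * v = a' * p" using nz' by simp
      moreover have "mpvars h' \<subseteq> insert x V" "x \<in> mpvars h'"
        using less.prems(4,5) 2 x by (auto simp: h' mpvars_mult_eq nz')
      ultimately have "p dvd h'" using less.hyps[of a' h' v] 2 less.prems by blast
      then show ?thesis by (simp add: h')
    next
      assume "q dvd v"
      then obtain v' where v': "v = q * v'" by (auto elim: dvdE)
      with nz have nz': "v' \<noteq> 0" "q \<noteq> 0" by auto
      have "q * (h * v') = q * (a' * p)" using less.prems(3) by (simp add: v' 2(2) ac_simps)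
      then have "h * v' = a' * p" using nz' by simp
      moreover have "mpvars v' \<subseteq> insert x V"
        using less.prems(6) by (auto simp: v' mpvars_mult_eq nz')
      ultimately show ?thesis using less.hyps[of a' h v'] 2 less.prems by blast
    qed
  qed
qed

text \<open>The set \<open>I\<close> of all \<open>e\<close> with \<open>p dvd e * g\<close>
  contains \<open>p\<close> and \<open>f\<close>. Up to factors free of \<open>x\<close>, its
  element \<open>h\<close> of least degree in \<open>x\<close> divides both. If \<open>h\<close>
  omits \<open>x\<close>, cancellation gives \<open>p dvd g\<close>; otherwise
  \<open>p dvd h\<close>, and this passes on to \<open>f\<close>.\<close>

lemma prime_p:
  assumes "mpvars f \<subseteq> insert x V" "mpvars g \<subseteq> insert x V" "p dvd f * g"
  shows "p dvd f \<or> p dvd g"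
proof (rule ccontr)
  assume contra: "\<not> (p dvd f \<or> p dvd g)"
  define W where "W = insert x V"
  define I where "I = {e. mpvars e \<subseteq> W \<and> p dvd e * g}"
  define h where "h = arg_min (degx x) (\<lambda>e. e \<in> I \<and> e \<noteq> 0)"
  have "p \<in> I \<and> p \<noteq> 0" using p p_nz by (auto simp: I_def W_def)
  then have h: "h \<in> I" "h \<noteq> 0" and min: "\<And>e. e \<in> I \<Longrightarrow> e \<noteq> 0 \<Longrightarrow> degx x h \<le> degx x e"
    using arg_min_nat_lemma[of "\<lambda>e. e \<in> I \<and> e \<noteq> 0" p "degx x"] unfolding h_def by auto
  have vh: "mpvars h \<subseteq> W" using h by (simp add: I_def)
  have div: "\<exists>a. a \<noteq> 0 \<and> mpvars a \<subseteq> W - {x} \<and> h dvd a * e" if "e \<in> I" for e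
  proof (rule minimal_degx_pseudo_dvd[OF h min _ _ _ that])
    fix c d e :: "('v, 'a) mpoly" assume cd: "mpvars c \<subseteq> W" "mpvars d \<subseteq> W" "e \<in> I"
    have "mpvars (c * e - d * h) \<subseteq> W"
      using cd vh by (intro order_trans[OF mpvars_diff] order_trans[OF mpvars_mult] Un_least) (auto simp: I_def)
    moreover have "(c * e - d * h) * g = c * (e * g) - d * (h * g)" by (simp add: algebra_simps)
    ultimately show "c * e - d * h \<in> I" using cd h by (simp add: I_def)
  qed (auto simp: I_def W_def)
  have Wx: "W - {x} = V" using x by (auto simp: W_def)
  show False
  proof (cases "x \<in> mpvars h")
    case False
    with vh have "mpvars h \<subseteq> V" by (auto simp: W_def)
    moreover have "p dvd h * g" using h by (simp add: I_def)
    ultimately show False using dvd_cancel_free[of h g] h assms contra by blast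
  next
    case True
    obtain a where a: "a \<noteq> 0" "mpvars a \<subseteq> V" "h dvd a * p"
      using div[of p] p Wx by (auto simp: I_def W_def)
    obtain b where b: "b \<noteq> 0" "mpvars b \<subseteq> V" "h dvd b * f"
      using div[of f] assms Wx by (auto simp: I_def W_def)
    from a(3) obtain v where v: "h * v = a * p" by (metis dvdE)
    have "a * p \<noteq> 0" using a p_nz by simp
    then have "v \<noteq> 0" unfolding v[symmetric] by auto
    then have "mpvars v \<subseteq> W"
      using mpvars_mult_eq[OF h(2), of v] mpvars_mult[of a p] a p unfolding v W_def by blast
    then have "p dvd h"
      using dvd_of_mult_eq_free_mult[OF a(1,2) v True] vh by (simp add: W_def)
    then have "p dvd b * f" using b(3) by (rule dvd_trans)
    then show False using dvd_cancel_free[OF b(1,2)] assms contra by blast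
  qed
qed

end

text \<open>Induction on the finite set of variables that occur. The base case is void, since
  constants over a field are never irreducible; in the step Gauss's lemma treats the irreducible
  polynomials without the new variable and \<open>prime_p\<close> the others.\<close>

lemma irreducible_dvd_mult_mpoly:
  fixes p :: "('v::linorder, 'a::field) mpoly"
  assumes "irreducible p" "p dvd f * g"
  shows "p dvd f \<or> p dvd g"
proof -
  have "\<forall>p f g :: ('v, 'a) mpoly. irreducible p \<longrightarrow> mpvars p \<subseteq> V \<longrightarrow> mpvars f \<subseteq> V \<longrightarrow> mpvars g \<subseteq> V \<longrightarrow>
      p dvd f * g \<longrightarrow> p dvd f \<or> p dvd g" if "finite V" for V :: "'v set"
    using that
  proof (induction V)
    case empty
    show ?case
    proof (intro allI impI)
      fix p f g :: "('v, 'a) mpoly"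
      assume "irreducible p" "mpvars p \<subseteq> {}"
      from this(2) obtain c where "p = mpconst c" using mpvars_empty_imp_const[of p] by blast
      then have "mpdeg p = 0" by simp
      moreover have "p \<noteq> 0" "\<not> p dvd 1" using \<open>irreducible p\<close> unfolding irreducible_def by blast+
      ultimately show "p dvd f \<or> p dvd g" unfolding mp_unit_iff by blast
    qed
  next
    case (insert x V)
    have free: "q dvd f \<or> q dvd g" if "irreducible q" "mpvars q \<subseteq> V" "mpvars f \<subseteq> insert x V" "mpvars g \<subseteq> insert x V"
        "q dvd f * g" for q f g :: "('v, 'a) mpoly"
    proof (rule gauss_lemma_step[of q V x f g])
      fix f g assume "mpvars f \<subseteq> V" "mpvars g \<subseteq> V" "q dvd f * g"
      with that(1,2) show "q dvd f \<or> q dvd g" by (rule insert.IH[rule_format])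
    qed (use that insert in auto)
    show ?case
    proof (intro allI impI)
      fix p f g :: "('v, 'a) mpoly"
      assume *: "irreducible p" "mpvars p \<subseteq> insert x V" "mpvars f \<subseteq> insert x V" "mpvars g \<subseteq> insert x V" "p dvd f * g"
      show "p dvd f \<or> p dvd g"
      proof (cases "x \<in> mpvars p")
        case True
        interpret prime_step V x p
          by (rule prime_step.intro) (fact insert.hyps * True free)+
        show ?thesis by (rule prime_p) (fact *)+
      next
        case False
        with * have "mpvars p \<subseteq> V" by blast
        then show ?thesis using * by (intro free)
      qed
    qed
  qed
  note * = this
  show ?thesis
    by (rule *[rule_format, of "mpvars p \<union> mpvars f \<union> mpvars g"]) (use assms in auto)
qed

text \<open>In the ideal of \<open>p\<close> and \<open>b\<close> the element \<open>h\<close> of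
  least degree in \<open>x\<close> is the wanted one: if it contained \<open>x\<close>, it would
  divide \<open>a * p\<close> and \<open>a' * b\<close> with nonzero \<open>a\<close>,
  \<open>a'\<close> free of \<open>x\<close>, and the primality of \<open>p\<close> excludes
  this.\<close>

lemma irreducible_eliminate_var:
  fixes p :: "('v::linorder, 'a::field) mpoly"
  assumes p: "irreducible p" "x \<in> mpvars p" and b: "\<not> p dvd b"
  shows "\<exists>u v. u * p + v * b \<noteq> 0 \<and> x \<notin> mpvars (u * p + v * b)"
proof -
  define I where "I = {e. \<exists>u v. e = u * p + v * b}"
  define h where "h = arg_min (degx x) (\<lambda>e. e \<in> I \<and> e \<noteq> 0)"
  have p0: "p \<noteq> 0" using p by auto
  have "p = 1 * p + 0 * b" "b = 0 * p + 1 * b" by simp_all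
  then have pI: "p \<in> I" and bI: "b \<in> I" unfolding I_def by blast+
  have h: "h \<in> I" "h \<noteq> 0" and min: "\<And>e. e \<in> I \<Longrightarrow> e \<noteq> 0 \<Longrightarrow> degx x h \<le> degx x e"
    using arg_min_nat_lemma[of "\<lambda>e. e \<in> I \<and> e \<noteq> 0" p "degx x"] pI p0 unfolding h_def by auto
  from h(1) obtain u0 v0 where h0: "h = u0 * p + v0 * b" unfolding I_def by blast
  have div: "\<exists>a. a \<noteq> 0 \<and> mpvars a \<subseteq> UNIV - {x} \<and> h dvd a * e" if "e \<in> I" for e
  proof (rule minimal_degx_pseudo_dvd[OF h min _ _ _ that])
    fix c d e :: "('v, 'a) mpoly" assume "e \<in> I"
    then obtain u v where "e = u * p + v * b" unfolding I_def by blast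
    with h0 have "c * e - d * h = (c * u - d * u0) * p + (c * v - d * v0) * b" by (simp add: algebra_simps)
    then show "c * e - d * h \<in> I" unfolding I_def by blast
  qed auto
  have "x \<notin> mpvars h"
  proof
    assume xh: "x \<in> mpvars h"
    from div[OF pI] obtain a where a: "a \<noteq> 0" "x \<notin> mpvars a" "h dvd a * p" by blast
    from div[OF bI] obtain a' where a': "a' \<noteq> 0" "x \<notin> mpvars a'" "h dvd a' * b" by blast
    from a(3) obtain v where v: "h * v = a * p" by (metis dvdE)
    then have "p dvd h * v" by simp
    then have "p dvd h \<or> p dvd v" by (rule irreducible_dvd_mult_mpoly[OF p(1)])
    then show False
    proof
      assume "p dvd h"
      then have "p dvd a' * b" using a'(3) by (rule dvd_trans)
      then have "p dvd a'" using irreducible_dvd_mult_mpoly[OF p(1)] b by blast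
      then show False using mpvars_dvd a' p(2) by blast
    next
      assume "p dvd v"
      then obtain v' where "v = p * v'" by (auto elim: dvdE)
      with v have "p * (h * v') = p * a" by (simp add: ac_simps)
      with p0 have "h * v' = a" by simp
      then have "h dvd a" by (metis dvd_triv_left)
      then show False using mpvars_dvd a xh by blast
    qed
  qed
  then show ?thesis using h(2) h0 by blast
qed

section \<open>Polynomial functions of one variable\<close>

text \<open>Stated for functions, so that polynomial dependence on a parameter follows from closure
  rules where the polynomial itself is never written down.\<close>

definition polyfun :: "(complex \<Rightarrow> complex) \<Rightarrow> bool" where
  "polyfun f \<longleftrightarrow> (\<exists>p. \<forall>s. f s = poly p s)"

lemma polyfun_const [intro!]: "polyfun (\<lambda>s. c)"
  unfolding polyfun_def by (rule exI[of _ "[:c:]"]) simp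

lemma polyfun_id [intro!]: "polyfun (\<lambda>s. s)"
  unfolding polyfun_def by (rule exI[of _ "[:0, 1:]"]) simp

lemma polyfun_add [intro!]: "polyfun f \<Longrightarrow> polyfun g \<Longrightarrow> polyfun (\<lambda>s. f s + g s)"
  unfolding polyfun_def by (metis poly_add)

lemma polyfun_diff [intro!]: "polyfun f \<Longrightarrow> polyfun g \<Longrightarrow> polyfun (\<lambda>s. f s - g s)"
  unfolding polyfun_def by (metis poly_diff)

lemma polyfun_mult [intro!]: "polyfun f \<Longrightarrow> polyfun g \<Longrightarrow> polyfun (\<lambda>s. f s * g s)"
  unfolding polyfun_def by (metis poly_mult)

lemma polyfun_uminus [intro!]: "polyfun f \<Longrightarrow> polyfun (\<lambda>s. - f s)"
  unfolding polyfun_def by (metis poly_minus)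

lemma polyfun_power [intro!]: "polyfun f \<Longrightarrow> polyfun (\<lambda>s. f s ^ e)"
  unfolding polyfun_def by (metis poly_power)

lemma polyfun_sum [intro!]: "(\<And>i. i \<in> I \<Longrightarrow> polyfun (f i)) \<Longrightarrow> polyfun (\<lambda>s. \<Sum>i\<in>I. f i s)"
  by (induction I rule: infinite_finite_induct) auto

lemma polyfun_prod [intro!]: "(\<And>i. i \<in> I \<Longrightarrow> polyfun (f i)) \<Longrightarrow> polyfun (\<lambda>s. \<Prod>i\<in>I. f i s)"
  by (induction I rule: infinite_finite_induct) auto

lemma polyfun_moneval [intro!]: "(\<And>v. polyfun (\<lambda>s. c s v)) \<Longrightarrow> polyfun (\<lambda>s. moneval (c s) k)"
  unfolding moneval_def by auto

lemma polyfun_mpeval [intro!]: "(\<And>v. polyfun (\<lambda>s. c s v)) \<Longrightarrow> polyfun (\<lambda>s. mpeval (c s) p)"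
  unfolding mpeval_eq_mpsubst mpsubst_def by auto

text \<open>Irreducibility of the affine line: along a rational curve, a vanishing product has a
  vanishing factor.\<close>

lemma polyfun_mult_eq_0:
  assumes "polyfun f" "polyfun g" "\<And>s. f s * g s = 0"
  shows "(\<forall>s. f s = 0) \<or> (\<forall>s. g s = 0)"
proof -
  from assms(1,2) obtain p q where pq: "f = poly p" "g = poly q" unfolding polyfun_def by fast
  with assms(3) have "poly (p * q) s = 0" for s by simp
  then have "p * q = 0" using poly_all_0_iff_0 by blast
  then show ?thesis by (auto simp: pq)
qed

text \<open>Substitute for a limit at 0: \<open>f s * s\<close> vanishes identically.\<close>

lemma polyfun_eq_0_at_0:
  assumes "polyfun f" "\<And>s. s \<noteq> 0 \<Longrightarrow> f s = 0"
  shows "f 0 = 0"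
  using polyfun_mult_eq_0[OF assms(1) polyfun_id] assms(2) by (metis mult_eq_0_iff zero_neq_one)

section \<open>Homogeneous forms\<close>

lemma plookup_le_deg:
  assumes "k \<in> deg_monomials n d" shows "plookup k v \<le> d"
proof (cases "v < n")
  case True
  then have "plookup k v \<le> (\<Sum>v<n. plookup k v)" by (intro member_le_sum) auto
  with assms show ?thesis by (simp add: deg_monomials_def)
next
  case False
  with assms have "v \<notin> pkeys k" by (auto simp: deg_monomials_def)
  then show ?thesis by (simp add: in_keys_iff)
qed

lemma plookup_deg_outside: "k \<in> deg_monomials n d \<Longrightarrow> v \<notin> {..<n} \<Longrightarrow> plookup k v = 0"
  by (auto simp: deg_monomials_def in_keys_iff subset_iff)

lemma finite_deg_monomials [simp]: "finite (deg_monomials n d)"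
proof -
  have "plookup ` deg_monomials n d \<subseteq> {f. \<forall>v. (v \<in> {..<n} \<longrightarrow> f v \<in> {..d}) \<and> (v \<notin> {..<n} \<longrightarrow> f v = 0)}"
    by (intro image_subsetI CollectI allI conjI impI) (auto dest: plookup_le_deg plookup_deg_outside)
  moreover have "finite {f. \<forall>v. (v \<in> {..<n} \<longrightarrow> f v \<in> {..d}) \<and> (v \<notin> {..<n} \<longrightarrow> f v = (0::nat))}"
    by (intro finite_set_of_finite_funs) auto
  ultimately have "finite (plookup ` deg_monomials n d)" by (rule finite_subset)
  moreover have "inj_on plookup (deg_monomials n d)" by (rule inj_onI) (simp add: Poly_Mapping.lookup_inject)
  ultimately show ?thesis by (rule finite_imageD)
qed

lemma deg_monomials_add: "k \<in> deg_monomials n d \<Longrightarrow> l \<in> deg_monomials n e \<Longrightarrow> k + l \<in> deg_monomials n (d + e)"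
  using Poly_Mapping.keys_add[of k l] by (auto simp: deg_monomials_def lookup_add sum.distrib)

lemma psingle_deg_monomials: "i < n \<Longrightarrow> psingle i d \<in> deg_monomials n d"
  by (auto simp: deg_monomials_def lookup_single when_def)

lemma moneval_scale: "k \<in> deg_monomials n d \<Longrightarrow> moneval (\<lambda>j. t * x j) k = t ^ d * moneval x k"
  by (simp add: deg_monomials_def moneval_superset[of "{..<n}" k] power_mult_distrib prod.distrib flip: power_sum)

lemma moneval_cong_deg: "k \<in> deg_monomials n d \<Longrightarrow> (\<And>i. i < n \<Longrightarrow> x i = y i) \<Longrightarrow> moneval x k = moneval y k"
  by (rule moneval_cong) (auto simp: deg_monomials_def)

lemma homogeneous_poly_mult:
  "homogeneous_poly n d p \<Longrightarrow> homogeneous_poly n e q \<Longrightarrow> homogeneous_poly n (d + e) (p * q)"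
  unfolding homogeneous_poly_def using Poly_Mapping.keys_mult[of p q] deg_monomials_add by blast

lemma homogeneous_poly_one: "homogeneous_poly n 0 1"
  by (auto simp: homogeneous_poly_def deg_monomials_def)

lemma homogeneous_poly_power: "homogeneous_poly n d p \<Longrightarrow> homogeneous_poly n (e * d) (p ^ e)"
  by (induction e) (auto simp: homogeneous_poly_one homogeneous_poly_mult)

lemma homogeneous_poly_sum: "(\<And>i. i \<in> I \<Longrightarrow> homogeneous_poly n d (g i)) \<Longrightarrow> homogeneous_poly n d (\<Sum>i\<in>I. g i)"
  unfolding homogeneous_poly_def using Poly_Mapping.keys_sum[of g I] by blast

lemma homogeneous_poly_const_mult: "homogeneous_poly n d p \<Longrightarrow> homogeneous_poly n d (mpconst c * p)"
  using homogeneous_poly_mult[of n 0 "mpconst c" d p] by (auto simp: homogeneous_poly_def mpconst_def deg_monomials_def)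

lemma homogeneous_poly_var: "i < n \<Longrightarrow> homogeneous_poly n 1 (mpvar i :: (nat, 'a::comm_semiring_1) mpoly)"
  using psingle_deg_monomials[of i n 1] by (auto simp: homogeneous_poly_def mpvar_def)

lemma mpeval_homogeneous:
  assumes "homogeneous_poly n d p"
  shows "mpeval x p = (\<Sum>k\<in>deg_monomials n d. plookup p k * moneval x k)"
  unfolding mpeval_eq_mpsubst
  using assms by (intro comm_semiring_hom.mpsubst_superset[OF comm_semiring_hom_id]) (auto simp: homogeneous_poly_def)

lemma linear_form_power_coeffs:
  fixes a :: "nat \<Rightarrow> 'a::comm_semiring_1"
  obtains l where "\<And>x. (\<Sum>k\<in>deg_monomials n d. l k * moneval x k) = (\<Sum>i<n. a i * x i) ^ d"
proof -
  define p where "p = (\<Sum>i<n. mpconst (a i) * mpvar i) ^ d"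
  have "homogeneous_poly n (d * 1) p"
    unfolding p_def by (intro homogeneous_poly_power homogeneous_poly_sum homogeneous_poly_const_mult homogeneous_poly_var) auto
  then have "mpeval x p = (\<Sum>k\<in>deg_monomials n d. plookup p k * moneval x k)" for x
    by (intro mpeval_homogeneous) simp
  moreover have "mpeval x p = (\<Sum>i<n. a i * x i) ^ d" for x
    by (simp add: p_def mpeval.hom_power mpeval.hom_sum mpeval.hom_mult)
  ultimately show ?thesis using that[of "plookup p"] by simp
qed

text \<open>Coefficients on the moment curve: \<open>x\<close> and \<open>y\<close> define nonzero
  univariate polynomials, and the powers of any \<open>b\<close> that is a root of neither serve as
  \<open>a\<close>.\<close>

lemma common_nonvanishing_linear_form:
  fixes x y :: "nat \<Rightarrow> complex"
  assumes "\<exists>i<n. x i \<noteq> 0" "\<exists>i<n. y i \<noteq> 0"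
  obtains a where "(\<Sum>i<n. a i * x i) \<noteq> 0" "(\<Sum>i<n. a i * y i) \<noteq> 0"
proof -
  define p where "p = (\<lambda>z::nat \<Rightarrow> complex. \<Sum>i<n. monom (z i) i)"
  have "coeff (p z) i = z i" if "i < n" for z i
    using that by (simp add: p_def coeff_sum)
  with assms have "p x * p y \<noteq> 0" by (metis coeff_0 no_zero_divisors)
  then obtain b where b: "poly (p x * p y) b \<noteq> 0" using poly_all_0_iff_0 by blast
  have "poly (p z) b = (\<Sum>i<n. b ^ i * z i)" for z
    by (simp add: p_def poly_sum poly_monom mult.commute)
  with b show ?thesis using that[of "\<lambda>i. b ^ i"] by simp
qed

lemma mpvars_det:
  fixes A :: "nat \<Rightarrow> nat \<Rightarrow> ('v, 'a::comm_ring_1) mpoly"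
  assumes A: "\<And>i j. i < s \<Longrightarrow> j < s \<Longrightarrow> mpvars (A i j) \<subseteq> B"
  shows "mpvars (det (mat s s (\<lambda>(i, j). A i j))) \<subseteq> B"
proof -
  have "mpvars (signof p * (\<Prod>i=0..<s. mat s s (\<lambda>(i, j). A i j) $$ (i, p i))) \<subseteq> B"
    if p: "p permutes {0..<s}" for p
  proof -
    have "mpvars (signof p :: ('v, 'a) mpoly) = {}" by (simp add: sign_def)
    moreover have "p i < s" if "i < s" for i using permutes_in_image[OF p, of i] that by simp
    moreover from this have "(\<Prod>i=0..<s. mat s s (\<lambda>(i, j). A i j) $$ (i, p i)) = (\<Prod>i=0..<s. A i (p i))"
      by (intro prod.cong) auto
    moreover have "mpvars (\<Prod>i=0..<s. A i (p i)) \<subseteq> B"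
      using calculation(2) by (intro mpvars_prod A) auto
    ultimately show ?thesis
      by (simp only:) (rule order_trans[OF mpvars_mult], simp)
  qed
  note * = this
  have "det (mat s s (\<lambda>(i, j). A i j)) =
      (\<Sum>p\<in>{p. p permutes {0..<s}}. signof p * (\<Prod>i=0..<s. mat s s (\<lambda>(i, j). A i j) $$ (i, p i)))"
    by (subst det_def) simp
  also have "mpvars \<dots> \<subseteq> B"
    by (rule mpvars_sum) (use * in blast)
  finally show ?thesis .
qed

section \<open>The variety of systems with a nontrivial zero\<close>

type_synonym coeff_idx = "nat \<times> (nat \<Rightarrow>\<^sub>0 nat)"

locale form_systems =
  fixes n d :: nat
  assumes n: "n \<ge> 2" and d: "d \<ge> 1"
begin

definition form :: "(coeff_idx \<Rightarrow> complex) \<Rightarrow> nat \<Rightarrow> (nat \<Rightarrow> complex) \<Rightarrow> complex" where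
  "form c i x = (\<Sum>k\<in>deg_monomials n d. c (i, k) * moneval x k)"

definition nontrivial_zero :: "(coeff_idx \<Rightarrow> complex) \<Rightarrow> (nat \<Rightarrow> complex) \<Rightarrow> bool" where
  "nontrivial_zero c x \<longleftrightarrow> (\<exists>i<n. x i \<noteq> 0) \<and> (\<forall>i<n. form c i x = 0)"

text \<open>The ideal P of the construction. Its members may involve indices outside the system;
  \<open>mpvars_gen\<close> excludes this for the generator.\<close>

definition vanishing :: "(coeff_idx, complex) mpoly set" where
  "vanishing = {p. \<forall>c x. nontrivial_zero c x \<longrightarrow> mpeval c p = 0}"

lemma vanishingD: "p \<in> vanishing \<Longrightarrow> nontrivial_zero c x \<Longrightarrow> mpeval c p = 0"
  by (auto simp: vanishing_def)

lemma vanishing_mult: "p \<in> vanishing \<Longrightarrow> q * p \<in> vanishing"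
  by (auto simp: vanishing_def mpeval.hom_mult)

lemma vanishing_add: "p \<in> vanishing \<Longrightarrow> q \<in> vanishing \<Longrightarrow> p + q \<in> vanishing"
  by (auto simp: vanishing_def mpeval.hom_add)

lemma form_scale: "form c i (\<lambda>j. t * x j) = t ^ d * form c i x"
  by (simp add: form_def moneval_scale sum_distrib_left ac_simps cong: sum.cong)

lemma polyfun_form: "(\<And>v. polyfun (\<lambda>s. c s v)) \<Longrightarrow> (\<And>v. polyfun (\<lambda>s. x s v)) \<Longrightarrow> polyfun (\<lambda>s. form (c s) i (x s))"
  unfolding form_def by auto

text \<open>The variety is connected by rational curves: two systems with zeros \<open>x\<^sub>1\<close> and \<open>x\<^sub>2\<close>, normalised to lie on a common affine
  hyperplane \<open>\<ell> = 1\<close>, are joined by interpolating linearly and subtracting the multiple of \<open>\<ell>\<^sup>d\<close> that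
  restores the zero.\<close>
lemma vanishing_prime:
  assumes "p * q \<in> vanishing"
  shows "p \<in> vanishing \<or> q \<in> vanishing"
proof (rule ccontr)
  assume "\<not> ?thesis"
  then obtain c1 x1 c2 x2 where z: "nontrivial_zero c1 x1" "nontrivial_zero c2 x2"
    and pq: "mpeval c1 p \<noteq> 0" "mpeval c2 q \<noteq> 0" by (auto simp: vanishing_def)
  from z obtain a where a: "(\<Sum>i<n. a i * x1 i) \<noteq> 0" "(\<Sum>i<n. a i * x2 i) \<noteq> 0"
    using common_nonvanishing_linear_form[of n x1 x2] unfolding nontrivial_zero_def by blast
  define l where "l = (\<lambda>x. \<Sum>i<n. a i * x i)"
  obtain b where b: "\<And>x. (\<Sum>k\<in>deg_monomials n d. b k * moneval x k) = (l x) ^ d"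
    using linear_form_power_coeffs[of n d a] unfolding l_def by metis
  define y1 where "y1 = (\<lambda>j. inverse (l x1) * x1 j)"
  define y2 where "y2 = (\<lambda>j. inverse (l x2) * x2 j)"
  have y: "l y1 = 1" "l y2 = 1" "\<And>i. i < n \<Longrightarrow> form c1 i y1 = 0" "\<And>i. i < n \<Longrightarrow> form c2 i y2 = 0"
    using a z unfolding y1_def y2_def form_scale nontrivial_zero_def
    by (simp_all add: l_def sum_distrib_left[symmetric] mult.left_commute[of "a _"])
  define x where "x = (\<lambda>s j. (1 - s) * y1 j + s * y2 j)"
  define e where "e = (\<lambda>s v. (1 - s) * c1 v + s * c2 v)"
  \<comment> \<open>Forms with index at least \<open>n\<close> need not vanish at the chosen points;
    leaving them uncorrected makes \<open>c 0 = c1\<close> and \<open>c 1 = c2\<close> hold as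
    functions.\<close>
  define c where "c = (\<lambda>s (i, k). if i < n then e s (i, k) - form (e s) i (x s) * b k else e s (i, k))"
  have lx: "l (x s) = 1" for s
  proof -
    have "l (x s) = (1 - s) * l y1 + s * l y2"
      by (simp add: l_def x_def sum_distrib_left sum.distrib[symmetric] algebra_simps)
    then show ?thesis by (simp add: y)
  qed
  have "nontrivial_zero (c s) (x s)" for s
  proof -
    have "\<exists>i<n. x s i \<noteq> 0" using lx[of s] unfolding l_def by (metis (no_types, lifting) lessThan_iff mult_zero_right sum.neutral zero_neq_one)
    moreover have "form (c s) i (x s) = 0" if "i < n" for i
    proof -
      define t where "t = form (e s) i (x s)"
      have "form (c s) i (x s) = (\<Sum>k\<in>deg_monomials n d. (e s (i, k) - t * b k) * moneval (x s) k)"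
        unfolding form_def[of "c s"] t_def using that by (simp add: c_def)
      also have "\<dots> = t - t * (\<Sum>k\<in>deg_monomials n d. b k * moneval (x s) k)"
        unfolding sum_distrib_left by (simp add: t_def form_def left_diff_distrib sum_subtractf mult.assoc)
      finally have "form (c s) i (x s) = t - t * (\<Sum>k\<in>deg_monomials n d. b k * moneval (x s) k)" .
      then show ?thesis by (simp add: b lx)
    qed
    ultimately show ?thesis by (simp add: nontrivial_zero_def)
  qed
  then have "mpeval (c s) p * mpeval (c s) q = 0" for s
    using assms unfolding mpeval.hom_mult[symmetric] by (blast dest: vanishingD)
  moreover have "polyfun (\<lambda>s. e s v)" "polyfun (\<lambda>s. x s j)" for v j
    unfolding e_def x_def by auto
  then have "polyfun (\<lambda>s. c s v)" for v
    unfolding c_def by (cases v; cases "fst v < n") (auto intro!: polyfun_form)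
  ultimately have "(\<forall>s. mpeval (c s) p = 0) \<or> (\<forall>s. mpeval (c s) q = 0)"
    by (intro polyfun_mult_eq_0) auto
  moreover have "c 0 = c1" "c 1 = c2"
    using y by (auto simp: c_def e_def x_def fun_eq_iff)
  ultimately show False using pq by metis
qed

subsection \<open>Determinants that vanish on the variety\<close>

definition det_entry where
  "det_entry e H c a b = (\<Sum>i<n. \<Sum>l\<in>deg_monomials n e. \<Sum>k\<in>deg_monomials n d.
     if l + k = b then H a i l * c (i, k) else 0)"

text \<open>Row \<open>a\<close> of the matrix holds the coefficients of \<open>\<Sum>\<^sub>i h\<^sub>i F\<^sub>i\<close> for forms \<open>h\<^sub>i\<close> with coefficients \<open>H a i\<close>, so that a
  common zero \<open>x\<close> of the \<open>F\<^sub>i\<close> puts the vector of monomials in \<open>x\<close> into the kernel.\<close>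
lemma vanishing_det:
  assumes ms: "set ms = deg_monomials n (e + d)" "distinct ms"
  obtains D where "D \<in> vanishing" "mpvars D \<subseteq> {..<n} \<times> deg_monomials n d"
    "\<And>c. mpeval c D = det (mat (length ms) (length ms) (\<lambda>(a, b). det_entry e H c (ms ! a) (ms ! b)))"
proof -
  let ?S = "length ms"
  define A :: "nat \<Rightarrow> nat \<Rightarrow> (coeff_idx, complex) mpoly" where
    "A = (\<lambda>a b. \<Sum>i<n. \<Sum>l\<in>deg_monomials n e. \<Sum>k\<in>deg_monomials n d.
     if l + k = ms ! b then mpconst (H (ms ! a) i l) * mpvar (i, k) else 0)"
  define D where "D = det (mat ?S ?S (\<lambda>(a, b). A a b))"
  have ev: "mpeval c (A a b) = det_entry e H c (ms ! a) (ms ! b)" for c a b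
    unfolding A_def det_entry_def
    by (auto simp: mpeval.hom_sum mpeval.hom_mult intro!: sum.cong)
  have D: "mpeval c D = det (mat ?S ?S (\<lambda>(a, b). det_entry e H c (ms ! a) (ms ! b)))" for c
  proof -
    have "map_mat (mpeval c) (mat ?S ?S (\<lambda>(a, b). A a b)) = mat ?S ?S (\<lambda>(a, b). det_entry e H c (ms ! a) (ms ! b))"
      by (rule eq_matI) (auto simp: ev)
    then show ?thesis unfolding D_def mpeval_ring.hom_det[symmetric] by simp
  qed
  have "D \<in> vanishing"
    unfolding vanishing_def
  proof (intro CollectI allI impI)
    fix c x assume z: "nontrivial_zero c x"
    let ?M = "mat ?S ?S (\<lambda>(a, b). det_entry e H c (ms ! a) (ms ! b))"
    define v where "v = vec ?S (\<lambda>b. moneval x (ms ! b))"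
    have "(\<Sum>b<?S. det_entry e H c a (ms ! b) * moneval x (ms ! b)) = 0" for a
    proof -
      have "(\<Sum>b<?S. det_entry e H c a (ms ! b) * moneval x (ms ! b)) =
          (\<Sum>m\<in>deg_monomials n (e + d). det_entry e H c a m * moneval x m)"
        using sum.reindex_bij_betw[OF bij_betw_nth[OF ms(2) refl ms(1)[symmetric]]] by simp
      also have "\<dots> = (\<Sum>i<n. \<Sum>l\<in>deg_monomials n e. \<Sum>k\<in>deg_monomials n d. \<Sum>m\<in>deg_monomials n (e + d).
          if l + k = m then H a i l * c (i, k) * moneval x m else 0)"
        unfolding det_entry_def sum_distrib_right sum.swap[where A = "deg_monomials n (e + d)"]
        by (intro sum.cong refl) simp
      also have "\<dots> = (\<Sum>i<n. \<Sum>l\<in>deg_monomials n e. \<Sum>k\<in>deg_monomials n d. H a i l * c (i, k) * moneval x (l + k))"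
        by (intro sum.cong refl) (auto dest: deg_monomials_add)
      also have "\<dots> = (\<Sum>i<n. (\<Sum>l\<in>deg_monomials n e. H a i l * moneval x l) * form c i x)"
        by (simp add: form_def sum_product moneval_add ac_simps)
      also have "\<dots> = 0" using z by (simp add: nontrivial_zero_def)
      finally show ?thesis .
    qed
    then have "?M *\<^sub>v v = 0\<^sub>v ?S"
      by (intro eq_vecI) (auto simp: v_def scalar_prod_def lessThan_atLeast0)
    moreover have "v \<noteq> 0\<^sub>v ?S"
    proof -
      obtain i where i: "i < n" "x i \<noteq> 0" using z by (auto simp: nontrivial_zero_def)
      then obtain b where "b < ?S" "ms ! b = psingle i (e + d)"
        using psingle_deg_monomials[of i n "e + d"] ms(1) by (metis in_set_conv_nth)
      then have "v $ b \<noteq> 0" "0\<^sub>v ?S $ b = (0::complex)" using i by (auto simp: v_def)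
      then show ?thesis by metis
    qed
    moreover have "?M \<in> carrier_mat ?S ?S" "v \<in> carrier_vec ?S" by (auto simp: v_def)
    ultimately show "mpeval c D = 0"
      unfolding D using det_0_iff_vec_prod_zero_field by blast
  qed
  moreover have "mpvars D \<subseteq> {..<n} \<times> deg_monomials n d"
    unfolding D_def
  proof (rule mpvars_det)
    fix a b
    show "mpvars (A a b) \<subseteq> {..<n} \<times> deg_monomials n d"
      unfolding A_def
      by (intro mpvars_sum) (auto dest!: subsetD[OF mpvars_mult] simp: if_distrib[of mpvars] split: if_splits)
  qed
  ultimately show ?thesis using that D by blast
qed

end

lemma complex_root_exists:
  assumes "d \<ge> 1" shows "\<exists>z::complex. z ^ d = a"
proof -
  have "degree (monom 1 d + [:- a:]) = d"
    using assms by (subst degree_add_eq_left) (simp_all add: degree_monom_eq)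
  then have "\<not> constant (poly (monom 1 d + [:- a:]))"
    using assms by (simp add: constant_degree)
  then obtain z where "poly (monom 1 d + [:- a:]) z = 0"
    using fundamental_theorem_of_algebra by blast
  then have "z ^ d = a" by (simp add: poly_monom)
  then show ?thesis ..
qed

lemma poly_map_poly_sum:
  fixes h :: "'a::zero \<Rightarrow> 'b::comm_semiring_1"
  assumes "h 0 = 0"
  shows "poly (map_poly h p) s = (\<Sum>i\<le>degree p. h (coeff p i) * s ^ i)"
proof -
  have "poly (map_poly h p) s = (\<Sum>i\<le>degree (map_poly h p). h (coeff p i) * s ^ i)"
    by (simp add: poly_altdef coeff_map_poly assms)
  also have "\<dots> = (\<Sum>i\<le>degree p. h (coeff p i) * s ^ i)"
  proof (rule sum.mono_neutral_left)
    show "\<forall>i\<in>{..degree p} - {..degree (map_poly h p)}. h (coeff p i) * s ^ i = 0"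
      using coeff_eq_0[of "map_poly h p"] by (auto simp: coeff_map_poly assms not_le)
  qed (auto simp: degree_map_poly_le)
  finally show ?thesis .
qed

context form_systems
begin

text \<open>The test systems that measure the degree in the coefficients of form
  \<open>j\<close>.\<close>

definition diag_sys :: "nat \<Rightarrow> complex \<Rightarrow> coeff_idx \<Rightarrow> complex" where
  "diag_sys j u = (\<lambda>(i, k). if k = psingle i d then (if i = j then u else 1) else 0)"

lemma sub_deg_monomials:
  assumes a: "a \<in> deg_monomials n (e + d)" and i: "i < n" "d \<le> plookup a i"
  shows "a - psingle i d \<in> deg_monomials n e" "(a - psingle i d) + psingle i d = a"
proof -
  show *: "(a - psingle i d) + psingle i d = a"
    by (rule poly_mapping_eqI) (use i in \<open>auto simp: lookup_add lookup_minus lookup_single when_def\<close>)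
  have "(\<Sum>v<n. plookup ((a - psingle i d) + psingle i d) v) = e + d"
    using a unfolding * by (simp add: deg_monomials_def)
  then have "(\<Sum>v<n. plookup (a - psingle i d) v) = e"
    using psingle_deg_monomials[OF i(1), of d] by (simp add: lookup_add sum.distrib deg_monomials_def)
  moreover have "pkeys (a - psingle i d) \<subseteq> pkeys a"
    by (auto simp: in_keys_iff lookup_minus)
  ultimately show "a - psingle i d \<in> deg_monomials n e"
    using a by (auto simp: deg_monomials_def)
qed

text \<open>Macaulay's matrix: in degree \<open>n (d - 1) + 1\<close> every monomial is divisible by some \<open>x\<^sub>i\<^sup>d\<close>, and \<open>i = j\<close> is chosen only if
  there is no other possibility.\<close>
lemma macaulay_determinant:
  assumes j: "j < n"
  obtains D N where "D \<in> vanishing" "mpvars D \<subseteq> {..<n} \<times> deg_monomials n d" "N \<le> d ^ (n - 1)"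
    "\<And>u. mpeval (diag_sys j u) D = u ^ N"
proof -
  \<comment> \<open>The degree \<open>e + d\<close> equals \<open>n * (d - 1) + 1\<close>, the least
    one in which every monomial contains a \<open>d\<close>-th power of a variable.\<close>
  define e where "e = (n - 1) * (d - 1)"
  let ?L = "deg_monomials n (e + d)"
  obtain ms where ms: "set ms = ?L" "distinct ms"
    using finite_distinct_list[OF finite_deg_monomials] by blast
  let ?S = "length ms"
  define P where "P = (\<lambda>a i. i < n \<and> i \<noteq> j \<and> d \<le> plookup a i)"
  define r where "r = (\<lambda>a. if \<exists>i. P a i then (SOME i. P a i) else j)"
  have r: "r a < n" "d \<le> plookup a (r a)" if a: "a \<in> ?L" for a
  proof -
    have "r a < n \<and> d \<le> plookup a (r a)"
    proof (cases "\<exists>i. P a i")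
      case True
      then have "P a (r a)" unfolding r_def by (simp add: someI_ex)
      then show ?thesis by (simp add: P_def)
    next
      case False
      have "(\<Sum>v\<in>{..<n} - {j}. plookup a v) \<le> (\<Sum>v\<in>{..<n} - {j}. d - 1)"
        by (rule sum_mono) (use False in \<open>auto simp: P_def not_le\<close>)
      also have "\<dots> = e" using j by (simp add: e_def)
      finally have "plookup a j \<ge> d"
        using a sum.remove[of "{..<n}" j "plookup a"] j by (simp add: deg_monomials_def)
      moreover have "r a = j" unfolding r_def using False by auto
      ultimately show ?thesis using j by simp
    qed
    then show "r a < n" "d \<le> plookup a (r a)" by auto
  qed
  have rj: "r a = j \<longleftrightarrow> \<not> (\<exists>i. P a i)" for a
  proof (cases "\<exists>i. P a i")
    case True
    then have "P a (r a)" unfolding r_def by (simp add: someI_ex)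
    then show ?thesis by (auto simp: P_def)
  qed (auto simp: r_def)
  define q where "q = (\<lambda>a. a - psingle (r a) d)"
  have q: "q a \<in> deg_monomials n e" "q a + psingle (r a) d = a" if "a \<in> ?L" for a
    using sub_deg_monomials[OF that r[OF that]] by (auto simp: q_def)
  define H where "H = (\<lambda>a i l. if i = r a \<and> l = q a then 1 else (0::complex))"
  obtain D where D: "D \<in> vanishing" "mpvars D \<subseteq> {..<n} \<times> deg_monomials n d"
    "\<And>c. mpeval c D = det (mat ?S ?S (\<lambda>(a, b). det_entry e H c (ms ! a) (ms ! b)))"
    using vanishing_det[OF ms] by metis
  \<comment> \<open>Row \<open>a\<close> belongs to the product of the monomial \<open>q a\<close>
    with form \<open>r a\<close>. At the diagonal system this product is the monomial
    \<open>a\<close> itself, multiplied by \<open>u\<close> if \<open>r a = j\<close>, so the matrix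
    is diagonal.\<close>
  have entry: "det_entry e H (diag_sys j u) a b = (if a = b then (if r a = j then u else 1) else 0)"
    if a: "a \<in> ?L" for a b u
  proof -
    define w where "w = (if a = b then (if r a = j then u else 1) else 0)"
    have "det_entry e H (diag_sys j u) a b = (\<Sum>i<n. \<Sum>l\<in>deg_monomials n e. \<Sum>k\<in>deg_monomials n d.
        if k = psingle i d then (if l = q a then (if i = r a then w else 0) else 0) else 0)"
      unfolding det_entry_def H_def diag_sys_def w_def
      by (intro sum.cong refl) (use q[OF a] in auto)
    also have "\<dots> = (\<Sum>i<n. \<Sum>l\<in>deg_monomials n e. if l = q a then (if i = r a then w else 0) else 0)"
      by (intro sum.cong refl) (simp add: psingle_deg_monomials)
    also have "\<dots> = w"
      using q(1)[OF a] r(1)[OF a] by simp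
    finally show ?thesis by (simp add: w_def)
  qed
  define A where "A = {a \<in> {0..<?S}. r (ms ! a) = j}"
  have ev: "mpeval (diag_sys j u) D = u ^ card A" for u
  proof -
    let ?M = "mat ?S ?S (\<lambda>(a, b). det_entry e H (diag_sys j u) (ms ! a) (ms ! b))"
    have M: "?M $$ (a, b) = (if a = b then (if r (ms ! a) = j then u else 1) else 0)" if "a < ?S" "b < ?S" for a b
    proof -
      have "ms ! a \<in> ?L" using that ms(1) nth_mem by blast
      moreover have "ms ! a = ms ! b \<longleftrightarrow> a = b" using that ms(2) nth_eq_iff_index_eq by blast
      ultimately show ?thesis using that by (simp add: entry)
    qed
    have "upper_triangular ?M" by (rule upper_triangularI) (simp del: index_mat add: M)
    then have "det ?M = prod_list (diag_mat ?M)" by (rule det_upper_triangular[of _ ?S]) simp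
    also have "\<dots> = (\<Prod>a=0..<?S. ?M $$ (a, a))" by (simp add: prod_list_diag_prod)
    also have "\<dots> = (\<Prod>a=0..<?S. if r (ms ! a) = j then u else 1)"
      by (intro prod.cong refl) (simp del: index_mat add: M)
    also have "\<dots> = u ^ card A"
      unfolding A_def by (simp flip: prod.inter_filter)
    finally show ?thesis by (simp add: D(3))
  qed
  \<comment> \<open>A row counts for \<open>A\<close> only if all its exponents apart from that of
    \<open>j\<close> are below \<open>d\<close>; these determine the monomial, since its degree is
    fixed.\<close>
  have "card A \<le> card (PiE ({..<n} - {j}) (\<lambda>_. {..<d}))"
  proof (rule card_inj_on_le)
    show "(\<lambda>a. restrict (plookup (ms ! a)) ({..<n} - {j})) ` A \<subseteq> PiE ({..<n} - {j}) (\<lambda>_. {..<d})"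
      unfolding A_def rj by (rule image_subsetI) (auto simp: P_def not_le restrict_PiE_iff)
    show "inj_on (\<lambda>a. restrict (plookup (ms ! a)) ({..<n} - {j})) A"
    proof (rule inj_onI)
      fix a b assume ab: "a \<in> A" "b \<in> A"
        and eq: "restrict (plookup (ms ! a)) ({..<n} - {j}) = restrict (plookup (ms ! b)) ({..<n} - {j})"
      then have L: "ms ! a \<in> ?L" "ms ! b \<in> ?L" using ms(1) nth_mem unfolding A_def by auto
      have *: "plookup (ms ! a) i = plookup (ms ! b) i" if "i < n" "i \<noteq> j" for i
        using fun_cong[OF eq, of i] that by simp
      have "(\<Sum>v\<in>{..<n} - {j}. plookup (ms ! a) v) = (\<Sum>v\<in>{..<n} - {j}. plookup (ms ! b) v)"
        by (rule sum.cong) (auto simp: *)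
      with L j have "plookup (ms ! a) j = plookup (ms ! b) j"
        using sum.remove[of "{..<n}" j "plookup (ms ! a)"] sum.remove[of "{..<n}" j "plookup (ms ! b)"]
        by (simp add: deg_monomials_def)
      then have "plookup (ms ! a) i = plookup (ms ! b) i" for i
        using * L by (cases "i < n") (auto simp: plookup_deg_outside)
      then have "ms ! a = ms ! b" by (intro poly_mapping_eqI)
      then show "a = b" using ab ms(2) nth_eq_iff_index_eq unfolding A_def by auto
    qed
  qed (auto intro: finite_PiE)
  also have "\<dots> = d ^ (n - 1)" using j by (simp add: card_PiE)
  finally show ?thesis using that[OF D(1,2) _ ev] by blast
qed

subsection \<open>No relation omits the last pure power\<close>

text \<open>Systems in which all but the last form have a prescribed zero are dense. The weights below single out the part of a relation that
  survives if \<open>x\<close> tends to infinity along with the coefficients of \<open>x\<^sub>i\<^sup>d\<close>; on that part the constraint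
  \<open>F\<^sub>i(x) = 0\<close> degenerates to the solvable equation \<open>a\<^sub>i x\<^sub>i\<^sup>d + y\<^sub>i = 0\<close>.\<close>
lemma vanishing_free_imp_zero:
  assumes p: "p \<in> vanishing" and free: "(n - 1, psingle (n - 1) d) \<notin> mpvars p"
  shows "p = 0"
proof (rule ccontr)
  assume "p \<noteq> 0"
  define z where "z = n - 1"
  have z: "z < n" "\<And>i. i < n \<Longrightarrow> i \<noteq> z \<Longrightarrow> i < z" using n by (auto simp: z_def)
  let ?Z = "psingle z d"
  have pure: "psingle i d = psingle i' d \<longleftrightarrow> i = i'" for i i' using d
    by (metis lookup_single_eq lookup_single_not_eq not_one_le_zero)
  \<comment> \<open>Put \<open>x_z = 1\<close> and scale the other coordinates by \<open>s\<close>.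
    In form \<open>i < z\<close> the term of \<open>x_i^d\<close>, thanks to its weight 1, has order
    \<open>s^(d+1)\<close>, all others apart from \<open>x_z^d\<close> have order at most
    \<open>s^d\<close>, and weight \<open>d + 1\<close> lets the coefficient of \<open>x_z^d\<close>
    balance them.\<close>
  define w :: "coeff_idx \<Rightarrow> nat" where
    "w = (\<lambda>(i, k). if i < z then (if k = ?Z then d + 1 else if k = psingle i d then 1 else 0) else 0)"
  define W where "W = degree (mpgrade w p)"
  define top where "top = lead_coeff (mpgrade w p)"
  have top0: "top \<noteq> 0" using \<open>p \<noteq> 0\<close> by (simp add: top_def)
  define ex where "ex = (\<lambda>k::nat \<Rightarrow>\<^sub>0 nat. \<Sum>v<z. plookup k v)"
  have exd: "ex k + plookup k z = d" if "k \<in> deg_monomials n d" for k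
  proof -
    have "{..<n} = insert z {..<z}" using z by auto
    with that show ?thesis by (simp add: deg_monomials_def ex_def)
  qed
  have pow: "w (i, k) + ex k \<le> d + 1" if "k \<in> deg_monomials n d" "k \<noteq> ?Z" for i k
    using exd[OF that(1)] that(2) by (auto simp: w_def)
  have pow0: "w (i, k) + ex k = d + 1 \<longleftrightarrow> k = psingle i d" if "k \<in> deg_monomials n d" "k \<noteq> ?Z" "i < z" for i k
  proof
    assume "k = psingle i d"
    moreover from this that have "plookup k z = 0" by (simp add: lookup_single)
    ultimately show "w (i, k) + ex k = d + 1" using that exd[OF that(1)] by (simp add: w_def)
  qed (use exd[OF that(1)] that in \<open>auto simp: w_def split: if_splits\<close>)
  have top: "mpeval (\<lambda>(i, k). if i < z \<and> k = ?Z then - (b (i, psingle i d) * x i ^ d) else b (i, k)) top = 0" for b x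
  proof -
    define x1 where "x1 = x(z := 1)"
    \<comment> \<open>For \<open>i < z\<close> the value at \<open>x_z^d\<close> is what
      \<open>F_i(y) = 0\<close> forces, divided by \<open>s^(d+1)\<close> and written in
      \<open>\<epsilon> = 1 / s\<close> so that it is polynomial at 0. By \<open>pow\<close> the
      truncated subtraction in the exponent is exact.\<close>
    define val where "val = (\<lambda>\<epsilon> (i, k). if i < z \<and> k = ?Z
      then - (\<Sum>k\<in>deg_monomials n d - {?Z}. b (i, k) * moneval x1 k * \<epsilon> ^ (d + 1 - (w (i, k) + ex k))) else b (i, k))"
    define g where "g = (\<lambda>\<epsilon>. \<Sum>e\<le>W. \<epsilon> ^ (W - e) * mpeval (val \<epsilon>) (coeff (mpgrade w p) e))"
    have pv: "polyfun (\<lambda>\<epsilon>. val \<epsilon> v)" for v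
      unfolding val_def by (cases v; cases "fst v < z \<and> snd v = ?Z") auto
    then have "polyfun g" unfolding g_def by auto
    moreover have "g \<epsilon> = 0" if "\<epsilon> \<noteq> 0" for \<epsilon>
    proof -
      define s where "s = inverse \<epsilon>"
      have s: "s \<noteq> 0" "s * \<epsilon> = 1" using that by (auto simp: s_def)
      define c where "c = (\<lambda>v. s ^ w v * val \<epsilon> v)"
      define y where "y = (\<lambda>v. if v = z then 1 else s * x v)"
      \<comment> \<open>The last form is made to vanish at \<open>y\<close> by changing its
        coefficient of \<open>x_z^d\<close>, the one that \<open>p\<close> omits;
        \<open>y z = 1\<close> makes this possible.\<close>
      define c' where "c' = c((z, ?Z) := - (\<Sum>k\<in>deg_monomials n d - {?Z}. c (z, k) * moneval y k))"
      have my: "moneval y k = s ^ ex k * moneval x1 k" if "k \<in> deg_monomials n d" for k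
      proof -
        have split: "{..<n} = insert z {..<z}" using z by auto
        have "moneval y k = (\<Prod>v<z. y v ^ plookup k v)"
          using that by (simp add: moneval_superset[of "{..<n}"] deg_monomials_def split y_def)
        also have "\<dots> = (\<Prod>v<z. s ^ plookup k v * x1 v ^ plookup k v)"
          by (intro prod.cong) (auto simp: y_def x1_def power_mult_distrib)
        also have "\<dots> = s ^ ex k * (\<Prod>v<z. x1 v ^ plookup k v)"
          by (simp add: prod.distrib ex_def power_sum)
        also have "(\<Prod>v<z. x1 v ^ plookup k v) = moneval x1 k"
          using that by (simp add: moneval_superset[of "{..<n}"] deg_monomials_def split x1_def)
        finally show ?thesis .
      qed
      have split: "form c'' i y = c'' (i, ?Z) + (\<Sum>k\<in>deg_monomials n d - {?Z}. c'' (i, k) * moneval y k)" for c'' i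
        unfolding form_def by (subst sum.remove[of _ ?Z]) (auto simp: psingle_deg_monomials z y_def)
      have "form c' i y = 0" if "i < n" for i
      proof (cases "i = z")
        case True
        then show ?thesis unfolding split by (simp add: c'_def)
      next
        case False
        then have i: "i < z" using z that by auto
        have "c (i, ?Z) = - (\<Sum>k\<in>deg_monomials n d - {?Z}. s ^ (d + 1) * (b (i, k) * moneval x1 k * \<epsilon> ^ (d + 1 - (w (i, k) + ex k))))"
          using i by (simp add: c_def val_def w_def sum_distrib_left)
        also have "\<dots> = - (\<Sum>k\<in>deg_monomials n d - {?Z}. c (i, k) * moneval y k)"
        proof (intro arg_cong[where f = uminus] sum.cong refl)
          fix k assume k: "k \<in> deg_monomials n d - {?Z}"
          have "s ^ (d + 1) * \<epsilon> ^ (d + 1 - (w (i, k) + ex k)) = s ^ (w (i, k) + ex k) * (s * \<epsilon>) ^ (d + 1 - (w (i, k) + ex k))"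
            unfolding power_mult_distrib mult.assoc[symmetric] power_add[symmetric] using pow[of k i] k by simp
          then have "s ^ (d + 1) * \<epsilon> ^ (d + 1 - (w (i, k) + ex k)) = s ^ w (i, k) * s ^ ex k"
            by (simp add: s power_add)
          moreover have "c (i, k) = s ^ w (i, k) * b (i, k)" using k by (simp add: c_def val_def)
          ultimately show "s ^ (d + 1) * (b (i, k) * moneval x1 k * \<epsilon> ^ (d + 1 - (w (i, k) + ex k))) = c (i, k) * moneval y k"
            using k by (simp add: my algebra_simps)
        qed
        finally show ?thesis using i unfolding split by (simp add: c'_def)
      qed
      then have "nontrivial_zero c' y" using z by (auto simp: nontrivial_zero_def y_def)
      then have "mpeval c' p = 0" by (rule vanishingD[OF p])
      moreover have "mpeval c' p = mpeval c p"
        by (rule mpeval_cong) (use free in \<open>auto simp: c'_def z_def\<close>)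
      ultimately have "(\<Sum>e\<le>W. mpeval (val \<epsilon>) (coeff (mpgrade w p) e) * s ^ e) = 0"
        by (simp add: c_def mpeval_mpgrade poly_map_poly_sum W_def)
      then have "\<epsilon> ^ W * (\<Sum>e\<le>W. mpeval (val \<epsilon>) (coeff (mpgrade w p) e) * s ^ e) = 0" by simp
      moreover have "g \<epsilon> = \<epsilon> ^ W * (\<Sum>e\<le>W. mpeval (val \<epsilon>) (coeff (mpgrade w p) e) * s ^ e)"
        unfolding g_def sum_distrib_left
      proof (intro sum.cong refl)
        fix e assume e: "e \<in> {..W}"
        have "\<epsilon> ^ W = \<epsilon> ^ (W - e) * \<epsilon> ^ e" using e by (simp flip: power_add)
        then have "\<epsilon> ^ W * s ^ e = \<epsilon> ^ (W - e) * (s * \<epsilon>) ^ e"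
          by (simp add: power_mult_distrib ac_simps)
        then have "\<epsilon> ^ W * s ^ e = \<epsilon> ^ (W - e)" by (simp only: s power_one mult_1_right)
        then show "\<epsilon> ^ (W - e) * mpeval (val \<epsilon>) (coeff (mpgrade w p) e) = \<epsilon> ^ W * (mpeval (val \<epsilon>) (coeff (mpgrade w p) e) * s ^ e)"
          by (simp only: mult_ac flip: \<open>\<epsilon> ^ W * s ^ e = \<epsilon> ^ (W - e)\<close>)
      qed
      ultimately show ?thesis by simp
    qed
    ultimately have "g 0 = 0" by (rule polyfun_eq_0_at_0)
    moreover have "g 0 = mpeval (val 0) top"
    proof -
      have "g 0 = (\<Sum>e\<le>W. if e = W then mpeval (val 0) (coeff (mpgrade w p) e) else 0)"
        unfolding g_def by (intro sum.cong) auto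
      then show ?thesis by (simp add: top_def W_def)
    qed
    moreover have "val 0 = (\<lambda>(i, k). if i < z \<and> k = ?Z then - (b (i, psingle i d) * x i ^ d) else b (i, k))"
    proof (intro ext, clarify)
      fix i k
      have "(\<Sum>k\<in>deg_monomials n d - {?Z}. b (i, k) * moneval x1 k * 0 ^ (d + 1 - (w (i, k) + ex k))) = b (i, psingle i d) * x i ^ d"
        if i: "i < z"
      proof -
        have "(\<Sum>k\<in>deg_monomials n d - {?Z}. b (i, k) * moneval x1 k * 0 ^ (d + 1 - (w (i, k) + ex k))) =
            (\<Sum>k\<in>deg_monomials n d - {?Z}. if k = psingle i d then b (i, k) * moneval x1 k else 0)"
        proof (intro sum.cong refl)
          fix k assume k: "k \<in> deg_monomials n d - {?Z}"
          then have "d + 1 - (w (i, k) + ex k) = 0 \<longleftrightarrow> k = psingle i d"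
            using pow[of k i] pow0[of k i] i by auto
          then show "b (i, k) * moneval x1 k * 0 ^ (d + 1 - (w (i, k) + ex k)) = (if k = psingle i d then b (i, k) * moneval x1 k else 0)"
            by (simp add: power_0_left)
        qed
        also have "\<dots> = b (i, psingle i d) * x i ^ d"
          using i z(1) by (simp add: psingle_deg_monomials pure x1_def)
        finally show ?thesis .
      qed
      then show "val 0 (i, k) = (if i < z \<and> k = ?Z then - (b (i, psingle i d) * x i ^ d) else b (i, k))"
        by (simp add: val_def)
    qed
    ultimately show ?thesis by simp
  qed
  \<comment> \<open>If all pure coefficients \<open>b (i, psingle i d)\<close> with
    \<open>i < z\<close> are nonzero, suitable \<open>d\<close>-th roots bring \<open>b\<close> into
    the shape required by \<open>top\<close>; the factor \<open>pr\<close> disposes of the remaining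
    \<open>b\<close>.\<close>
  define pr :: "(coeff_idx, complex) mpoly" where "pr = (\<Prod>i<z. mpvar (i, psingle i d))"
  have "mpeval b (top * pr) = 0" for b
  proof (cases "\<exists>i<z. b (i, psingle i d) = 0")
    case True
    then show ?thesis by (auto simp: pr_def mpeval.hom_mult mpeval.hom_prod prod_zero_iff)
  next
    case False
    have "\<exists>y. b (i, psingle i d) * y ^ d = - b (i, ?Z)" if "i < z" for i
    proof -
      obtain y where "y ^ d = - b (i, ?Z) / b (i, psingle i d)" using complex_root_exists[OF d] by blast
      with False that show ?thesis by (intro exI[of _ y]) auto
    qed
    then obtain x where x: "\<And>i. i < z \<Longrightarrow> b (i, psingle i d) * x i ^ d = - b (i, ?Z)" by metis
    then have "(\<lambda>(i, k). if i < z \<and> k = ?Z then - (b (i, psingle i d) * x i ^ d) else b (i, k)) = b"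
      by auto
    with top[of b x] show ?thesis by (simp add: mpeval.hom_mult)
  qed
  then have "top * pr = 0" by (rule mpeval_all_zero)
  moreover have "pr \<noteq> 0" unfolding pr_def by simp
  ultimately show False using top0 by simp
qed

subsection \<open>The vanishing ideal is principal\<close>

lemma n_pos: "0 < n"
  using n by simp

lemma nontrivial_zero_exists: "nontrivial_zero (\<lambda>_. 0) (\<lambda>_. 1)"
  using n by (auto simp: nontrivial_zero_def form_def intro!: exI[of _ 0])

definition gen :: "(coeff_idx, complex) mpoly" where
  "gen = arg_min mpdeg (\<lambda>p. p \<in> vanishing \<and> p \<noteq> 0)"

lemma gen: "gen \<in> vanishing" "gen \<noteq> 0" "p \<in> vanishing \<Longrightarrow> p \<noteq> 0 \<Longrightarrow> mpdeg gen \<le> mpdeg p"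
proof -
  obtain D N where D: "D \<in> vanishing" "\<And>u. mpeval (diag_sys 0 u) D = u ^ N"
    by (rule macaulay_determinant[OF n_pos]) (rule that)
  from D(2)[of 1] have "D \<noteq> 0" by auto
  with D(1) have "(gen \<in> vanishing \<and> gen \<noteq> 0) \<and> (\<forall>p. p \<in> vanishing \<and> p \<noteq> 0 \<longrightarrow> mpdeg gen \<le> mpdeg p)"
    unfolding gen_def by (intro arg_min_nat_lemma) simp
  then show "gen \<in> vanishing" "gen \<noteq> 0" "p \<in> vanishing \<Longrightarrow> p \<noteq> 0 \<Longrightarrow> mpdeg gen \<le> mpdeg p" by blast+
qed

lemma unit_not_vanishing: "p dvd 1 \<Longrightarrow> p \<notin> vanishing"
  using vanishingD[OF _ nontrivial_zero_exists, of p] by (auto elim!: mp_unitE)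

text \<open>By primality one factor lies in the ideal, and minimality of the total degree leaves
  degree 0 for the other.\<close>

lemma irreducible_gen: "irreducible gen"
  unfolding irreducible_def
proof (intro conjI allI impI)
  show "gen \<noteq> 0" by (rule gen)
  show "\<not> gen dvd 1" using unit_not_vanishing gen(1) by blast
  fix a b assume ab: "gen = a * b"
  then have nz: "a \<noteq> 0" "b \<noteq> 0" using gen(2) by auto
  then have deg: "mpdeg gen = mpdeg a + mpdeg b" unfolding ab by (rule mpdeg_mult)
  from vanishing_prime[of a b] gen(1) have "a \<in> vanishing \<or> b \<in> vanishing" by (simp add: ab)
  then show "a dvd 1 \<or> b dvd 1"
    using gen(3)[of a] gen(3)[of b] nz deg unfolding mp_unit_iff by linarith
qed

lemma gen_dvd: assumes "p \<in> vanishing" shows "gen dvd p"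
proof (rule ccontr)
  assume "\<not> gen dvd p"
  let ?t = "(n - 1, psingle (n - 1) d)"
  have "?t \<in> mpvars gen" using vanishing_free_imp_zero gen by blast
  from irreducible_eliminate_var[OF irreducible_gen this \<open>\<not> gen dvd p\<close>] obtain u v
    where "u * gen + v * p \<noteq> 0" "?t \<notin> mpvars (u * gen + v * p)" by blast
  moreover have "u * gen + v * p \<in> vanishing"
    using gen(1) assms by (intro vanishing_add vanishing_mult)
  ultimately show False using vanishing_free_imp_zero by blast
qed

text \<open>Membership in \<open>vanishing\<close> does not bound the variables, but
  \<open>gen\<close> divides a Macaulay determinant, which involves only coefficients of the
  system.\<close>

lemma mpvars_gen: "mpvars gen \<subseteq> {..<n} \<times> deg_monomials n d"
proof -
  obtain D N where D: "D \<in> vanishing" "mpvars D \<subseteq> {..<n} \<times> deg_monomials n d" "\<And>u. mpeval (diag_sys 0 u) D = u ^ N"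
    by (rule macaulay_determinant[OF n_pos]) (rule that)
  from D(3)[of 1] have "D \<noteq> 0" by auto
  with mpvars_dvd[OF gen_dvd[OF D(1)]] D(2) show ?thesis by blast
qed

end

section \<open>The Nullstellensatz\<close>

definition mp_ideal :: "('v, 'a::comm_ring_1) mpoly set \<Rightarrow> bool" where
  "mp_ideal I \<longleftrightarrow> 0 \<in> I \<and> (\<forall>p\<in>I. \<forall>q\<in>I. p + q \<in> I) \<and> (\<forall>p\<in>I. \<forall>r. r * p \<in> I)"

lemma mp_idealD:
  assumes "mp_ideal I"
  shows "0 \<in> I" "p \<in> I \<Longrightarrow> q \<in> I \<Longrightarrow> p + q \<in> I" "p \<in> I \<Longrightarrow> r * p \<in> I"
  using assms by (auto simp: mp_ideal_def)

lemma mp_ideal_uminus: "mp_ideal I \<Longrightarrow> p \<in> I \<Longrightarrow> - p \<in> I"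
  using mp_idealD(3)[of I p "- 1"] by simp

lemma mp_ideal_diff: "mp_ideal I \<Longrightarrow> p \<in> I \<Longrightarrow> q \<in> I \<Longrightarrow> p - q \<in> I"
  using mp_idealD(2)[of I p "- q"] mp_ideal_uminus[of I q] by simp

lemma mp_ideal_sum: "mp_ideal I \<Longrightarrow> (\<And>i. i \<in> S \<Longrightarrow> f i \<in> I) \<Longrightarrow> (\<Sum>i\<in>S. f i) \<in> I"
  by (induction S rule: infinite_finite_induct) (auto intro: mp_idealD)

lemma mp_ideal_const_imp_one:
  fixes I :: "('v, 'a::field) mpoly set"
  assumes "mp_ideal I" "mpconst c \<in> I" "c \<noteq> 0" shows "1 \<in> I"
  using mp_idealD(3)[OF assms(1,2), of "mpconst (inverse c)"] assms(3) by (simp flip: mpconst_mult)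

text \<open>Zorn's lemma. Maximality is recorded in the form used later, as invertibility modulo
  \<open>M\<close> of everything outside \<open>M\<close>.\<close>

lemma maximal_ideal_exists:
  fixes J :: "('v, 'a::comm_ring_1) mpoly set"
  assumes J: "mp_ideal J" "1 \<notin> J"
  obtains M where "mp_ideal M" "J \<subseteq> M" "1 \<notin> M" "\<And>z. z \<notin> M \<Longrightarrow> \<exists>h. h * z - 1 \<in> M"
proof -
  let ?A = "{I. mp_ideal I \<and> J \<subseteq> I \<and> 1 \<notin> I}"
  have "\<exists>M\<in>?A. \<forall>X\<in>?A. M \<subseteq> X \<longrightarrow> X = M"
  proof (rule subset_Zorn_nonempty)
    show "?A \<noteq> {}" using J by blast
    fix C assume C: "C \<noteq> {}" "subset.chain ?A C"
    then have CA: "C \<subseteq> ?A" and ch: "\<And>X Y. X \<in> C \<Longrightarrow> Y \<in> C \<Longrightarrow> X \<subseteq> Y \<or> Y \<subseteq> X"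
      by (auto simp: subset.chain_def)
    have idC: "mp_ideal X" "J \<subseteq> X" "1 \<notin> X" if "X \<in> C" for X
      using CA that by blast+
    obtain X0 where X0: "X0 \<in> C" using C(1) by blast
    have "mp_ideal (\<Union>C)"
      unfolding mp_ideal_def
    proof (intro conjI ballI allI)
      show "0 \<in> \<Union>C" using mp_idealD(1)[OF idC(1)[OF X0]] X0 by (rule UnionI[rotated])
    next
      fix p q assume "p \<in> \<Union>C" "q \<in> \<Union>C"
      then obtain X Y where "p \<in> X" "X \<in> C" "q \<in> Y" "Y \<in> C" by blast
      with ch[of X Y] obtain Z where Z: "p \<in> Z" "q \<in> Z" "Z \<in> C" by blast
      show "p + q \<in> \<Union>C" by (rule UnionI[OF Z(3) mp_idealD(2)[OF idC(1)[OF Z(3)] Z(1,2)]])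
    next
      fix p r assume "p \<in> \<Union>C"
      then obtain X where X: "p \<in> X" "X \<in> C" by blast
      show "r * p \<in> \<Union>C" by (rule UnionI[OF X(2) mp_idealD(3)[OF idC(1)[OF X(2)] X(1)]])
    qed
    moreover have "J \<subseteq> \<Union>C" using idC(2)[OF X0] X0 by (rule order_trans[OF _ Union_upper])
    moreover have "1 \<notin> \<Union>C" using idC(3) by blast
    ultimately show "\<Union>C \<in> ?A" by simp
  qed
  then obtain M where MA: "M \<in> ?A" and MX: "\<forall>X\<in>?A. M \<subseteq> X \<longrightarrow> X = M" by blast
  from MA have M: "mp_ideal M" "J \<subseteq> M" "1 \<notin> M" by simp_all
  have max: "X = M" if "mp_ideal X" "J \<subseteq> X" "1 \<notin> X" "M \<subseteq> X" for X
    using MX that by simp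
  have "\<exists>h. h * z - 1 \<in> M" if z: "z \<notin> M" for z
  proof -
    define X where "X = {p. \<exists>m\<in>M. \<exists>h. p = m + h * z}"
    have "mp_ideal X"
      unfolding mp_ideal_def
    proof (intro conjI ballI allI)
      show "0 \<in> X" unfolding X_def by (intro CollectI bexI[of _ 0] exI[of _ 0]) (simp_all add: mp_idealD(1)[OF M(1)])
    next
      fix p q assume "p \<in> X" "q \<in> X"
      then obtain m h m' h' where "m \<in> M" "m' \<in> M" "p = m + h * z" "q = m' + h' * z" unfolding X_def by blast
      moreover from this have "p + q = (m + m') + (h + h') * z" by (simp add: algebra_simps)
      ultimately show "p + q \<in> X" unfolding X_def using mp_idealD(2)[OF M(1)] by blast
    next
      fix p r assume "p \<in> X"
      then obtain m h where "m \<in> M" "p = m + h * z" unfolding X_def by blast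
      moreover from this have "r * p = r * m + (r * h) * z" by (simp add: algebra_simps)
      ultimately show "r * p \<in> X" unfolding X_def using mp_idealD(3)[OF M(1)] by blast
    qed
    moreover have "M \<subseteq> X"
    proof
      fix m assume "m \<in> M"
      then show "m \<in> X" unfolding X_def by (intro CollectI bexI[of _ m] exI[of _ 0]) simp_all
    qed
    moreover have "z \<in> X"
      unfolding X_def by (intro CollectI bexI[of _ 0] exI[of _ 1]) (simp_all add: mp_idealD(1)[OF M(1)])
    ultimately have "1 \<in> X" using max[of X] order_trans[OF M(2), of X] z by metis
    then obtain m h where "m \<in> M" "1 = m + h * z" unfolding X_def by blast
    then have "h * z - 1 = - m" by (simp add: algebra_simps)
    with \<open>m \<in> M\<close> M(1) show ?thesis by (metis mp_ideal_uminus)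
  qed
  then show ?thesis by (rule that[OF M])
qed

lemma lookup_mpconst_mult: "plookup (mpconst c * p) k = c * plookup p k"
  unfolding mpconst_def mult_map_scale_conv_mult[symmetric]
  by (simp add: Poly_Mapping.map.rep_eq when_def)

text \<open>One vector more than there are coordinates. A zero row makes the coefficient matrix
  square, and it is singular because the last unit vector lies in the kernel of its
  transpose.\<close>

lemma nontrivial_linear_relation:
  fixes f :: "nat \<Rightarrow> ('k \<Rightarrow>\<^sub>0 complex)"
  assumes "finite B" "\<And>j. pkeys (f j) \<subseteq> B"
  obtains v S where "\<And>k. (\<Sum>j<S. v j * plookup (f j) k) = 0" "\<exists>j<S. v j \<noteq> 0"
proof -
  obtain bs where bs: "set bs = B" "distinct bs" using finite_distinct_list[OF assms(1)] by blast
  define N where "N = length bs"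
  define M where "M = mat (Suc N) (Suc N) (\<lambda>(i, j). if i < N then plookup (f j) (bs ! i) else 0)"
  have M: "M \<in> carrier_mat (Suc N) (Suc N)" "transpose_mat M \<in> carrier_mat (Suc N) (Suc N)" by (simp_all add: M_def)
  have "transpose_mat M *\<^sub>v unit_vec (Suc N) N = 0\<^sub>v (Suc N)"
  proof (rule eq_vecI)
    fix i assume "i < dim_vec (0\<^sub>v (Suc N) :: complex vec)"
    then have i: "i < Suc N" by simp
    then have "(transpose_mat M *\<^sub>v unit_vec (Suc N) N) $ i = col M i \<bullet> unit_vec (Suc N) N"
      by (simp add: M_def)
    also have "\<dots> = col M i $ N" by (rule scalar_prod_right_unit) (auto simp: M_def)
    also have "\<dots> = 0" using i by (simp add: M_def)
    finally show "(transpose_mat M *\<^sub>v unit_vec (Suc N) N) $ i = 0\<^sub>v (Suc N) $ i" using i by simp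
  qed (simp add: M_def)
  moreover have "unit_vec (Suc N) N \<noteq> (0\<^sub>v (Suc N) :: complex vec)"
    by (metis index_unit_vec(1) index_zero_vec(1) lessI zero_neq_one)
  ultimately have "det (transpose_mat M) = 0"
    unfolding det_0_iff_vec_prod_zero_field[OF M(2)]
    by (intro exI[of _ "unit_vec (Suc N) N"] conjI unit_vec_carrier)
  then have "det M = 0" using det_transpose[OF M(1)] by simp
  then obtain v where v: "v \<in> carrier_vec (Suc N)" "v \<noteq> 0\<^sub>v (Suc N)" "M *\<^sub>v v = 0\<^sub>v (Suc N)"
    unfolding det_0_iff_vec_prod_zero_field[OF M(1)] by blast
  have "(\<Sum>j<Suc N. v $ j * plookup (f j) k) = 0" for k
  proof (cases "k \<in> B")
    case True
    then obtain i where i: "i < N" "bs ! i = k" using bs(1) by (auto simp: in_set_conv_nth N_def)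
    from v(3) i have "(M *\<^sub>v v) $ i = 0" by simp
    then have "(\<Sum>j = 0..<Suc N. plookup (f j) k * v $ j) = 0"
      using i v(1) by (simp add: M_def scalar_prod_def)
    then show ?thesis by (simp add: atLeast0LessThan mult.commute)
  next
    case False
    then have "plookup (f j) k = 0" for j using assms(2)[of j] by (auto simp: in_keys_iff)
    then show ?thesis by simp
  qed
  moreover have "\<exists>j<Suc N. v $ j \<noteq> 0"
    using v(1,2) by (metis carrier_vecD eq_vecI index_zero_vec(1) index_zero_vec(2))
  ultimately show ?thesis by (rule that)
qed

text \<open>A single parameter bounds both the variables and the degree, so that countably many
  finite sets exhaust the exponent vectors.\<close>

definition box_monomials :: "nat \<Rightarrow> (nat \<Rightarrow>\<^sub>0 nat) set" where
  "box_monomials m = (\<Union>e\<le>m. deg_monomials m e)"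

lemma finite_box_monomials: "finite (box_monomials m)"
  by (simp add: box_monomials_def)

lemma box_monomials_cover: 
  assumes "finite K" shows "\<exists>m. K \<subseteq> box_monomials m"
proof -
  define g where "g = (\<lambda>k::nat \<Rightarrow>\<^sub>0 nat. Suc (\<Sum>v\<in>pkeys k. v) + (\<Sum>v\<in>pkeys k. plookup k v))"
  have "k \<in> box_monomials m" if "g k \<le> m" for k m
  proof -
    have "pkeys k \<subseteq> {..<m}"
    proof
      fix v assume "v \<in> pkeys k"
      then have "v \<le> (\<Sum>v\<in>pkeys k. v)" by (intro member_le_sum) auto
      then show "v \<in> {..<m}" using that by (simp add: g_def)
    qed
    then have "(\<Sum>v<m. plookup k v) = (\<Sum>v\<in>pkeys k. plookup k v)"
      by (intro sum.mono_neutral_right) (auto simp: in_keys_iff)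
    also have "\<dots> \<le> m" using that by (simp add: g_def)
    finally show ?thesis using \<open>pkeys k \<subseteq> {..<m}\<close> by (auto simp: box_monomials_def deg_monomials_def)
  qed
  moreover have "g k \<le> (\<Sum>k\<in>K. g k)" if "k \<in> K" for k
    using assms that by (intro member_le_sum) auto
  ultimately show ?thesis by blast
qed

lemma uncountable_UNIV_complex: "uncountable (UNIV :: complex set)"
proof
  assume "countable (UNIV :: complex set)"
  then have "countable (Re ` UNIV)" by (rule countable_image)
  moreover have "Re ` UNIV = UNIV" by (metis surj_def Re_complex_of_real)
  ultimately show False using uncountable_UNIV_real by simp
qed

text \<open>The polynomials in countably many variables form a space of countable dimension, whereas the inverses of \<open>z - a\<close> for
  the uncountably many \<open>a\<close> would be linearly independent modulo \<open>M\<close>.\<close>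
lemma maximal_ideal_residue:
  fixes M :: "(nat, complex) mpoly set"
  assumes M: "mp_ideal M" "1 \<notin> M" "\<And>z. z \<notin> M \<Longrightarrow> \<exists>h. h * z - 1 \<in> M"
  shows "\<exists>a. z - mpconst a \<in> M"
proof (rule ccontr)
  assume "\<not> ?thesis"
  with M(3) have "\<forall>a. \<exists>h. h * (z - mpconst a) - 1 \<in> M" by blast
  then obtain h where h: "\<And>a. h a * (z - mpconst a) - 1 \<in> M" by metis
  interpret mc: comm_semiring_hom "mpconst :: complex \<Rightarrow> (nat, complex) mpoly" by (rule comm_semiring_hom_mpconst)
  define E where "E = (\<lambda>q. poly (map_poly (mpconst :: complex \<Rightarrow> (nat, complex) mpoly) q) z)"
  interpret E: comm_semiring_hom E
    unfolding E_def by (rule comm_semiring_hom_poly_map) (rule comm_semiring_hom_mpconst)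
  have E_lin: "E [:- a, 1:] = z - mpconst a" for a
    unfolding E_def mc.map_poly_pCons_hom by (simp add: mpconst_def single_uminus)
  have E_const: "E [:c:] = mpconst c" for c
    unfolding E_def mc.map_poly_pCons_hom by simp
  \<comment> \<open>Under the assumption to be refuted, \<open>z\<close> is transcendental modulo
    \<open>M\<close>: \<open>q\<close> splits into linear factors over the complex numbers, and each
    \<open>z - mpconst a\<close> is invertible modulo \<open>M\<close>.\<close>
  have nz: "E q \<notin> M" if "q \<noteq> 0" for q
    using that
  proof (induction "degree q" arbitrary: q rule: less_induct)
    case less
    show ?case
    proof (cases "degree q = 0")
      case True
      then obtain c where "q = [:c:]" by (meson degree_eq_zeroE)
      with less.prems M(1,2) show ?thesis using mp_ideal_const_imp_one[of M c] by (auto simp: E_const)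
    next
      case False
      then have "\<not> constant (poly q)" by (simp add: constant_degree)
      then obtain a where "poly q a = 0" using fundamental_theorem_of_algebra by blast
      then obtain q' where q: "q = [:- a, 1:] * q'" unfolding poly_eq_0_iff_dvd by (rule dvdE)
      with less.prems have "q' \<noteq> 0" by auto
      then have "degree q' < degree q" unfolding q by (subst degree_mult_eq) auto
      with less.hyps \<open>q' \<noteq> 0\<close> have "E q' \<notin> M" by blast
      show ?thesis
      proof
        assume "E q \<in> M"
        have "h a * E q - E q' * (h a * (z - mpconst a) - 1) \<in> M"
          by (rule mp_ideal_diff[OF M(1) mp_idealD(3)[OF M(1) \<open>E q \<in> M\<close>] mp_idealD(3)[OF M(1) h]])
        moreover have "h a * E q - E q' * (h a * (z - mpconst a) - 1) = E q'"
          unfolding q E.hom_mult E_lin by (simp add: algebra_simps)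
        ultimately show False using \<open>E q' \<notin> M\<close> by simp
      qed
    qed
  qed
  \<comment> \<open>Uncountably many inverses \<open>h a\<close> are distributed over countably many
    boxes, so one box receives infinitely many.\<close>
  have "\<exists>m. infinite {a. pkeys (h a) \<subseteq> box_monomials m}"
  proof (rule ccontr)
    assume "\<nexists>m. infinite {a. pkeys (h a) \<subseteq> box_monomials m}"
    then have "countable (\<Union>m. {a. pkeys (h a) \<subseteq> box_monomials m})"
      by (intro countable_UN) (auto intro: countable_finite)
    moreover have "(\<Union>m. {a. pkeys (h a) \<subseteq> box_monomials m}) = UNIV"
      using box_monomials_cover[OF finite_keys] by blast
    ultimately show False using uncountable_UNIV_complex by simp
  qed
  then obtain m where "infinite {a. pkeys (h a) \<subseteq> box_monomials m}" by blast
  then obtain a :: "nat \<Rightarrow> complex" where a: "inj a" "range a \<subseteq> {a. pkeys (h a) \<subseteq> box_monomials m}"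
    using infinite_countable_subset by blast
  obtain v S where v: "\<And>k. (\<Sum>j<S. v j * plookup (h (a j)) k) = 0" "\<exists>j<S. v j \<noteq> 0"
  proof (rule nontrivial_linear_relation[OF finite_box_monomials])
    show "pkeys (h (a j)) \<subseteq> box_monomials m" for j using a(2) by auto
  qed (rule that)
  have rel: "(\<Sum>j<S. mpconst (v j) * h (a j)) = 0"
    by (rule poly_mapping_eqI) (simp add: lookup_sum lookup_mpconst_mult v)
  \<comment> \<open>The numerator of the sum of the fractions \<open>v j / (x - a j)\<close>. The
    linear relation between the inverses puts \<open>E q\<close> into \<open>M\<close>, while
    \<open>q\<close> is nonzero at \<open>a i\<close>.\<close>
  define q where "q = (\<Sum>j<S. [:v j:] * (\<Prod>l\<in>{..<S} - {j}. [:- a l, 1:]))"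
  obtain i where i: "i < S" "v i \<noteq> 0" using v(2) by blast
  have "poly q (a i) = (\<Sum>j<S. if j = i then v i * (\<Prod>l\<in>{..<S} - {i}. a i - a l) else 0)"
    unfolding q_def poly_sum
  proof (intro sum.cong refl)
    fix j assume j: "j \<in> {..<S}"
    show "poly ([:v j:] * (\<Prod>l\<in>{..<S} - {j}. [:- a l, 1:])) (a i) = (if j = i then v i * (\<Prod>l\<in>{..<S} - {i}. a i - a l) else 0)"
      using i j by (auto simp: poly_prod prod_zero_iff)
  qed
  also have "\<dots> = v i * (\<Prod>l\<in>{..<S} - {i}. a i - a l)" using i by simp
  also have "\<dots> \<noteq> 0" using i a(1) by (auto simp: inj_eq)
  finally have "q \<noteq> 0" by auto
  have "E q = (\<Sum>j<S. mpconst (v j) * (\<Prod>l\<in>{..<S} - {j}. z - mpconst (a l)))"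
    by (simp only: q_def E.hom_sum E.hom_mult E.hom_prod E_lin E_const)
  also have "\<dots> = (\<Sum>j<S. mpconst (v j) * (\<Prod>l\<in>{..<S} - {j}. z - mpconst (a l)))
      - (\<Sum>j<S. mpconst (v j) * h (a j)) * (\<Prod>l<S. z - mpconst (a l))"
    by (simp add: rel)
  also have "\<dots> = (\<Sum>j<S. - (mpconst (v j) * (\<Prod>l\<in>{..<S} - {j}. z - mpconst (a l))) * (h (a j) * (z - mpconst (a j)) - 1))"
    unfolding sum_distrib_right sum_subtractf[symmetric]
  proof (intro sum.cong refl)
    fix j assume "j \<in> {..<S}"
    then have "(\<Prod>l<S. z - mpconst (a l)) = (z - mpconst (a j)) * (\<Prod>l\<in>{..<S} - {j}. z - mpconst (a l))"
      by (intro prod.remove) auto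
    note prod_eq = this
    show "mpconst (v j) * (\<Prod>l\<in>{..<S} - {j}. z - mpconst (a l)) - mpconst (v j) * h (a j) * (\<Prod>l<S. z - mpconst (a l))
       = - (mpconst (v j) * (\<Prod>l\<in>{..<S} - {j}. z - mpconst (a l))) * (h (a j) * (z - mpconst (a j)) - 1)"
      unfolding prod_eq by (simp add: algebra_simps)
  qed
  also have "\<dots> \<in> M"
    by (intro mp_ideal_sum[OF M(1)] mp_idealD(3)[OF M(1)] h)
  finally show False using nz[OF \<open>q \<noteq> 0\<close>] by blast
qed

text \<open>Modulo a maximal ideal above \<open>J\<close> every variable is congruent to a constant,
  so every polynomial is congruent to its value at the point formed by these constants. For a member
  of \<open>J\<close> this value lies in the proper ideal \<open>M\<close>, hence is 0.\<close>

theorem weak_nullstellensatz: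
  fixes J :: "(nat, complex) mpoly set"
  assumes "mp_ideal J" "1 \<notin> J"
  shows "\<exists>a. \<forall>p\<in>J. mpeval a p = 0"
proof -
  obtain M where M: "mp_ideal M" "J \<subseteq> M" "1 \<notin> M" "\<And>z. z \<notin> M \<Longrightarrow> \<exists>h. h * z - 1 \<in> M"
    by (rule maximal_ideal_exists[OF assms]) (rule that)
  have "\<exists>a. mpvar v - mpconst a \<in> M" for v
    by (rule maximal_ideal_residue) fact+
  then obtain a where a: "\<And>v. mpvar v - mpconst (a v) \<in> M" by metis
  interpret mc: comm_semiring_hom "mpconst :: complex \<Rightarrow> (nat, complex) mpoly" by (rule comm_semiring_hom_mpconst)
  have res: "p - mpconst (mpeval a p) \<in> M" for p
  proof (induction p rule: mpoly_induct)
    case (add p q)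
    from mp_idealD(2)[OF M(1) this] show ?case by (simp add: mpeval.hom_add mc.hom_add algebra_simps)
  next
    case (mult p q)
    have "p * q - mpconst (mpeval a (p * q)) = q * (p - mpconst (mpeval a p)) + mpconst (mpeval a p) * (q - mpconst (mpeval a q))"
      by (simp add: mpeval.hom_mult mc.hom_mult algebra_simps)
    with mult show ?case using M(1) by (simp add: mp_idealD)
  qed (use a mp_idealD(1)[OF M(1)] in simp_all)
  have "mpeval a p = 0" if "p \<in> J" for p
  proof (rule ccontr)
    assume "mpeval a p \<noteq> 0"
    moreover have "p - (p - mpconst (mpeval a p)) \<in> M"
      by (rule mp_ideal_diff[OF M(1) subsetD[OF M(2) that] res])
    ultimately show False using mp_ideal_const_imp_one[OF M(1)] M(3) by simp
  qed
  then show ?thesis by blast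
qed

section \<open>Graded components of the ideal generated by the forms\<close>

lemma sum_monom: "(\<Sum>i\<in>I. monom (f i) e) = monom (\<Sum>i\<in>I. f i) e"
  by (induction I rule: infinite_finite_induct) (simp_all add: add_monom)

lemma prod_monom: "(\<Prod>i\<in>I. monom (f i) (g i)) = monom (\<Prod>i\<in>I. f i) (\<Sum>i\<in>I. g i)"
  by (induction I rule: infinite_finite_induct) (simp_all add: mult_monom monom_0 one_pCons)

lemma mpgrade_single: "mpgrade w (psingle k c) = monom (psingle k c) (\<Sum>v\<in>pkeys k. w v * plookup k v)"
proof -
  have "mpgrade w (psingle k c) = [:mpconst c:] * moneval (\<lambda>v. monom (mpvar v) (w v)) k"
    unfolding mpgrade_def by (rule comm_semiring_hom.mpsubst_single[OF comm_semiring_hom_pmpconst])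
  also have "moneval (\<lambda>v. monom (mpvar v) (w v)) k = monom (moneval mpvar k) (\<Sum>v\<in>pkeys k. w v * plookup k v)"
    by (simp add: moneval_def monom_power prod_monom)
  finally show ?thesis by (simp add: moneval_mpvar smult_monom mpconst_def mult_single)
qed

lemma mpvar_power: "(mpvar v :: ('v, 'a::comm_semiring_1) mpoly) ^ e = psingle (psingle v e) 1"
  using moneval_mpvar[of "psingle v e", where 'a = 'a] by simp

lemma left_deg_monomials:
  assumes "l + k \<in> deg_monomials n (e + d)" "k \<in> deg_monomials n d"
  shows "l \<in> deg_monomials n e"
proof -
  have "pkeys l \<subseteq> pkeys (l + k)" by (auto simp: in_keys_iff lookup_add)
  with assms show ?thesis by (auto simp: deg_monomials_def lookup_add sum.distrib)
qed

context form_systems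
begin

definition poly_form :: "(coeff_idx \<Rightarrow> complex) \<Rightarrow> nat \<Rightarrow> (nat, complex) mpoly" where
  "poly_form c i = (\<Sum>k\<in>deg_monomials n d. psingle k (c (i, k)))"

lemma mpeval_poly_form [simp]: "mpeval x (poly_form c i) = form c i x"
  by (simp add: poly_form_def form_def mpeval.hom_sum mpeval_single)

lemma mpgrade_poly_form: "mpgrade (\<lambda>_. Suc 0) (poly_form c i) = monom (poly_form c i) d"
proof -
  have "mpgrade (\<lambda>_. Suc 0) (psingle k (c (i, k))) = monom (psingle k (c (i, k))) d" if k: "k \<in> deg_monomials n d" for k
  proof -
    have "(\<Sum>v\<in>pkeys k. plookup k v) = (\<Sum>v<n. plookup k v)"
      using k by (intro sum.mono_neutral_left) (auto simp: deg_monomials_def in_keys_iff)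
    with k show ?thesis by (simp add: mpgrade_single deg_monomials_def)
  qed
  then show ?thesis by (simp add: poly_form_def mpgrade.hom_sum sum_monom)
qed

lemma lookup_poly_form: "k \<in> deg_monomials n d \<Longrightarrow> plookup (poly_form c i) k = c (i, k)"
  by (simp add: poly_form_def lookup_sum lookup_single when_def)

lemma homogeneous_poly_form: "homogeneous_poly n d (poly_form c i)"
  unfolding poly_form_def by (intro homogeneous_poly_sum) (auto simp: homogeneous_poly_def)

definition form_ideal :: "(coeff_idx \<Rightarrow> complex) \<Rightarrow> (nat, complex) mpoly set" where
  "form_ideal c = {p. \<exists>h. p = (\<Sum>i<n. h i * poly_form c i)}"

lemma mp_ideal_form_ideal: "mp_ideal (form_ideal c)"
  unfolding mp_ideal_def
proof (intro conjI ballI allI)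
  show "0 \<in> form_ideal c"
    unfolding form_ideal_def by (intro CollectI exI[of _ "\<lambda>_. 0"]) simp
next
  fix p q assume "p \<in> form_ideal c" "q \<in> form_ideal c"
  then obtain h h' where "p = (\<Sum>i<n. h i * poly_form c i)" "q = (\<Sum>i<n. h' i * poly_form c i)"
    unfolding form_ideal_def by blast
  then show "p + q \<in> form_ideal c"
    unfolding form_ideal_def by (intro CollectI exI[of _ "\<lambda>i. h i + h' i"]) (simp add: distrib_right sum.distrib)
next
  fix p r assume "p \<in> form_ideal c"
  then obtain h where "p = (\<Sum>i<n. h i * poly_form c i)" unfolding form_ideal_def by blast
  then show "r * p \<in> form_ideal c"
    unfolding form_ideal_def by (intro CollectI exI[of _ "\<lambda>i. r * h i"]) (simp add: sum_distrib_left mult.assoc)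
qed

text \<open>Multiplication by a form of degree \<open>d\<close> shifts the grading by
  \<open>d\<close>, so the components of the multipliers \<open>h i\<close> express the components
  of \<open>p\<close>.\<close>

lemma coeff_mpgrade_form_ideal:
  assumes "p \<in> form_ideal c"
  shows "coeff (mpgrade (\<lambda>_. Suc 0) p) e \<in> form_ideal c"
proof -
  from assms obtain h where h: "p = (\<Sum>i<n. h i * poly_form c i)" unfolding form_ideal_def by blast
  have "coeff (mpgrade (\<lambda>_. Suc 0) p) e = (\<Sum>i<n. (if e < d then 0 else coeff (mpgrade (\<lambda>_. Suc 0) (h i)) (e - d)) * poly_form c i)"
    unfolding h mpgrade.hom_sum mpgrade.hom_mult mpgrade_poly_form coeff_sum
    by (intro sum.cong refl, subst mult.commute, subst coeff_monom_mult) (simp add: mult.commute)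
  then show ?thesis
    unfolding form_ideal_def by (intro CollectI) (rule exI)
qed

text \<open>By the weak Nullstellensatz the ideal of the forms together with \<open>x\<^sub>j - 1\<close> is the unit ideal; comparing homogeneous components
  then yields a power of \<open>x\<^sub>j\<close>.\<close>
lemma var_power_in_form_ideal:
  assumes c: "\<nexists>x. nontrivial_zero c x" and j: "j < n"
  shows "\<exists>K. mpvar j ^ K \<in> form_ideal c"
proof -
  note I = mp_ideal_form_ideal[of c]
  define J where "J = {p. \<exists>f\<in>form_ideal c. \<exists>g. p = f + g * (mpvar j - 1)}"
  have "mp_ideal J"
    unfolding mp_ideal_def
  proof (intro conjI ballI allI)
    show "0 \<in> J" unfolding J_def by (intro CollectI bexI[of _ 0] exI[of _ 0]) (simp_all add: mp_idealD(1)[OF I])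
  next
    fix p q assume "p \<in> J" "q \<in> J"
    then obtain f g f' g' where fg: "f \<in> form_ideal c" "f' \<in> form_ideal c" "p = f + g * (mpvar j - 1)" "q = f' + g' * (mpvar j - 1)"
      unfolding J_def by blast
    show "p + q \<in> J"
      unfolding J_def
      by (intro CollectI bexI[of _ "f + f'"] exI[of _ "g + g'"]) (simp_all add: mp_idealD(2)[OF I] fg algebra_simps)
  next
    fix p r assume "p \<in> J"
    then obtain f g where fg: "f \<in> form_ideal c" "p = f + g * (mpvar j - 1)" unfolding J_def by blast
    show "r * p \<in> J"
      unfolding J_def
      by (intro CollectI bexI[of _ "r * f"] exI[of _ "r * g"] mp_idealD(3)[OF I fg(1)]) (simp add: fg algebra_simps)
  qed
  have "1 \<in> J"
  proof (rule ccontr)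
    assume "1 \<notin> J"
    from weak_nullstellensatz[OF \<open>mp_ideal J\<close> this] obtain a where "\<forall>p\<in>J. mpeval a p = 0" ..
    note a = bspec[OF this]
    have "mpvar j - 1 \<in> J"
      unfolding J_def by (intro CollectI bexI[of _ 0] exI[of _ 1]) (simp_all add: mp_idealD(1)[OF I])
    from a[OF this] have "a j = 1" by (simp add: mpeval_ring.hom_minus)
    moreover have "form c i a = 0" if i: "i < n" for i
    proof -
      have "poly_form c i \<in> form_ideal c"
        unfolding form_ideal_def using i
        by (intro CollectI exI[of _ "\<lambda>i'. if i' = i then 1 else 0"]) (simp add: if_distrib[of "\<lambda>h. h * _"] cong: if_cong)
      then have "poly_form c i \<in> J"
        unfolding J_def by (intro CollectI bexI[of _ "poly_form c i"] exI[of _ 0]) simp_all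
      from a[OF this] show ?thesis by simp
    qed
    moreover have "\<exists>i<n. a i \<noteq> 0" using \<open>a j = 1\<close> j by (intro exI[of _ j]) simp
    ultimately have "nontrivial_zero c a" by (simp add: nontrivial_zero_def)
    with c show False by blast
  qed
  then obtain f g where f: "f \<in> form_ideal c" and fg: "1 = f + g * (mpvar j - 1)" unfolding J_def by blast
  define G where "G = mpgrade (\<lambda>_. Suc 0) g"
  define f' where "f' = mpgrade (\<lambda>_. Suc 0) f"
  have f': "coeff f' e \<in> form_ideal c" for e unfolding f'_def by (rule coeff_mpgrade_form_ideal[OF f])
  have "mpgrade (\<lambda>_. Suc 0) (mpvar j - 1 :: (nat, complex) mpoly) = [:- 1, mpvar j:]"
    by (simp add: mpgrade_ring.hom_minus mpgrade_var mpgrade.hom_one monom_Suc monom_0 one_pCons)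
  then have "1 = f' + G * [:- 1, mpvar j:]"
    using arg_cong[OF fg, of "mpgrade (\<lambda>_. Suc 0)"]
    by (simp only: mpgrade.hom_add mpgrade.hom_mult mpgrade.hom_one f'_def G_def)
  then have eq: "1 = f' + (pCons 0 (Polynomial.smult (mpvar j) G) - G)" by simp
  \<comment> \<open>Modulo the ideal, each coefficient of \<open>G\<close> is \<open>x_j\<close>
    times the preceding one, starting from \<open>- 1\<close>; beyond the degree of \<open>G\<close>
    only the power of \<open>x_j\<close> remains.\<close>
  have "coeff G e + mpvar j ^ e \<in> form_ideal c" for e
  proof (induction e)
    case 0
    have "coeff G 0 + mpvar j ^ 0 = coeff f' 0"
      using arg_cong[OF eq, of "\<lambda>p. coeff p 0"] by (simp add: algebra_simps)
    with f' show ?case by simp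
  next
    case (Suc e)
    have "coeff G (Suc e) = coeff f' (Suc e) + mpvar j * coeff G e"
      using arg_cong[OF eq, of "\<lambda>p. coeff p (Suc e)"] by (simp add: algebra_simps)
    then have "coeff G (Suc e) + mpvar j ^ Suc e = coeff f' (Suc e) + mpvar j * (coeff G e + mpvar j ^ e)"
      by (simp add: algebra_simps)
    with Suc f' show ?case by (simp add: mp_idealD(2,3)[OF I])
  qed
  from this[of "Suc (degree G)"] have "mpvar j ^ Suc (degree G) \<in> form_ideal c"
    by (simp only: coeff_eq_0[of G "Suc (degree G)"] add_0_left lessI)
  then show ?thesis ..
qed

text \<open>Pigeonhole: a monomial whose degree exceeds the sum of the exponents \<open>K j\<close>
  is divisible by one of the powers in the ideal.\<close>

lemma monomials_in_form_ideal:
  assumes "\<nexists>x. nontrivial_zero c x"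
  obtains e where "\<And>a. a \<in> deg_monomials n (e + d) \<Longrightarrow> psingle a 1 \<in> form_ideal c"
proof -
  note I = mp_ideal_form_ideal[of c]
  have "\<forall>j. \<exists>K. j < n \<longrightarrow> mpvar j ^ K \<in> form_ideal c" using var_power_in_form_ideal[OF assms] by blast
  then obtain K where K: "\<And>j. j < n \<Longrightarrow> mpvar j ^ K j \<in> form_ideal c" by metis
  define e where "e = (\<Sum>j<n. K j)"
  have "psingle a 1 \<in> form_ideal c" if a: "a \<in> deg_monomials n (e + d)" for a
  proof -
    have "\<exists>j<n. K j \<le> plookup a j"
    proof (rule ccontr)
      assume "\<not> ?thesis"
      then have "(\<Sum>j<n. plookup a j) \<le> e" unfolding e_def by (intro sum_mono) (auto simp: not_le)
      with a d show False by (simp add: deg_monomials_def)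
    qed
    then obtain j where j: "j < n" "K j \<le> plookup a j" by blast
    have "(a - psingle j (K j)) + psingle j (K j) = a"
      by (rule poly_mapping_eqI) (use j in \<open>auto simp: lookup_add lookup_minus lookup_single when_def\<close>)
    then have "psingle a (1::complex) = psingle (a - psingle j (K j)) 1 * mpvar j ^ K j"
      by (simp add: mpvar_power mult_single)
    with K[OF j(1)] show ?thesis by (simp add: mp_idealD(3)[OF I])
  qed
  then show ?thesis by (rule that)
qed

text \<open>\<open>h\<close> need not be homogeneous: only its component of degree \<open>e\<close>
  contributes to a monomial of degree \<open>e + d\<close>.\<close>

lemma lookup_mult_poly_form:
  assumes b: "b \<in> deg_monomials n (e + d)"
  shows "plookup (h * poly_form c i) b =
    (\<Sum>l\<in>deg_monomials n e. \<Sum>k\<in>deg_monomials n d. if l + k = b then plookup h l * c (i, k) else 0)"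
proof -
  let ?t = "\<lambda>l. \<Sum>k\<in>deg_monomials n d. if l + k = b then plookup h l * c (i, k) else 0"
  have "h * poly_form c i = (\<Sum>l\<in>pkeys h. psingle l (plookup h l)) * poly_form c i"
    by (simp add: poly_mapping_sum_single)
  also have "\<dots> = (\<Sum>l\<in>pkeys h. \<Sum>k\<in>deg_monomials n d. psingle (l + k) (plookup h l * c (i, k)))"
    by (simp add: poly_form_def sum_product mult_single)
  finally have "plookup (h * poly_form c i) b = (\<Sum>l\<in>pkeys h. ?t l)"
    by (simp add: lookup_sum lookup_single when_def)
  also have "\<dots> = (\<Sum>l\<in>pkeys h \<union> deg_monomials n e. ?t l)"
    by (intro sum.mono_neutral_left) (auto simp: in_keys_iff intro!: sum.neutral)
  also have "\<dots> = (\<Sum>l\<in>deg_monomials n e. ?t l)"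
    using b left_deg_monomials[of _ _ n e d] by (intro sum.mono_neutral_right) (auto intro!: sum.neutral)
  finally show ?thesis .
qed

text \<open>The rows are built from multipliers \<open>h a\<close> that express each monomial
  \<open>a\<close> by the forms of this very \<open>c\<close>, so at \<open>c\<close> the matrix is
  the identity. The multipliers stay fixed when the coefficients vary, which keeps the determinant
  in the ideal.\<close>

lemma vanishing_separates:
  assumes "\<nexists>x. nontrivial_zero c x"
  obtains D where "D \<in> vanishing" "mpeval c D = 1"
proof -
  obtain e where e: "\<And>a. a \<in> deg_monomials n (e + d) \<Longrightarrow> psingle a 1 \<in> form_ideal c"
    by (rule monomials_in_form_ideal[OF assms]) (rule that)
  then have "\<forall>a. \<exists>h. a \<in> deg_monomials n (e + d) \<longrightarrow> psingle a 1 = (\<Sum>i<n. h i * poly_form c i)"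
    unfolding form_ideal_def by blast
  then obtain h where h: "\<And>a. a \<in> deg_monomials n (e + d) \<Longrightarrow> psingle a 1 = (\<Sum>i<n. h a i * poly_form c i)" by metis
  obtain ms where ms: "set ms = deg_monomials n (e + d)" "distinct ms"
    using finite_distinct_list[OF finite_deg_monomials] by blast
  let ?S = "length ms"
  define H where "H = (\<lambda>a i l. plookup (h a i) l)"
  obtain D where D: "D \<in> vanishing"
    "\<And>c. mpeval c D = det (mat ?S ?S (\<lambda>(a, b). det_entry e H c (ms ! a) (ms ! b)))"
    by (rule vanishing_det[OF ms]) (rule that)
  have entry: "det_entry e H c a b = (if a = b then 1 else 0)"
    if "a \<in> deg_monomials n (e + d)" "b \<in> deg_monomials n (e + d)" for a b
  proof -
    have "det_entry e H c a b = plookup (\<Sum>i<n. h a i * poly_form c i) b"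
      using that(2) by (simp add: det_entry_def H_def lookup_sum lookup_mult_poly_form)
    also have "\<dots> = plookup (psingle a (1::complex)) b" using h[OF that(1)] by simp
    finally show ?thesis by (simp add: lookup_single when_def)
  qed
  have "mat ?S ?S (\<lambda>(a, b). det_entry e H c (ms ! a) (ms ! b)) = 1\<^sub>m ?S"
  proof (rule eq_matI)
    fix a b assume "a < dim_row (1\<^sub>m ?S :: complex mat)" "b < dim_col (1\<^sub>m ?S :: complex mat)"
    then have ab: "a < ?S" "b < ?S" by auto
    then have "ms ! a \<in> deg_monomials n (e + d)" "ms ! b \<in> deg_monomials n (e + d)" using ms(1) nth_mem by blast+
    moreover have "ms ! a = ms ! b \<longleftrightarrow> a = b" using ab ms(2) nth_eq_iff_index_eq by blast
    ultimately show "mat ?S ?S (\<lambda>(a, b). det_entry e H c (ms ! a) (ms ! b)) $$ (a, b) = 1\<^sub>m ?S $$ (a, b)"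
      using ab by (simp add: entry)
  qed auto
  then have "mpeval c D = 1" by (simp add: D(2))
  with D(1) show ?thesis by (rule that)
qed

lemma gen_eq_0_iff: "mpeval c gen = 0 \<longleftrightarrow> (\<exists>x. nontrivial_zero c x)"
proof
  assume 0: "mpeval c gen = 0"
  show "\<exists>x. nontrivial_zero c x"
  proof (rule ccontr)
    assume "\<nexists>x. nontrivial_zero c x"
    then obtain D where D: "D \<in> vanishing" "mpeval c D = 1" by (rule vanishing_separates)
    from gen_dvd[OF D(1)] obtain q where "D = gen * q" by (rule dvdE)
    with 0 D(2) show False by (simp add: mpeval.hom_mult)
  qed
qed (use gen(1) in \<open>blast dest: vanishingD\<close>)

section \<open>Existence and uniqueness of the resultant\<close>

abbreviation unit_sys :: "coeff_idx \<Rightarrow> complex" where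
  "unit_sys \<equiv> system_coeffs (\<lambda>i. mpvar i ^ d)"

lemma unit_sys: "unit_sys = (\<lambda>(i, k). if k = psingle i d then 1 else 0)"
  by (auto simp: system_coeffs_def mpvar_power lookup_single when_def fun_eq_iff)

lemma form_diag_sys: "i < n \<Longrightarrow> form (diag_sys j u) i x = (if i = j then u else 1) * x i ^ d"
  by (simp add: form_def diag_sys_def psingle_deg_monomials if_distrib[of "\<lambda>a. a * _"] cong: if_cong)

lemma unit_sys_no_zero: "\<not> nontrivial_zero unit_sys x"
proof -
  have "unit_sys = diag_sys 0 1" by (auto simp: unit_sys diag_sys_def fun_eq_iff)
  then show ?thesis using d by (auto simp: nontrivial_zero_def form_diag_sys)
qed

definition res :: "(coeff_idx, complex) mpoly" where
  "res = mpconst (inverse (mpeval unit_sys gen)) * gen"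

lemma gen_unit_sys: "mpeval unit_sys gen \<noteq> 0"
  unfolding gen_eq_0_iff using unit_sys_no_zero by blast

lemma gen_eq_res: "gen = mpconst (mpeval unit_sys gen) * res"
  by (simp add: res_def gen_unit_sys flip: mult.assoc mpconst_mult)

lemma mpeval_res: "mpeval c res = inverse (mpeval unit_sys gen) * mpeval c gen"
  by (simp add: res_def mpeval.hom_mult)

lemma res_unit_sys: "mpeval unit_sys res = 1"
  by (simp add: mpeval_res gen_unit_sys)

lemma res_eq_0_iff: "mpeval c res = 0 \<longleftrightarrow> (\<exists>x. nontrivial_zero c x)"
  using gen_unit_sys by (simp add: mpeval_res gen_eq_0_iff)

lemma res_vanishing: "res \<in> vanishing"
  unfolding res_def by (intro vanishing_mult gen)

lemma res_nonzero: "res \<noteq> 0"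
  using res_unit_sys by auto

lemma res_dvd: "p \<in> vanishing \<Longrightarrow> res dvd p"
  using gen_dvd[of p] gen_eq_res by (metis dvd_mult_right)

lemma mpvars_res: "mpvars res \<subseteq> {..<n} \<times> deg_monomials n d"
  unfolding res_def using mpvars_mult[of "mpconst (inverse (mpeval unit_sys gen))" gen] mpvars_gen by simp

lemma irreducible_res: "irreducible res"
  unfolding irreducible_def
proof (intro conjI allI impI)
  show "res \<noteq> 0" by (rule res_nonzero)
  show "\<not> res dvd 1" using unit_not_vanishing res_vanishing by blast
  fix a b assume "res = a * b"
  then have "gen = (mpconst (mpeval unit_sys gen) * a) * b" using gen_eq_res by (simp add: mult.assoc)
  with irreducible_gen have "mpconst (mpeval unit_sys gen) * a dvd 1 \<or> b dvd 1" unfolding irreducible_def by blast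
  then show "a dvd 1 \<or> b dvd 1" using dvd_mult_right by blast
qed

lemma common_zero_iff:
  assumes "\<forall>i<n. homogeneous_poly n d (F i)"
  shows "(\<exists>x\<in>carrier_vec n. x \<noteq> 0\<^sub>v n \<and> (\<forall>i<n. mpeval (\<lambda>j. x $ j) (F i) = 0)) \<longleftrightarrow>
    (\<exists>y. nontrivial_zero (system_coeffs F) y)"
proof -
  have ev: "mpeval x (F i) = form (system_coeffs F) i x" if "i < n" for i x
    using assms that by (simp add: mpeval_homogeneous form_def system_coeffs_def)
  show ?thesis
  proof
    assume "\<exists>x\<in>carrier_vec n. x \<noteq> 0\<^sub>v n \<and> (\<forall>i<n. mpeval (\<lambda>j. x $ j) (F i) = 0)"
    then obtain x where x: "x \<in> carrier_vec n" "x \<noteq> 0\<^sub>v n" "\<And>i. i < n \<Longrightarrow> mpeval (\<lambda>j. x $ j) (F i) = 0" by auto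
    then have "\<exists>i<n. x $ i \<noteq> 0" by (metis carrier_vecD eq_vecI index_zero_vec(1) index_zero_vec(2))
    then have "nontrivial_zero (system_coeffs F) (\<lambda>j. x $ j)"
      using x by (simp add: nontrivial_zero_def ev)
    then show "\<exists>y. nontrivial_zero (system_coeffs F) y" by (rule exI[of _ "\<lambda>j. x $ j"])
  next
    assume "\<exists>y. nontrivial_zero (system_coeffs F) y"
    then obtain x :: "nat \<Rightarrow> complex" where x: "nontrivial_zero (system_coeffs F) x" ..
    have "form (system_coeffs F) i (\<lambda>j. vec n x $ j) = form (system_coeffs F) i x" for i
      unfolding form_def by (intro sum.cong refl arg_cong2[of _ _ _ _ "(*)"] moneval_cong_deg) auto
    with x have "\<forall>i<n. mpeval (\<lambda>j. vec n x $ j) (F i) = 0" by (simp add: ev nontrivial_zero_def)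
    moreover have "vec n x \<noteq> 0\<^sub>v n" using x unfolding nontrivial_zero_def by (metis index_vec index_zero_vec(1))
    ultimately show "\<exists>x\<in>carrier_vec n. x \<noteq> 0\<^sub>v n \<and> (\<forall>i<n. mpeval (\<lambda>j. x $ j) (F i) = 0)"
      by (intro bexI[of _ "vec n x"]) auto
  qed
qed

lemma is_resultant_res: "is_resultant n d res"
  unfolding is_resultant_def
  using mpvars_res irreducible_res res_unit_sys common_zero_iff by (simp add: res_eq_0_iff)

lemma is_resultant_unique:
  assumes "is_resultant n d R" shows "R = res"
proof -
  have "R \<in> vanishing"
    unfolding vanishing_def
  proof (intro CollectI allI impI)
    fix c x assume z: "nontrivial_zero c x"
    \<comment> \<open>\<open>c\<close> may be nonzero at indices outside the system;
      \<open>poly_form c\<close> discards them, and \<open>R\<close> does not involve them.\<close>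
    have eq: "system_coeffs (poly_form c) (i, k) = c (i, k)" if "k \<in> deg_monomials n d" for i k
      using that by (simp add: system_coeffs_def lookup_poly_form)
    then have "form (system_coeffs (poly_form c)) i x = form c i x" for i
      by (simp add: form_def)
    with z have "nontrivial_zero (system_coeffs (poly_form c)) x" by (simp add: nontrivial_zero_def)
    then have "mpeval (system_coeffs (poly_form c)) R = 0"
      using assms common_zero_iff[of "poly_form c"] homogeneous_poly_form unfolding is_resultant_def by blast
    moreover have "mpeval (system_coeffs (poly_form c)) R = mpeval c R"
      using assms eq unfolding is_resultant_def by (intro mpeval_cong) auto
    ultimately show "mpeval c R = 0" by simp
  qed
  then obtain q where q: "R = res * q" using res_dvd by (auto elim: dvdE)
  have "irreducible R" using assms by (simp add: is_resultant_def)
  with q have "res dvd 1 \<or> q dvd 1" unfolding irreducible_def by blast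
  then have "q dvd 1" using unit_not_vanishing res_vanishing by blast
  then obtain k where k: "q = mpconst k" by (rule mp_unitE)
  have "mpeval unit_sys R = 1" using assms by (simp add: is_resultant_def)
  then have "k = 1" by (simp add: q k mpeval.hom_mult res_unit_sys)
  then show ?thesis by (simp add: q k)
qed

lemma resultant_poly_eq_res: "resultant_poly n d = res"
  unfolding resultant_poly_def using is_resultant_res is_resultant_unique by (rule the_equality)

end

section \<open>Polynomials in one variable: monomial divisors, reversal, derivatives\<close>

lemma dvd_power_var_imp_monom:
  fixes p :: "complex poly"
  assumes "p dvd monom 1 N"
  shows "\<exists>c r. p = monom c r \<and> r \<le> N"
proof -
  from assms obtain q where q: "monom 1 N = p * q" by (rule dvdE)
  then have nz: "p \<noteq> 0" "q \<noteq> 0" by (metis monom_eq_0_iff mult_zero_left mult_zero_right one_neq_zero)+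
  have root: "z = 0" if "poly p z = 0" for z
  proof -
    have "z ^ N = poly p z * poly q z" using arg_cong[OF q, of "\<lambda>p. poly p z"] by (simp add: poly_monom)
    with that show ?thesis by simp
  qed
  have "\<exists>c r. p = monom c r"
  proof (cases "poly p 0 = 0")
    case True
    then have "{z. poly p z = 0} = {0}" using root by auto
    then have "p = Polynomial.smult (lead_coeff p) ([:0, 1:] ^ order 0 p)"
      using complex_poly_decompose[of p] by simp
    then show ?thesis by (metis monom_altdef)
  next
    case False
    then have "{z. poly p z = 0} = {}" using root by auto
    then have "p = monom (lead_coeff p) 0"
      using complex_poly_decompose[of p] by (simp add: monom_0)
    then show ?thesis by blast
  qed
  then obtain c r where cr: "p = monom c r" by blast
  have "degree p \<le> degree (monom (1::complex) N)"
    unfolding q using nz by (simp add: degree_mult_eq)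
  with nz show ?thesis by (auto simp: cr degree_monom_eq)
qed

lemma poly_ext: "(\<And>s. poly p s = poly q s) \<Longrightarrow> p = q"
  for p q :: "complex poly"
  by (subst poly_eq_poly_eq_iff[symmetric]) (rule ext)

lemma polyfun_poly: "polyfun (poly p)"
  unfolding polyfun_def by blast

lemma polyfun_eq_off_0:
  assumes "polyfun f" "polyfun g" "\<And>s. s \<noteq> 0 \<Longrightarrow> f s = g s"
  shows "f s = g s"
proof (cases "s = 0")
  case True
  have "f 0 - g 0 = 0"
    by (rule polyfun_eq_0_at_0[of "\<lambda>s. f s - g s"]) (use assms in auto)
  with True show ?thesis by simp
qed (use assms in auto)

text \<open>\<open>H\<close> is \<open>G\<close> read backwards with respect to degree
  \<open>r\<close>; the nonzero constant term of \<open>G\<close> becomes the leading coefficient of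
  \<open>H\<close>, so the degree does not drop.\<close>

lemma reflected_poly:
  fixes H G :: "complex poly"
  assumes rel: "\<And>t. t \<noteq> 0 \<Longrightarrow> poly H t = t ^ r * poly G (inverse t)" and G0: "poly G 0 \<noteq> 0"
  shows "degree H = r" "reflect_poly H = G"
proof -
  have eq: "reflect_poly H * monom 1 r = monom 1 (degree H) * G"
  proof (rule poly_ext, rule polyfun_eq_off_0[of "poly (reflect_poly H * monom 1 r)"])
    fix s :: complex assume s: "s \<noteq> 0"
    then have "inverse s ^ r * s ^ r = 1" by (simp flip: power_mult_distrib)
    with s rel[of "inverse s"] show "poly (reflect_poly H * monom 1 r) s = poly (monom 1 (degree H) * G) s"
      by (simp add: poly_reflect_poly_nz poly_monom)
  qed (rule polyfun_poly)+
  have H0: "H \<noteq> 0"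
  proof
    assume "H = 0"
    with eq have "monom 1 0 * G = 0" by simp
    with G0 show False by (auto simp: monom_0)
  qed
  then have c: "coeff (reflect_poly H) 0 \<noteq> 0" by simp
  show deg: "degree H = r"
  proof (rule linorder_cases[of "degree H" r])
    assume "degree H < r"
    then have "coeff (monom 1 r * reflect_poly H) (degree H) = 0" "coeff (monom 1 (degree H) * G) (degree H) = poly G 0"
      by (simp_all add: coeff_monom_mult poly_0_coeff_0)
    with eq G0 show ?thesis by (simp add: mult.commute)
  next
    assume "degree H > r"
    then have "coeff (monom 1 r * reflect_poly H) r = coeff (reflect_poly H) 0" "coeff (monom 1 (degree H) * G) r = 0"
      by (simp_all add: coeff_monom_mult)
    with eq c show ?thesis by (simp add: mult.commute)
  qed
  have "monom 1 r * reflect_poly H = monom 1 r * G" using eq deg by (simp add: mult.commute)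
  then show "reflect_poly H = G" by simp
qed

text \<open>The fundamental theorem of algebra. It turns the absence of nontrivial zeros along a
  line of systems into constancy of the resultant.\<close>

lemma polyfun_nonzero_imp_const:
  assumes "polyfun f" "\<And>s. f s \<noteq> 0" shows "f s = f 0"
proof -
  from assms(1) obtain p where p: "\<And>s. f s = poly p s" unfolding polyfun_def by metis
  have "constant (poly p)"
    using fundamental_theorem_of_algebra[of p] assms(2) by (auto simp: p)
  then show ?thesis unfolding p constant_def by blast
qed

text \<open>One gradient \<open>L\<close> serves all directions \<open>w\<close>: it can be
  determined by testing single coordinates and then applied to any system.\<close>

lemma mpeval_directional_derivative:
  assumes "finite V" "mpvars p \<subseteq> V"
  shows "\<exists>L. \<forall>w. ((\<lambda>e. mpeval (\<lambda>v. a v + e * w v) p) has_field_derivative (\<Sum>v\<in>V. L v * w v)) (at (0::complex))"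
proof (induction p rule: mpoly_induct)
  case (const c)
  show ?case by (intro exI[of _ "\<lambda>_. 0"]) simp
next
  case (var u)
  then have "u \<in> V" using assms by blast
  have *: "((\<lambda>e. a u + e * w u) has_field_derivative w u) (at 0)" for w :: "_ \<Rightarrow> complex"
    by (auto intro!: derivative_eq_intros)
  have **: "(\<Sum>v\<in>V. (if v = u then 1 else 0) * w v) = w u" for w :: "_ \<Rightarrow> complex"
    using \<open>u \<in> V\<close> assms(1) by (simp add: if_distrib[of "\<lambda>z. z * _"] cong: if_cong)
  show ?case
    by (rule exI[of _ "\<lambda>v. if v = u then 1 else 0"], rule allI) (unfold ** mpeval_var, rule *)
next
  case (add p q)
  from add(1) obtain L where L: "\<forall>w. ((\<lambda>e. mpeval (\<lambda>v. a v + e * w v) p) has_field_derivative (\<Sum>v\<in>V. L v * w v)) (at 0)" ..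
  from add(2) obtain M where M: "\<forall>w. ((\<lambda>e. mpeval (\<lambda>v. a v + e * w v) q) has_field_derivative (\<Sum>v\<in>V. M v * w v)) (at 0)" ..
  have "((\<lambda>e. mpeval (\<lambda>v. a v + e * w v) (p + q)) has_field_derivative (\<Sum>v\<in>V. L v * w v) + (\<Sum>v\<in>V. M v * w v)) (at 0)" for w
    unfolding mpeval.hom_add by (rule DERIV_add[OF L[rule_format] M[rule_format]])
  then show ?case by (intro exI[of _ "\<lambda>v. L v + M v"]) (simp add: distrib_right sum.distrib)
next
  case (mult p q)
  from mult(1) obtain L where L: "\<forall>w. ((\<lambda>e. mpeval (\<lambda>v. a v + e * w v) p) has_field_derivative (\<Sum>v\<in>V. L v * w v)) (at 0)" ..
  from mult(2) obtain M where M: "\<forall>w. ((\<lambda>e. mpeval (\<lambda>v. a v + e * w v) q) has_field_derivative (\<Sum>v\<in>V. M v * w v)) (at 0)" ..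
  have "((\<lambda>e. mpeval (\<lambda>v. a v + e * w v) (p * q)) has_field_derivative
      (\<Sum>v\<in>V. L v * w v) * mpeval (\<lambda>v. a v + 0 * w v) q + (\<Sum>v\<in>V. M v * w v) * mpeval (\<lambda>v. a v + 0 * w v) p) (at 0)" for w
    unfolding mpeval.hom_mult by (rule DERIV_mult[OF L[rule_format] M[rule_format]])
  note * = this
  have **: "(\<Sum>v\<in>V. (L v * mpeval a q + M v * mpeval a p) * w v) =
      (\<Sum>v\<in>V. L v * w v) * mpeval (\<lambda>v. a v + 0 * w v) q + (\<Sum>v\<in>V. M v * w v) * mpeval (\<lambda>v. a v + 0 * w v) p" for w
    unfolding sum_distrib_right sum.distrib[symmetric] by (intro sum.cong) (simp_all add: algebra_simps)
  show ?case
    by (rule exI[of _ "\<lambda>v. L v * mpeval a q + M v * mpeval a p"], rule allI) (unfold **, rule *)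
qed

lemma DERIV_one_plus_power: "((\<lambda>e. (1 + e) ^ N) has_field_derivative of_nat N) (at (0::complex))"
  by (auto intro!: derivative_eq_intros)

section \<open>The degree of the resultant in the coefficients of one form\<close>

context form_systems
begin

definition scale_block :: "nat \<Rightarrow> complex \<Rightarrow> (coeff_idx \<Rightarrow> complex) \<Rightarrow> coeff_idx \<Rightarrow> complex" where
  "scale_block j u c = (\<lambda>(i, k). if i = j then u * c (i, k) else c (i, k))"

lemma form_scale_block: "form (scale_block j u c) i x = (if i = j then u else 1) * form c i x"
  by (simp add: form_def scale_block_def sum_distrib_left mult.assoc)

lemma nontrivial_zero_scale_block: "nontrivial_zero c x \<Longrightarrow> nontrivial_zero (scale_block j u c) x"
  by (simp add: nontrivial_zero_def form_scale_block)

text \<open>Scaling performed on the polynomial itself, so that divisibility by \<open>res\<close>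
  applies to the result.\<close>

definition subst_block :: "nat \<Rightarrow> complex \<Rightarrow> (coeff_idx, complex) mpoly \<Rightarrow> (coeff_idx, complex) mpoly" where
  "subst_block j u = mpsubst mpconst (\<lambda>(i, k). if i = j then mpconst u * mpvar (i, k) else mpvar (i, k))"

lemma mpeval_subst_block [simp]: "mpeval c (subst_block j u p) = mpeval (scale_block j u c) p"
  unfolding subst_block_def mpeval_mpsubst scale_block_def
  by (rule arg_cong[of _ _ "\<lambda>c. mpeval c p"]) (auto simp: mpeval.hom_mult)

lemma subst_block_vanishing: "p \<in> vanishing \<Longrightarrow> subst_block j u p \<in> vanishing"
  by (subst vanishing_def) (use vanishingD nontrivial_zero_scale_block in fastforce)

lemma scale_block_inverse: "u \<noteq> 0 \<Longrightarrow> scale_block j (inverse u) (scale_block j u c) = c"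
  by (auto simp: scale_block_def fun_eq_iff)

lemma scale_block_unit_sys: "scale_block j u unit_sys = diag_sys j u"
  by (auto simp: scale_block_def unit_sys diag_sys_def fun_eq_iff)

text \<open>The scaled resultant equals \<open>res * q u\<close>; scaling back by
  \<open>inverse u\<close> makes \<open>q u\<close> a unit, and its constant value is read off at
  the unit system.\<close>

lemma res_scale_block_nz:
  assumes u: "u \<noteq> 0"
  shows "mpeval (scale_block j u c) res = mpeval (diag_sys j u) res * mpeval c res"
proof -
  have "\<exists>q. subst_block j v res = res * q" for v
    using res_dvd[OF subst_block_vanishing[OF res_vanishing]] unfolding dvd_def .
  then obtain q where "\<And>v. subst_block j v res = res * q v" by metis
  then have q: "mpeval (scale_block j v c) res = mpeval c res * mpeval c (q v)" for v c
    unfolding mpeval_subst_block[symmetric] mpeval.hom_mult[symmetric] by simp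
  have "res * (q u * subst_block j u (q (inverse u))) = res"
  proof (rule mpoly_eqI)
    fix c
    have "mpeval c res = mpeval (scale_block j (inverse u) (scale_block j u c)) res"
      by (simp add: scale_block_inverse u)
    also have "\<dots> = mpeval c res * mpeval c (q u) * mpeval (scale_block j u c) (q (inverse u))"
      by (simp only: q)
    finally show "mpeval c (res * (q u * subst_block j u (q (inverse u)))) = mpeval c res"
      by (simp add: mpeval.hom_mult mult.assoc)
  qed
  then have "1 = q u * subst_block j u (q (inverse u))" using res_nonzero by simp
  then have "q u dvd 1" by (rule dvdI)
  then obtain k where k: "q u = mpconst k" by (rule mp_unitE)
  have "mpeval (diag_sys j u) res = k"
    using q[of u unit_sys] by (simp add: scale_block_unit_sys res_unit_sys k)
  then show ?thesis by (simp add: q k mult.commute)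
qed

lemma polyfun_scale_block: "polyfun (\<lambda>u. scale_block j u c v)"
  unfolding scale_block_def by (cases v; cases "fst v = j") auto

text \<open>On the diagonal systems \<open>res\<close> divides a determinant equal to
  \<open>u ^ N\<close>, so it is a monomial in \<open>u\<close>, with coefficient 1 by
  normalisation. The case \<open>u = 0\<close> follows by polynomiality.\<close>

lemma block_degree_exists:
  assumes j: "j < n"
  obtains r where "r \<le> d ^ (n - 1)" "\<And>u c. mpeval (scale_block j u c) res = u ^ r * mpeval c res"
proof -
  obtain D N where D: "D \<in> vanishing" "mpvars D \<subseteq> {..<n} \<times> deg_monomials n d" "N \<le> d ^ (n - 1)" "\<And>u. mpeval (diag_sys j u) D = u ^ N"
    by (rule macaulay_determinant[OF j]) (rule that)
  obtain q where q: "D = res * q" using res_dvd[OF D(1)] by (rule dvdE)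
  have pf: "polyfun (\<lambda>u. mpeval (diag_sys j u) p)" for p
    unfolding scale_block_unit_sys[symmetric] by (intro polyfun_mpeval polyfun_scale_block)
  obtain P where P: "\<And>u. mpeval (diag_sys j u) res = poly P u" using pf[of res] unfolding polyfun_def by metis
  obtain Q where Q: "\<And>u. mpeval (diag_sys j u) q = poly Q u" using pf[of q] unfolding polyfun_def by metis
  have "poly (monom 1 N) u = poly (P * Q) u" for u
    using D(4)[of u] by (simp add: poly_monom q mpeval.hom_mult P Q)
  then have "monom 1 N = P * Q" by (rule poly_ext)
  then have "P dvd monom 1 N" by (rule dvdI)
  then obtain k r where kr: "P = monom k r" "r \<le> N" using dvd_power_var_imp_monom by blast
  have "diag_sys j 1 = unit_sys" by (auto simp: diag_sys_def unit_sys fun_eq_iff)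
  then have "k = 1" using P[of 1] res_unit_sys by (simp add: kr poly_monom)
  have "mpeval (scale_block j u c) res = u ^ r * mpeval c res" for u c
  proof (rule polyfun_eq_off_0[of "\<lambda>u. mpeval (scale_block j u c) res"])
    show "polyfun (\<lambda>u. mpeval (scale_block j u c) res)" by (intro polyfun_mpeval polyfun_scale_block)
    show "polyfun (\<lambda>u. u ^ r * mpeval c res)" by auto
    fix u :: complex assume "u \<noteq> 0"
    then show "mpeval (scale_block j u c) res = u ^ r * mpeval c res"
      by (simp add: res_scale_block_nz P kr \<open>k = 1\<close> poly_monom)
  qed
  with kr(2) D(3) show ?thesis by (intro that[of r]) auto
qed

text \<open>The system \<open>x\<^sub>i\<^sup>d = x\<^sub>i\<^sub>+\<^sub>1 x\<^sub>j\<^sup>d\<^sup>-\<^sup>1\<close> (\<open>i \<noteq> j\<close>), \<open>t x\<^sub>j\<^sup>d = x\<^sub>j\<^sub>+\<^sub>1 x\<^sub>j\<^sup>d\<^sup>-\<^sup>1\<close> with cyclic indices has a nontrivial zero for every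
  root of unity \<open>t\<close> of order \<open>d\<^sup>n\<^sup>-\<^sup>1\<close>. In \<open>cyc_sys\<close> the equation number \<open>j\<close> has the two coefficients \<open>a\<close> and \<open>b\<close>.\<close>
definition nxt :: "nat \<Rightarrow> nat" where "nxt i = (if i + 1 = n then 0 else i + 1)"

text \<open>The position of \<open>i\<close> on the cycle that starts at \<open>nxt j\<close> and
  ends in \<open>j\<close>, counted from 0 to \<open>n - 1\<close>.\<close>

definition pos :: "nat \<Rightarrow> nat \<Rightarrow> nat" where "pos j i = (if j < i then i - j - 1 else i + n - j - 1)"

definition cyc_sys :: "nat \<Rightarrow> complex \<Rightarrow> complex \<Rightarrow> coeff_idx \<Rightarrow> complex" where
  "cyc_sys j a b = (\<lambda>(i, k). (if i = j then a else 1) * (if k = psingle i d then 1 else 0)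
     - (if i = j then b else 1) * (if k = psingle (nxt i) 1 + psingle j (d - 1) then 1 else 0))"

lemma form_cyc_sys:
  assumes "i < n" "j < n"
  shows "form (cyc_sys j a b) i x = (if i = j then a else 1) * x i ^ d - (if i = j then b else 1) * (x (nxt i) * x j ^ (d - 1))"
proof -
  let ?q = "psingle (nxt i) 1 + psingle j (d - 1)"
  have "nxt i < n" using assms n by (auto simp: nxt_def)
  then have "?q \<in> deg_monomials n (1 + (d - 1))"
    using assms by (intro deg_monomials_add psingle_deg_monomials)
  then have q: "?q \<in> deg_monomials n d" using d by simp
  have "form (cyc_sys j a b) i x = (\<Sum>k\<in>deg_monomials n d. (if k = psingle i d then (if i = j then a else 1) * moneval x k else 0))
      - (\<Sum>k\<in>deg_monomials n d. (if k = ?q then (if i = j then b else 1) * moneval x k else 0))"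
    unfolding form_def sum_subtractf[symmetric] by (intro sum.cong refl) (auto simp: cyc_sys_def algebra_simps)
  then show ?thesis using q assms by (simp add: psingle_deg_monomials moneval_add)
qed

lemma pos_facts:
  assumes "i < n" "j < n"
  shows "pos j j = n - 1" "pos j (nxt j) = 0" "i \<noteq> j \<Longrightarrow> pos j (nxt i) = pos j i + 1" "pos j i < n" "nxt i < n"
    "pos j i = n - 1 \<Longrightarrow> i = j"
proof -
  show "pos j j = n - 1" "nxt i < n" "pos j i < n" using assms n by (auto simp: pos_def nxt_def)
  show "pos j (nxt j) = 0" using assms n unfolding pos_def nxt_def by (cases "j + 1 = n") simp_all
  show "pos j (nxt i) = pos j i + 1" if "i \<noteq> j"
    using assms n that unfolding pos_def nxt_def by (cases "i + 1 = n"; cases "j < i") auto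
  show "i = j" if "pos j i = n - 1"
  proof (cases "j < i")
    case True
    then have "pos j i = i - j - 1" by (simp add: pos_def)
    with that True assms show ?thesis by linarith
  next
    case False
    then have "pos j i = i + n - j - 1" by (simp add: pos_def)
    with that False assms n show ?thesis by linarith
  qed
qed

text \<open>Along the cycle each coordinate is the \<open>d\<close>-th power of the preceding one,
  starting with \<open>t\<close> at \<open>nxt j\<close>; after \<open>n - 1\<close> steps the value
  at \<open>j\<close> is \<open>t ^ (d ^ (n - 1)) = 1\<close>, which closes the cycle.\<close>

lemma cyc_sys_zero:
  assumes j: "j < n" and t: "t ^ (d ^ (n - 1)) = 1"
  shows "\<exists>x :: nat \<Rightarrow> complex. nontrivial_zero (cyc_sys j t 1) x"
proof -
  define x where "x = (\<lambda>i. t ^ (d ^ pos j i))"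
  have xj: "x j = 1" using t by (simp add: x_def pos_facts(1)[OF j j])
  have "form (cyc_sys j t 1) i x = 0" if i: "i < n" for i
  proof (cases "i = j")
    case True
    have "x (nxt j) = t" by (simp add: x_def pos_facts(2)[OF j j])
    with True show ?thesis using j by (simp add: form_cyc_sys xj)
  next
    case False
    have "x (nxt i) = x i ^ d"
      using pos_facts(3)[OF i j False] by (simp add: x_def mult.commute flip: power_mult)
    with False show ?thesis using i j by (simp add: form_cyc_sys xj)
  qed
  then have "nontrivial_zero (cyc_sys j t 1) x" using j xj by (auto simp: nontrivial_zero_def)
  then show ?thesis by (rule exI[of _ x])
qed

text \<open>The parameters \<open>1\<close>, \<open>0\<close> are the point at infinity of the
  family in \<open>t\<close>. Equation \<open>j\<close> reads \<open>x_j^d = 0\<close>, and the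
  others propagate the zero backwards along the cycle. Hence the degree in \<open>t\<close> does not
  drop.\<close>

lemma cyc_sys_no_zero:
  assumes j: "j < n"
  shows "\<not> nontrivial_zero (cyc_sys j 1 0) x"
proof
  assume z: "nontrivial_zero (cyc_sys j 1 0) x"
  then have f: "form (cyc_sys j 1 0) i x = 0" if "i < n" for i using that by (simp add: nontrivial_zero_def)
  have "\<forall>i<n. pos j i = n - 1 - k \<longrightarrow> x i = 0" if "k < n" for k
    using that
  proof (induction k)
    case 0
    have "x j = 0" using f[OF j] j d by (simp add: form_cyc_sys)
    then show ?case using pos_facts(6)[OF _ j] by auto
  next
    case (Suc k)
    show ?case
    proof (intro allI impI)
      fix i assume i: "i < n" "pos j i = n - 1 - Suc k"
      with Suc.prems have ne: "i \<noteq> j" using pos_facts(1)[OF j j] by auto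
      have "pos j (nxt i) = n - 1 - k" using pos_facts(3)[OF i(1) j ne] i Suc.prems by simp
      then have "x (nxt i) = 0" using Suc pos_facts(5)[OF i(1) j] by simp
      then have "x i ^ d = 0" using f[OF i(1)] ne i(1) j by (simp add: form_cyc_sys)
      then show "x i = 0" by simp
    qed
  qed
  note * = this
  have "x i = 0" if "i < n" for i
  proof -
    have "n - 1 - pos j i < n" "pos j i = n - 1 - (n - 1 - pos j i)" using pos_facts(4)[OF that j] by simp_all
    with *[of "n - 1 - pos j i"] that show ?thesis by blast
  qed
  with z show False by (auto simp: nontrivial_zero_def)
qed

text \<open>As a polynomial in \<open>t\<close>, the resultant of the cyclic system has exact degree
  \<open>r\<close> and vanishes at \<open>d ^ (n - 1)\<close> roots of unity, so the upper bound on
  \<open>r\<close> is attained.\<close>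

lemma res_scale_block:
  assumes j: "j < n"
  shows "mpeval (scale_block j u c) res = u ^ (d ^ (n - 1)) * mpeval c res"
proof -
  obtain r where r: "r \<le> d ^ (n - 1)" "\<And>u c. mpeval (scale_block j u c) res = u ^ r * mpeval c res"
    by (rule block_degree_exists[OF j]) (rule that)
  have pf: "polyfun (\<lambda>t. cyc_sys j (a t) (b t) v)" if "polyfun a" "polyfun b" for a b v
    unfolding cyc_sys_def using that by (cases v; cases "fst v = j") auto
  have "polyfun (\<lambda>t. mpeval (cyc_sys j t 1) res)" "polyfun (\<lambda>t. mpeval (cyc_sys j 1 t) res)"
    by (intro polyfun_mpeval pf; blast)+
  then obtain H G where H: "\<And>t. mpeval (cyc_sys j t 1) res = poly H t" and G: "\<And>t. mpeval (cyc_sys j 1 t) res = poly G t"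
    unfolding polyfun_def by metis
  have "poly H t = t ^ r * poly G (inverse t)" if "t \<noteq> 0" for t
  proof -
    have "cyc_sys j t 1 = scale_block j t (cyc_sys j 1 (inverse t))"
      using that by (auto simp: cyc_sys_def scale_block_def fun_eq_iff right_diff_distrib)
    then show ?thesis unfolding H[symmetric] G[symmetric] by (simp only: r(2))
  qed
  note rel = this
  have G0: "poly G 0 \<noteq> 0"
    unfolding G[symmetric] res_eq_0_iff using cyc_sys_no_zero[OF j] by blast
  have deg: "degree H = r" and "reflect_poly H = G"
    by (rule reflected_poly[OF rel G0]; assumption)+
  then have H0: "H \<noteq> 0" using G0 by auto
  have "{t. t ^ (d ^ (n - 1)) = 1} \<subseteq> {t. poly H t = 0}"
    using cyc_sys_zero[OF j] by (auto simp: H[symmetric] res_eq_0_iff)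
  then have "card {t::complex. t ^ (d ^ (n - 1)) = 1} \<le> card {t. poly H t = 0}"
    by (rule card_mono[OF poly_roots_finite[OF H0]])
  also have "\<dots> \<le> r" using poly_roots_degree[OF H0] deg by simp
  also have "card {t::complex. t ^ (d ^ (n - 1)) = 1} = d ^ (n - 1)"
    using d by (intro card_roots_unity_eq) simp
  finally have "r = d ^ (n - 1)" using r(1) by simp
  then show ?thesis by (simp add: r(2))
qed

lemma res_scale: "mpeval (\<lambda>v. u * c v) res = u ^ (n * d ^ (n - 1)) * mpeval c res"
proof -
  have "mpeval (\<lambda>(i, k). if i < j then u * c (i, k) else c (i, k)) res = u ^ (j * d ^ (n - 1)) * mpeval c res"
    if "j \<le> n" for j
    using that
  proof (induction j)
    case (Suc j)
    have "(\<lambda>(i, k). if i < Suc j then u * c (i, k) else c (i, k)) =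
        scale_block j u (\<lambda>(i, k). if i < j then u * c (i, k) else c (i, k))"
      by (auto simp: scale_block_def fun_eq_iff)
    with Suc show ?case by (simp add: res_scale_block power_add)
  qed (simp add: case_prod_eta)
  from this[of n] have "mpeval (\<lambda>(i, k). if i < n then u * c (i, k) else c (i, k)) res = u ^ (n * d ^ (n - 1)) * mpeval c res"
    by simp
  moreover have "mpeval (\<lambda>(i, k). if i < n then u * c (i, k) else c (i, k)) res = mpeval (\<lambda>v. u * c v) res"
    using mpvars_res by (intro mpeval_cong) auto
  ultimately show ?thesis by simp
qed

subsection \<open>The derivative at the unit system\<close>

lemma res_derivative:
  "((\<lambda>e. mpeval (\<lambda>v. unit_sys v + e * w v) res) has_field_derivative of_nat (d ^ (n - 1)) * (\<Sum>i<n. w (i, psingle i d))) (at 0)"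
proof -
  let ?V = "{..<n} \<times> deg_monomials n d"
  have "finite ?V" by simp
  from mpeval_directional_derivative[OF this mpvars_res] obtain L
    where "\<forall>w. ((\<lambda>e. mpeval (\<lambda>v. unit_sys v + e * w v) res) has_field_derivative (\<Sum>v\<in>?V. L v * w v)) (at 0)" ..
  note L = this[rule_format]
  have Lv: "L (i, k) = (if k = psingle i d then of_nat (d ^ (n - 1)) else 0)" if ik: "i < n" "k \<in> deg_monomials n d" for i k
  proof -
    define w where "w = (\<lambda>v. if v = (i, k) then 1 else (0::complex))"
    have "(\<Sum>v\<in>?V. L v * w v) = (\<Sum>v\<in>?V. if v = (i, k) then L v else 0)"
      by (intro sum.cong) (auto simp: w_def)
    also have "\<dots> = L (i, k)" using ik by (subst sum.delta) auto
    finally have DL: "((\<lambda>e. mpeval (\<lambda>v. unit_sys v + e * w v) res) has_field_derivative L (i, k)) (at 0)"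
      using L[of w] by simp
    show ?thesis
    proof (cases "k = psingle i d")
      case True
      \<comment> \<open>The pure power is the only coefficient of form \<open>i\<close> in the unit
        system, so this direction just rescales the form by \<open>1 + e\<close>.\<close>
      have "(\<lambda>v. unit_sys v + e * w v) = scale_block i (1 + e) unit_sys" for e
        by (auto simp: w_def scale_block_def unit_sys True fun_eq_iff)
      then have "(\<lambda>e. mpeval (\<lambda>v. unit_sys v + e * w v) res) = (\<lambda>e. (1 + e) ^ (d ^ (n - 1)))"
        by (simp add: res_scale_block[OF ik(1)] res_unit_sys)
      from DL[unfolded this] have "L (i, k) = of_nat (d ^ (n - 1))"
        by (rule DERIV_unique[OF _ DERIV_one_plus_power])
      then show ?thesis unfolding if_P[OF True] .
    next
      case False
      have fm: "form (\<lambda>v. unit_sys v + e * w v) i' x = x i' ^ d + (if i' = i then e * moneval x k else 0)" if "i' < n"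
        for e :: complex and i' :: nat and x :: "nat \<Rightarrow> complex"
      proof -
        have "form (\<lambda>v. unit_sys v + e * w v) i' x = (\<Sum>k'\<in>deg_monomials n d. if k' = psingle i' d then moneval x k' else 0)
            + (\<Sum>k'\<in>deg_monomials n d. if k' = k then (if i' = i then e * moneval x k' else 0) else 0)"
          unfolding form_def sum.distrib[symmetric]
        proof (intro sum.cong refl)
          fix k'
          show "(unit_sys (i', k') + e * w (i', k')) * moneval x k' =
              (if k' = psingle i' d then moneval x k' else 0) + (if k' = k then (if i' = i then e * moneval x k' else 0) else 0)"
            unfolding unit_sys w_def by (cases "k' = psingle i' d"; cases "k' = k"; cases "i' = i") (simp_all add: distrib_right)
        qed
        also have "(\<Sum>k'\<in>deg_monomials n d. if k' = psingle i' d then moneval x k' else 0) = x i' ^ d"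
          using that by (simp add: psingle_deg_monomials)
        also have "(\<Sum>k'\<in>deg_monomials n d. if k' = k then (if i' = i then e * moneval x k' else 0) else 0) = (if i' = i then e * moneval x k else 0)"
          using ik(2) by (subst sum.delta) simp_all
        finally show ?thesis .
      qed
      \<comment> \<open>A second variable in the monomial \<open>k\<close> prevents new zeros: the
        forms other than \<open>i\<close> make all coordinates except \<open>x_i\<close> vanish,
        hence also the monomial, and then form \<open>i\<close> gives
        \<open>x_i = 0\<close>.\<close>
      obtain v where v: "v < n" "v \<noteq> i" "plookup k v > 0"
      proof (rule ccontr)
        assume "\<not> thesis"
        with that have k0: "plookup k v = 0" if "v < n" "v \<noteq> i" for v using that by blast
        then have "(\<Sum>v<n. plookup k v) = plookup k i" using ik(1) by (subst sum.remove[of _ i]) auto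
        then have "plookup k i = d" using ik(2) by (simp add: deg_monomials_def)
        then have "k = psingle i d"
          using k0 plookup_deg_outside[OF ik(2)] by (intro poly_mapping_eqI) (auto simp: lookup_single when_def)
        with False show False by blast
      qed
      have "\<not> nontrivial_zero (\<lambda>v. unit_sys v + e * w v) x" for e :: complex and x :: "nat \<Rightarrow> complex"
      proof
        assume z: "nontrivial_zero (\<lambda>v. unit_sys v + e * w v) x"
        then have f: "x i' ^ d + (if i' = i then e * moneval x k else 0) = 0" if "i' < n" for i'
          using that fm[of i' e x] by (simp add: nontrivial_zero_def)
        have "x i' = 0" if "i' < n" "i' \<noteq> i" for i' using f[OF that(1)] that(2) by simp
        moreover from this v have "moneval x k = 0"
          by (auto simp: moneval_def in_keys_iff intro!: prod_zero bexI[of _ v])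
        then have "x i = 0" using f[OF ik(1)] by simp
        ultimately have "x i' = 0" if "i' < n" for i' using that by (cases "i' = i") auto
        with z show False by (auto simp: nontrivial_zero_def)
      qed
      then have "mpeval (\<lambda>v. unit_sys v + e * w v) res \<noteq> 0" for e by (simp add: res_eq_0_iff)
      moreover have "polyfun (\<lambda>e. mpeval (\<lambda>v. unit_sys v + e * w v) res)" by auto
      ultimately have "(\<lambda>e. mpeval (\<lambda>v. unit_sys v + e * w v) res) = (\<lambda>e. mpeval (\<lambda>v. unit_sys v + 0 * w v) res)"
        by (intro ext polyfun_nonzero_imp_const[of "\<lambda>e. mpeval (\<lambda>v. unit_sys v + e * w v) res"])
      with DL have "((\<lambda>e. mpeval (\<lambda>v. unit_sys v + 0 * w v) res) has_field_derivative L (i, k)) (at 0)" by (simp only:)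
      then have "L (i, k) = 0" by (rule DERIV_unique) (rule DERIV_const)
      then show ?thesis unfolding if_not_P[OF False] .
    qed
  qed
  have "(\<Sum>v\<in>?V. L v * w v) = (\<Sum>i<n. \<Sum>k\<in>deg_monomials n d. L (i, k) * w (i, k))"
    by (simp add: sum.cartesian_product case_prod_unfold)
  also have "\<dots> = (\<Sum>i<n. \<Sum>k\<in>deg_monomials n d. if k = psingle i d then of_nat (d ^ (n - 1)) * w (i, k) else 0)"
    by (intro sum.cong refl) (simp add: Lv)
  also have "\<dots> = of_nat (d ^ (n - 1)) * (\<Sum>i<n. w (i, psingle i d))"
    by (simp add: psingle_deg_monomials sum_distrib_left)
  finally show ?thesis using L[of w] by simp
qed

end

section \<open>The first trace\<close>

definition msize :: "('v \<Rightarrow>\<^sub>0 nat) \<Rightarrow> nat" where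
  "msize k = (\<Sum>v\<in>pkeys k. plookup k v)"

lemma msize_superset: "finite A \<Longrightarrow> pkeys k \<subseteq> A \<Longrightarrow> msize k = (\<Sum>v\<in>A. plookup k v)"
  unfolding msize_def by (intro sum.mono_neutral_left) (auto simp: in_keys_iff)

lemma msize_add: "msize (k + l) = msize k + msize l"
proof -
  let ?A = "pkeys k \<union> pkeys l"
  have "msize (k + l) = (\<Sum>v\<in>?A. plookup (k + l) v)"
    by (rule msize_superset) (auto dest: subsetD[OF Poly_Mapping.keys_add])
  then show ?thesis by (simp add: msize_superset[of ?A] lookup_add sum.distrib)
qed

lemma msize_single [simp]: "msize (psingle v e) = e"
  by (simp add: msize_def)

lemma msize_zero_iff [simp]: "msize k = 0 \<longleftrightarrow> k = 0"
proof
  assume "msize k = 0"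
  then have "\<forall>v\<in>pkeys k. plookup k v = 0" by (simp add: msize_def)
  then have "plookup k v = plookup 0 v" for v by (cases "v \<in> pkeys k") (simp_all add: in_keys_iff)
  then show "k = 0" by (rule poly_mapping_eqI)
qed (simp add: msize_def)

lemma sub_single_add:
  fixes k :: "'v \<Rightarrow>\<^sub>0 nat"
  shows "plookup k v > 0 \<Longrightarrow> (k - psingle v 1) + psingle v 1 = k"
  by (rule poly_mapping_eqI) (auto simp: lookup_add lookup_minus lookup_single when_def)

lemma lookup_mppderiv:
  "plookup (mppderiv v p) k = of_nat (plookup k v + 1) * plookup p (k + psingle v 1)"
proof -
  have "plookup (mppderiv v p) k =
      (\<Sum>l\<in>pkeys p. if l = k + psingle v 1 then of_nat (plookup k v + 1) * plookup p l else 0)"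
    unfolding mppderiv_def lookup_sum
  proof (intro sum.cong refl)
    fix l
    show "plookup (psingle (l - psingle v 1) (of_nat (plookup l v) * plookup p l)) k =
        (if l = k + psingle v 1 then of_nat (plookup k v + 1) * plookup p l else 0)"
    proof (cases "plookup l v = 0")
      case True
      then have "l \<noteq> k + psingle v 1" by (auto simp: lookup_add)
      with True show ?thesis by simp
    next
      case False
      then have "l - psingle v 1 = k \<longleftrightarrow> l = k + psingle v 1" using sub_single_add[of l v] by auto
      then show ?thesis by (auto simp: lookup_single lookup_add when_def)
    qed
  qed
  then show ?thesis by (simp add: in_keys_iff)
qed

lemma lookup_mult_mpvar:
  "plookup (p * mpvar v) k = (if plookup k v > 0 then plookup p (k - psingle v 1) else 0)"
proof -
  have "p * mpvar v = (\<Sum>l\<in>pkeys p. psingle l (plookup p l)) * mpvar v" by (simp add: poly_mapping_sum_single)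
  also have "\<dots> = (\<Sum>l\<in>pkeys p. psingle (l + psingle v 1) (plookup p l))"
    by (simp add: mpvar_def sum_distrib_right mult_single)
  finally have "plookup (p * mpvar v) k = (\<Sum>l\<in>pkeys p. if l + psingle v 1 = k then plookup p l else 0)"
    by (simp add: lookup_sum lookup_single when_def)
  also have "\<dots> = (if plookup k v > 0 then plookup p (k - psingle v 1) else 0)"
  proof (cases "plookup k v > 0")
    case True
    then have "l + psingle v 1 = k \<longleftrightarrow> l = k - psingle v 1" for l using sub_single_add[of k v] by auto
    with True show ?thesis by (simp add: in_keys_iff)
  next
    case False
    then have "l + psingle v 1 \<noteq> k" for l by (auto simp: lookup_add)
    with False show ?thesis by simp
  qed
  finally show ?thesis .
qed

text \<open>The factor may stay unspecified because the rule is applied only where the coefficient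
  of \<open>p\<close> on the right is 0.\<close>

lemma foldr_mppderiv_lookup:
  "\<exists>c. plookup (foldr (\<lambda>j. mppderiv (i, j)) js p) k = c * plookup p (k + (\<Sum>j\<leftarrow>js. psingle (i, j) 1))"
proof (induction js arbitrary: k)
  case Nil
  show ?case by (intro exI[of _ 1]) simp
next
  case (Cons j js)
  obtain c where "plookup (foldr (\<lambda>j. mppderiv (i, j)) js p) (k + psingle (i, j) 1) =
      c * plookup p (k + psingle (i, j) 1 + (\<Sum>j\<leftarrow>js. psingle (i, j) 1))" using Cons.IH by blast
  then show ?case
    by (intro exI[of _ "of_nat (plookup k (i, j) + 1) * c"]) (simp add: lookup_mppderiv mult.assoc add.assoc)
qed

lemma foldr_mppderiv_replicate:
  fixes p :: "(nat \<times> nat, 'a::field_char_0) mpoly"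
  shows "plookup (foldr (\<lambda>j. mppderiv (i, j)) (replicate e i) p) k =
    fact (plookup k (i, i) + e) / fact (plookup k (i, i)) * plookup p (k + psingle (i, i) e)"
proof (induction e arbitrary: k)
  case (Suc e)
  have "psingle (i, i) 1 + psingle (i, i) e = psingle (i, i) (Suc e)" by (simp flip: single_add)
  then have "k + psingle (i, i) 1 + psingle (i, i) e = k + psingle (i, i) (Suc e)" by (simp add: add.assoc)
  note idx = this
  let ?a = "plookup k (i, i)"
  have "plookup (foldr (\<lambda>j. mppderiv (i, j)) (replicate (Suc e) i) p) k =
      of_nat (?a + 1) * plookup (foldr (\<lambda>j. mppderiv (i, j)) (replicate e i) p) (k + psingle (i, i) 1)"
    by (simp only: replicate_Suc foldr.simps o_apply lookup_mppderiv)
  also have "\<dots> = of_nat (?a + 1) * (fact (?a + 1 + e) / fact (?a + 1)) * plookup p (k + psingle (i, i) (Suc e))"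
    unfolding Suc.IH idx by (simp only: lookup_add lookup_single_eq mult.assoc)
  also have "(fact (?a + 1) :: 'a) = of_nat (?a + 1) * fact ?a" by (simp add: fact_Suc)
  also have "of_nat (?a + 1) * (fact (?a + 1 + e) / (of_nat (?a + 1) * fact ?a)) = (fact (?a + Suc e) / fact ?a :: 'a)"
    using of_nat_neq_0[of ?a, where 'a = 'a] by (simp del: of_nat_Suc fact_Suc)
  finally show ?case .
qed simp

text \<open>Monomials of an entry of the power come from walks from \<open>a\<close> to
  \<open>b\<close>. The variables of row \<open>i\<close> are the steps that start in
  \<open>i\<close>, so a walk using only these stays at \<open>i\<close> until its last step, and
  there is exactly one.\<close>

lemma lookup_var_mat_power:
  assumes i: "i < n" and row: "pkeys k \<subseteq> {i} \<times> UNIV" and ab: "a < n" "b < n"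
  shows "plookup ((var_mat n ^\<^sub>m Suc e) $$ (a, b)) k = (if a = i \<and> k = psingle (i, i) e + psingle (i, b) 1 then 1 else 0)"
  using row ab
proof (induction e arbitrary: k a b)
  case 0
  have "(var_mat n ^\<^sub>m Suc 0) $$ (a, b) = (mpvar (a, b) :: (nat \<times> nat, 'a) mpoly)"
    using 0 by (simp add: var_mat_def)
  then have eq: "plookup ((var_mat n ^\<^sub>m Suc 0) $$ (a, b)) k = (if psingle (a, b) 1 = k then 1 else (0::'a))"
    by (simp only: mpvar_def lookup_single when_def)
  have "a = i" if "psingle (a, b) 1 = k"
  proof -
    have "pkeys k = {(a, b)}" by (simp flip: that)
    with 0(1) show ?thesis by auto
  qed
  then have "psingle (a, b) 1 = k \<longleftrightarrow> a = i \<and> k = psingle (i, i) 0 + psingle (i, b) 1" by auto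
  then show ?case unfolding eq by simp
next
  case (Suc e)
  let ?A = "var_mat n :: (nat \<times> nat, 'a) mpoly mat"
  have c: "?A ^\<^sub>m Suc e \<in> carrier_mat n n" by (rule pow_carrier_mat) (simp add: var_mat_def)
  have "(?A ^\<^sub>m Suc (Suc e)) $$ (a, b) = ((?A ^\<^sub>m Suc e) * ?A) $$ (a, b)" by simp
  also have "\<dots> = (\<Sum>c<n. (?A ^\<^sub>m Suc e) $$ (a, c) * mpvar (c, b))"
    using Suc.prems c by (simp add: scalar_prod_def var_mat_def atLeast0LessThan del: pow_mat.simps)
  finally have "plookup ((?A ^\<^sub>m Suc (Suc e)) $$ (a, b)) k =
      (\<Sum>c<n. if plookup k (c, b) > 0 then plookup ((?A ^\<^sub>m Suc e) $$ (a, c)) (k - psingle (c, b) 1) else 0)"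
    by (simp only: lookup_sum lookup_mult_mpvar)
  also have "\<dots> = (\<Sum>c<n. if c = i then if plookup k (i, b) > 0 then plookup ((?A ^\<^sub>m Suc e) $$ (a, i)) (k - psingle (i, b) 1) else 0 else 0)"
  proof (intro sum.cong refl)
    fix c
    have "plookup k (c, b) = 0" if "c \<noteq> i" using Suc.prems(1) that by (auto simp: in_keys_iff subset_iff)
    then show "(if plookup k (c, b) > 0 then plookup ((?A ^\<^sub>m Suc e) $$ (a, c)) (k - psingle (c, b) 1) else 0) =
        (if c = i then if plookup k (i, b) > 0 then plookup ((?A ^\<^sub>m Suc e) $$ (a, i)) (k - psingle (i, b) 1) else 0 else 0)"
      by (auto simp del: pow_mat.simps)
  qed
  also have "\<dots> = (if plookup k (i, b) > 0 then plookup ((?A ^\<^sub>m Suc e) $$ (a, i)) (k - psingle (i, b) 1) else 0)"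
    using i by (simp del: pow_mat.simps)
  also have "\<dots> = (if a = i \<and> k = psingle (i, i) (Suc e) + psingle (i, b) 1 then 1 else 0)"
  proof (cases "plookup k (i, b) > 0")
    case True
    have "pkeys (k - psingle (i, b) 1) \<subseteq> pkeys k" by (auto simp: in_keys_iff lookup_minus)
    then have "pkeys (k - psingle (i, b) 1) \<subseteq> {i} \<times> UNIV" using Suc.prems(1) by (rule order_trans)
    then have "plookup ((?A ^\<^sub>m Suc e) $$ (a, i)) (k - psingle (i, b) 1) =
        (if a = i \<and> k - psingle (i, b) 1 = psingle (i, i) e + psingle (i, i) 1 then 1 else 0)"
      using Suc.prems i by (intro Suc.IH)
    moreover have "psingle (i, i) e + psingle (i, i) 1 = psingle (i, i) (Suc e)" by (simp flip: single_add)
    moreover have "k - psingle (i, b) 1 = l \<longleftrightarrow> k = l + psingle (i, b) 1" for l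
      using sub_single_add[OF True] by auto
    ultimately show ?thesis using True by (simp del: pow_mat.simps)
  next
    case False
    then have "k \<noteq> psingle (i, i) (Suc e) + psingle (i, b) 1" by (auto simp: lookup_add)
    with False show ?thesis by simp
  qed
  finally show ?case .
qed

lemma msize_keys_var_mat_power:
  assumes "a < n" "b < n" "k \<in> pkeys ((var_mat n ^\<^sub>m e) $$ (a, b) :: (nat \<times> nat, 'a::comm_semiring_1) mpoly)"
  shows "msize k = e"
  using assms
proof (induction e arbitrary: k b)
  case 0
  then show ?case by (auto simp: var_mat_def split: if_splits)
next
  case (Suc e)
  let ?A = "var_mat n :: (nat \<times> nat, 'a) mpoly mat"
  have c: "?A ^\<^sub>m e \<in> carrier_mat n n" by (rule pow_carrier_mat) (simp add: var_mat_def)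
  have "(?A ^\<^sub>m Suc e) $$ (a, b) = (\<Sum>c<n. (?A ^\<^sub>m e) $$ (a, c) * mpvar (c, b))"
    using Suc.prems(1,2) c by (simp add: scalar_prod_def var_mat_def atLeast0LessThan)
  with Suc.prems(3) obtain c where c: "c < n" "k \<in> pkeys ((?A ^\<^sub>m e) $$ (a, c) * mpvar (c, b))"
    using Poly_Mapping.keys_sum[of "\<lambda>c. (?A ^\<^sub>m e) $$ (a, c) * mpvar (c, b)" "{..<n}"] by auto
  then obtain l where "l \<in> pkeys ((?A ^\<^sub>m e) $$ (a, c))" "k = l + psingle (c, b) 1"
    using Poly_Mapping.keys_mult[of "(?A ^\<^sub>m e) $$ (a, c)" "mpvar (c, b)"] by (auto simp: mpvar_def)
  with Suc.IH[of c l] Suc.prems c show ?case by (simp add: msize_add)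
qed

lemma finite_index_lists [simp]: "finite (index_lists n k)"
  using finite_lists_length_eq[of "{..<n}" k] by (simp add: index_lists_def conj_commute)

lemma lookup_sum_list_single:
  "inj f \<Longrightarrow> plookup (\<Sum>j\<leftarrow>js. psingle (f j) (1::nat)) (f i) = count_list js i"
  by (induction js) (auto simp: lookup_add lookup_single when_def inj_eq)

lemma sum_list_single_eq_iff:
  assumes "inj f"
  shows "(\<Sum>j\<leftarrow>js. psingle (f j) 1) = psingle (f i) (length js) \<longleftrightarrow> js = replicate (length js) i"
proof
  assume eq: "(\<Sum>j\<leftarrow>js. psingle (f j) 1) = psingle (f i) (length js)"
  have "j = i" if "j \<in> set js" for j
  proof (rule ccontr)
    assume "j \<noteq> i"
    then have "plookup (psingle (f i) (length js)) (f j) = 0" using assms by (simp add: lookup_single inj_eq)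
    then have "count_list js j = 0" using lookup_sum_list_single[OF assms, of js j] eq by simp
    with that show False by (simp add: count_list_0_iff)
  qed
  then show "js = replicate (length js) i" by (metis replicate_length_same)
next
  have "(\<Sum>j\<leftarrow>replicate e i. psingle (f j) 1) = psingle (f i) e" for e
    by (induction e) (simp_all flip: single_add)
  moreover assume "js = replicate (length js) i"
  ultimately show "(\<Sum>j\<leftarrow>js. psingle (f j) 1) = psingle (f i) (length js)" by metis
qed

text \<open>The order of differentiation equals the degree of the trace, so at most a constant
  survives, a multiple of the coefficient of the monomial \<open>l\<close>. All derivatives belong
  to row \<open>i\<close>, and the only monomial of the trace inside that row is
  \<open>a_ii ^ (e + 1)\<close>.\<close>

lemma g_hat_trace_summand:
  fixes p :: "(nat \<times> nat, complex) mpoly"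
  assumes i: "i < n" and js: "length js = Suc e"
  defines "p \<equiv> mat_trace (var_mat n ^\<^sub>m Suc e)"
  shows "foldr (\<lambda>j. mppderiv (i, j)) js p = (if js = replicate (Suc e) i then mpconst (fact (Suc e)) else 0)"
proof (rule poly_mapping_eqI)
  fix k
  let ?B = "var_mat n ^\<^sub>m Suc e :: (nat \<times> nat, complex) mpoly mat"
  have "?B \<in> carrier_mat n n" by (rule pow_carrier_mat) (simp add: var_mat_def)
  then have "dim_row ?B = n" by (rule carrier_matD)
  then have p: "p = (\<Sum>a<n. ?B $$ (a, a))"
    unfolding p_def mat_trace_def by (simp only:)
  have size: "msize l = Suc e" if "l \<in> pkeys p" for l
  proof -
    have "l \<in> (\<Union>a<n. pkeys (?B $$ (a, a)))"
      using that Poly_Mapping.keys_sum[of "\<lambda>a. ?B $$ (a, a)" "{..<n}"] unfolding p by blast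
    then obtain a where "a < n" "l \<in> pkeys (?B $$ (a, a))" by blast
    then show ?thesis by (intro msize_keys_var_mat_power[of a n a])
  qed
  define l where "l = (\<Sum>j\<leftarrow>js. psingle (i, j) (1::nat))"
  have inj: "inj (Pair i)" by (simp add: inj_on_def)
  have "msize (\<Sum>j\<leftarrow>js. psingle (i, j) (1::nat)) = length js" by (induction js) (simp_all add: msize_add)
  then have msl: "msize l = Suc e" using js by (simp add: l_def)
  have row: "pkeys l \<subseteq> {i} \<times> UNIV"
  proof -
    have "pkeys (\<Sum>j\<leftarrow>js. psingle (i, j) (1::nat)) \<subseteq> {i} \<times> UNIV"
      by (induction js) (auto dest!: subsetD[OF Poly_Mapping.keys_add])
    then show ?thesis by (simp add: l_def)
  qed
  have pl: "plookup p l = (if l = psingle (i, i) (Suc e) then 1 else 0)"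
  proof -
    have "plookup p l = (\<Sum>a<n. if a = i then if l = psingle (i, i) e + psingle (i, i) 1 then 1 else 0 else 0)"
      unfolding p lookup_sum using i row by (intro sum.cong refl) (simp add: lookup_var_mat_power del: pow_mat.simps)
    then show ?thesis using i by (simp flip: single_add)
  qed
  have l_iff: "l = psingle (i, i) (Suc e) \<longleftrightarrow> js = replicate (Suc e) i"
    using sum_list_single_eq_iff[OF inj, of js i] js by (simp add: l_def)
  obtain c where c: "plookup (foldr (\<lambda>j. mppderiv (i, j)) js p) k = c * plookup p (k + l)"
    using foldr_mppderiv_lookup[of i js p k] unfolding l_def by blast
  show "plookup (foldr (\<lambda>j. mppderiv (i, j)) js p) k = plookup (if js = replicate (Suc e) i then mpconst (fact (Suc e)) else 0) k"
  proof (cases "k = 0")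
    case False
    then have "msize (k + l) \<noteq> Suc e" using msl by (simp add: msize_add)
    then have "plookup p (k + l) = 0" using size by (auto simp: in_keys_iff)
    with False c show ?thesis by (simp add: mpconst_def lookup_single)
  next
    case True
    show ?thesis
    proof (cases "js = replicate (Suc e) i")
      case js_eq: True
      have "plookup (foldr (\<lambda>j. mppderiv (i, j)) js p) 0 = fact (Suc e) * plookup p (psingle (i, i) (Suc e))"
        unfolding js_eq foldr_mppderiv_replicate by simp
      also have "\<dots> = fact (Suc e)" using pl l_iff js_eq by simp
      finally show ?thesis unfolding True if_P[OF js_eq] mpconst_def lookup_single_eq .
    next
      case False
      then have "plookup p l = 0" using pl l_iff by simp
      then show ?thesis using c unfolding True if_not_P[OF False] by (simp only: add_0 mult_zero_right lookup_zero)
    qed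
  qed
qed

lemma Tr1_eq:
  assumes "m \<ge> 2"
  shows "Tr1 m n T = mpconst ((of_nat m - 1) ^ (n - 1) * (\<Sum>i<n. T (replicate m i)))"
proof -
  obtain e where e: "m = Suc (Suc e)" using assms that[of "m - 2"] by simp
  interpret mc: comm_semiring_hom "mpconst :: complex \<Rightarrow> (nat \<times> nat, complex) mpoly" by (rule comm_semiring_hom_mpconst)
  have "g_hat m n T i (mat_trace (var_mat n ^\<^sub>m Suc e)) = mpconst (T (replicate m i) * fact (Suc e))" if i: "i < n" for i
  proof -
    have "g_hat m n T i (mat_trace (var_mat n ^\<^sub>m Suc e)) =
        (\<Sum>js\<in>index_lists n (Suc e). if js = replicate (Suc e) i then mpconst (T (i # js) * fact (Suc e)) else 0)"
      unfolding g_hat_def e diff_Suc_1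
      by (intro sum.cong refl) (simp add: index_lists_def g_hat_trace_summand[OF i] mc.hom_mult del: pow_mat.simps replicate_Suc fact_Suc)
    also have "\<dots> = mpconst (T (i # replicate (Suc e) i) * fact (Suc e))"
    proof -
      have "replicate (Suc e) i \<in> index_lists n (Suc e)" using i by (auto simp: index_lists_def)
      then show ?thesis by (simp del: replicate_Suc fact_Suc)
    qed
    finally show ?thesis by (simp add: e)
  qed
  then have "Tr1 m n T = mpconst ((of_nat m - 1) ^ (n - 1)) * (\<Sum>i<n. mpconst (1 / fact (Suc e)) * mpconst (T (replicate m i) * fact (Suc e)))"
    unfolding Tr1_def e diff_Suc_1 by (simp add: e del: pow_mat.simps fact_Suc)
  also have "\<dots> = mpconst ((of_nat m - 1) ^ (n - 1) * (\<Sum>i<n. T (replicate m i)))"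
    by (simp add: mc.hom_mult[symmetric] mc.hom_sum[symmetric] del: fact_Suc)
  finally show ?thesis .
qed

section \<open>Sum and product of roots through the reversed polynomial\<close>

lemma DERIV_prod_linear_power:
  assumes "finite S"
  shows "((\<lambda>e. \<Prod>z\<in>S. (1 - z * e) ^ k z) has_field_derivative - (\<Sum>z\<in>S. of_nat (k z) * z)) (at (0::complex))"
  using assms
proof (induction S)
  case (insert x S)
  have "((\<lambda>e. (1 - x * e) ^ k x) has_field_derivative - (of_nat (k x) * x)) (at 0)"
    by (auto intro!: derivative_eq_intros)
  from DERIV_mult[OF this insert.IH] insert.hyps show ?case by simp
qed simp

text \<open>Vieta's formulas: \<open>G\<close> is the product of \<open>(1 - z * x) ^ k z\<close>
  over the roots \<open>z\<close> of \<open>P\<close>, so its derivative at 0 is minus the weighted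
  sum of the roots. \<open>G0\<close> makes \<open>P\<close> monic of degree
  \<open>N\<close>.\<close>

lemma reflected_poly_roots:
  fixes P G :: "complex poly"
  assumes rel: "\<And>t. t \<noteq> 0 \<Longrightarrow> poly P t = t ^ N * poly G (inverse t)" and G0: "poly G 0 = 1"
    and DG: "(poly G has_field_derivative D) (at 0)"
  shows "P \<noteq> 0" "(\<Sum>z | poly P z = 0. of_nat (order z P) * z) = - D"
    "(\<Prod>z | poly P z = 0. z ^ order z P) = (- 1) ^ N * poly P 0"
proof -
  have deg: "degree P = N" and refl: "reflect_poly P = G" using reflected_poly[OF rel] G0 by auto
  then show P0: "P \<noteq> 0" using G0 by auto
  define S where "S = {z. poly P z = 0}"
  define k where "k = (\<lambda>z. order z P)"
  have fin: "finite S" unfolding S_def by (rule poly_roots_finite[OF P0])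
  have "lead_coeff P = 1" using G0 unfolding refl[symmetric] by simp
  then have dec: "(\<Prod>z\<in>S. [:- z, 1:] ^ k z) = P"
    using complex_poly_decompose[of P] by (simp add: S_def k_def)
  have val: "poly P t = (\<Prod>z\<in>S. (t - z) ^ k z)" for t
    unfolding dec[symmetric] by (simp add: poly_prod)
  define Q where "Q = (\<Prod>z\<in>S. [:1, - z:] ^ k z)"
  have Q: "poly Q t = (\<Prod>z\<in>S. (1 - z * t) ^ k z)" for t
    unfolding Q_def by (simp add: poly_prod mult.commute)
  have relQ: "poly P t = t ^ (\<Sum>z\<in>S. k z) * poly Q (inverse t)" if "t \<noteq> 0" for t
  proof -
    have "t * (1 - z * inverse t) = t - z" for z using that by (simp add: field_simps)
    then show ?thesis
      unfolding val Q power_sum prod.distrib[symmetric] power_mult_distrib[symmetric] by simp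
  qed
  have "poly Q 0 \<noteq> 0" by (simp add: Q)
  \<comment> \<open>This exhibits \<open>P\<close> as a reversal a second time; comparison with
    \<open>rel\<close> identifies the exponents and the two reversed polynomials.\<close>
  from reflected_poly[OF relQ this] deg refl have sum_k: "(\<Sum>z\<in>S. k z) = N" and "G = Q" by auto
  have "((\<lambda>e. poly G e) has_field_derivative - (\<Sum>z\<in>S. of_nat (k z) * z)) (at 0)"
    unfolding \<open>G = Q\<close> Q by (rule DERIV_prod_linear_power[OF fin])
  with DG have "D = - (\<Sum>z\<in>S. of_nat (k z) * z)" by (rule DERIV_unique)
  then show "(\<Sum>z | poly P z = 0. of_nat (order z P) * z) = - D" by (simp add: S_def k_def)
  have "poly P 0 = (\<Prod>z\<in>S. (- 1) ^ k z * z ^ k z)"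
    unfolding val by (simp add: power_mult_distrib[symmetric])
  also have "\<dots> = (- 1) ^ N * (\<Prod>z\<in>S. z ^ k z)"
    by (simp add: prod.distrib sum_k flip: power_sum)
  finally have "(- 1) ^ N * poly P 0 = ((- 1) ^ N * (- 1) ^ N) * (\<Prod>z\<in>S. z ^ k z)" by (simp only: mult.assoc)
  also have "(- 1 :: complex) ^ N * (- 1) ^ N = 1" by (simp flip: power_mult_distrib)
  finally show "(\<Prod>z | poly P z = 0. z ^ order z P) = (- 1) ^ N * poly P 0" by (simp add: S_def k_def)
qed

section \<open>Tensors\<close>

definition list_monomial :: "nat list \<Rightarrow> (nat \<Rightarrow>\<^sub>0 nat)" where
  "list_monomial js = (\<Sum>j\<leftarrow>js. psingle j 1)"

lemma list_monomial_deg: "js \<in> index_lists n d \<Longrightarrow> list_monomial js \<in> deg_monomials n d"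
proof (induction js arbitrary: d)
  case (Cons j js)
  then obtain e where e: "d = Suc e" "js \<in> index_lists n e" "j < n" by (auto simp: index_lists_def)
  from deg_monomials_add[OF psingle_deg_monomials[OF e(3), of 1] Cons.IH[OF e(2)]]
  show ?case by (simp add: list_monomial_def e(1))
qed (auto simp: list_monomial_def index_lists_def deg_monomials_def)

lemma tensor_forms_eq:
  fixes T :: "'a::comm_semiring_1 tensor"
  assumes "i < n"
  shows "tensor_forms m n T i = (\<Sum>js\<in>index_lists n (m - 1). psingle (list_monomial js) (T (i # js)))"
proof -
  have mon: "(\<Prod>j\<leftarrow>js. vec n mpvar $ j) = psingle (list_monomial js) (1::'a)" if "set js \<subseteq> {..<n}" for js
    using that by (induction js) (simp_all add: list_monomial_def mpvar_def mult_single)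
  have "tensor_forms m n T i = (\<Sum>js\<in>index_lists n (m - 1). mpconst (T (i # js)) * (\<Prod>j\<leftarrow>js. vec n mpvar $ j))"
    using assms by (simp add: tensor_forms_def tensor_apply_def)
  also have "\<dots> = (\<Sum>js\<in>index_lists n (m - 1). psingle (list_monomial js) (T (i # js)))"
    by (intro sum.cong refl) (simp add: mon index_lists_def mpconst_def mult_single)
  finally show ?thesis .
qed

lemma homogeneous_tensor_forms: "i < n \<Longrightarrow> homogeneous_poly n (m - 1) (tensor_forms m n T i)"
  unfolding tensor_forms_eq by (intro homogeneous_poly_sum) (auto simp: homogeneous_poly_def list_monomial_deg)

lemma mpeval_tensor_forms: "i < n \<Longrightarrow> mpeval (\<lambda>j. x $ j) (tensor_forms m n T i) = tensor_apply m n T x $ i"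
proof -
  assume i: "i < n"
  have "moneval (\<lambda>j. x $ j) (list_monomial js) = (\<Prod>j\<leftarrow>js. x $ j)" for js
    by (induction js) (simp_all add: list_monomial_def moneval_add)
  with i show ?thesis by (simp add: tensor_forms_eq tensor_apply_def mpeval.hom_sum mpeval_single)
qed

lemma tensor_coeffs:
  assumes "i < n"
  shows "system_coeffs (tensor_forms m n T) (i, k) = (\<Sum>js\<in>index_lists n (m - 1). if list_monomial js = k then T (i # js) else 0)"
  using assms by (simp add: system_coeffs_def tensor_forms_eq lookup_sum lookup_single when_def)

lemma list_monomial_eq_single_iff:
  "js \<in> index_lists n d \<Longrightarrow> list_monomial js = psingle i d \<longleftrightarrow> js = replicate d i"
  using sum_list_single_eq_iff[of "\<lambda>j. j" js i] by (auto simp: list_monomial_def index_lists_def)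

text \<open>Several index lists may share a monomial, but a pure power arises from the constant list
  alone.\<close>

lemma tensor_coeffs_diagonal:
  assumes "i < n" "m \<ge> 1"
  shows "system_coeffs (tensor_forms m n T) (i, psingle i (m - 1)) = T (replicate m i)"
proof -
  have "replicate (m - 1) i \<in> index_lists n (m - 1)" using assms by (auto simp: index_lists_def)
  moreover have "replicate m i = i # replicate (m - 1) i" using assms(2) by (metis Suc_diff_1 less_eq_Suc_le One_nat_def replicate_Suc)
  moreover have "system_coeffs (tensor_forms m n T) (i, psingle i (m - 1)) =
      (\<Sum>js\<in>index_lists n (m - 1). if js = replicate (m - 1) i then T (i # js) else 0)"
    unfolding tensor_coeffs[OF assms(1)] by (intro sum.cong refl) (simp add: list_monomial_eq_single_iff)
  ultimately show ?thesis by simp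
qed

lemma tensor_coeffs_shifted:
  assumes "i < n"
  shows "system_coeffs (tensor_forms m n (shifted_tensor l T)) (i, k) =
    l * system_coeffs (\<lambda>i. mpvar i ^ (m - 1)) (i, k) - system_coeffs (tensor_forms m n T) (i, k)"
proof -
  have id: "id_tensor (i # js) = (if js = replicate (m - 1) i then 1 else (0::complex))" if "js \<in> index_lists n (m - 1)" for js
  proof -
    have "length js = m - 1" using that by (simp add: index_lists_def)
    then have "js = replicate (m - 1) i \<longleftrightarrow> (\<forall>j\<in>set js. j = i)" by (metis in_set_replicate replicate_length_same)
    then show ?thesis by (auto simp: id_tensor_def)
  qed
  have rep: "replicate (m - 1) i \<in> index_lists n (m - 1)" using assms by (auto simp: index_lists_def)
  have "system_coeffs (tensor_forms m n (shifted_tensor l T)) (i, k) =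
      (\<Sum>js\<in>index_lists n (m - 1). (if js = replicate (m - 1) i then if psingle i (m - 1) = k then l else 0 else 0)
        - (if list_monomial js = k then T (i # js) else 0))"
    unfolding tensor_coeffs[OF assms]
  proof (intro sum.cong refl)
    fix js assume js: "js \<in> index_lists n (m - 1)"
    show "(if list_monomial js = k then shifted_tensor l T (i # js) else 0) =
        (if js = replicate (m - 1) i then if psingle i (m - 1) = k then l else 0 else 0) - (if list_monomial js = k then T (i # js) else 0)"
      using list_monomial_eq_single_iff[OF js, of i] id[OF js] by (auto simp: shifted_tensor_def)
  qed
  also have "\<dots> = (if psingle i (m - 1) = k then l else 0) - system_coeffs (tensor_forms m n T) (i, k)"
    using rep by (simp add: sum_subtractf tensor_coeffs[OF assms])
  also have "(if psingle i (m - 1) = k then l else 0) = l * system_coeffs (\<lambda>i. mpvar i ^ (m - 1)) (i, k)"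
    by (simp add: system_coeffs_def lookup_single mpvar_power)
  finally show ?thesis .
qed

text \<open>Finiteness of the spectrum belongs to the claim because sums and products over infinite
  sets take default values.\<close>

theorem corollary8p2:
  fixes m n :: nat and T :: "complex tensor"
  assumes "m \<ge> 2" and "n \<ge> 2"
  shows "finite (tensor_spectrum m n T) \<and>
         (\<Sum>l\<in>tensor_spectrum m n T. of_nat (alg_mult m n T l) * l) =
           (of_nat m - 1) ^ (n - 1) * (\<Sum>i<n. T (replicate m i)) \<and>
         mpconst ((of_nat m - 1) ^ (n - 1) * (\<Sum>i<n. T (replicate m i))) = Tr1 m n T \<and>
         (\<Prod>l\<in>tensor_spectrum m n T. l ^ alg_mult m n T l) = Edet m n T"
proof -
  define d where "d = m - 1"
  interpret form_systems n d using assms by unfold_locales (auto simp: d_def)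
  define c where "c = system_coeffs (tensor_forms m n T)"
  define N where "N = n * d ^ (n - 1)"
  have Edet: "Edet m n S = mpeval (system_coeffs (tensor_forms m n S)) res" for S
    by (simp only: Edet_def Res_def resultant_poly_eq_res flip: d_def)
  \<comment> \<open>In this form the system at \<open>l = 0\<close> is \<open>c\<close> scaled by
    \<open>- 1\<close>, so that \<open>res_scale\<close> yields the sign relating
    \<open>poly P 0\<close> to \<open>Edet m n T\<close>.\<close>
  have shift: "Edet m n (shifted_tensor l T) = mpeval (\<lambda>v. l * unit_sys v + (- 1) * c v) res" for l
    unfolding Edet
    by (rule mpeval_cong) (use mpvars_res in \<open>auto simp: c_def d_def tensor_coeffs_shifted\<close>)
  have "polyfun (\<lambda>l. mpeval (\<lambda>v. l * unit_sys v + (- 1) * c v) res)" "polyfun (\<lambda>e. mpeval (\<lambda>v. unit_sys v + e * (- c v)) res)"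
    by (intro polyfun_mpeval polyfun_add polyfun_mult polyfun_id polyfun_const)+
  then obtain P G where P: "\<And>l. mpeval (\<lambda>v. l * unit_sys v + (- 1) * c v) res = poly P l"
    and G: "\<And>e. mpeval (\<lambda>v. unit_sys v + e * (- c v)) res = poly G e"
    unfolding polyfun_def by metis
  have rel: "poly P t = t ^ N * poly G (inverse t)" if "t \<noteq> 0" for t
  proof -
    have "(\<lambda>v. t * unit_sys v + (- 1) * c v) = (\<lambda>v. t * (unit_sys v + inverse t * (- c v)))"
      using that by (intro ext) (simp add: field_simps)
    then show ?thesis unfolding P[symmetric] G[symmetric] N_def by (simp only: res_scale)
  qed
  have G0: "poly G 0 = 1" by (simp add: res_unit_sys flip: G)
  have "((\<lambda>e. poly G e) has_field_derivative of_nat (d ^ (n - 1)) * (\<Sum>i<n. - c (i, psingle i d))) (at 0)"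
    unfolding G[symmetric] by (rule res_derivative)
  moreover have "c (i, psingle i d) = T (replicate m i)" if "i < n" for i
    unfolding c_def d_def by (rule tensor_coeffs_diagonal) (use that assms in auto)
  moreover have "(of_nat (d ^ (n - 1)) :: complex) = (of_nat m - 1) ^ (n - 1)"
    using assms(1) by (simp add: d_def of_nat_diff)
  ultimately have DG: "(poly G has_field_derivative - ((of_nat m - 1) ^ (n - 1) * (\<Sum>i<n. T (replicate m i)))) (at 0)"
    by (simp add: sum_negf)
  note roots = reflected_poly_roots[OF rel G0 DG]
  have char: "Edet m n (shifted_tensor l T) = poly P l" for l
    by (simp only: shift P)
  have charpoly: "tensor_charpoly m n T = P"
    unfolding tensor_charpoly_def char by (rule the_equality) (auto intro: poly_ext)
  have spectrum: "tensor_spectrum m n T = {l. poly P l = 0}"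
  proof -
    have "tensor_eigenvalue m n T l \<longleftrightarrow> poly P l = 0" for l
    proof -
      let ?F = "tensor_forms m n (shifted_tensor l T)"
      have dim: "dim_vec (tensor_apply m n (shifted_tensor l T) x) = n" for x by (simp add: tensor_apply_def)
      have "tensor_apply m n (shifted_tensor l T) x = 0\<^sub>v n \<longleftrightarrow> (\<forall>i<n. mpeval (\<lambda>j. x $ j) (?F i) = 0)" for x
        by (auto simp: mpeval_tensor_forms dim vec_eq_iff)
      then have "tensor_eigenvalue m n T l \<longleftrightarrow> (\<exists>x\<in>carrier_vec n. x \<noteq> 0\<^sub>v n \<and> (\<forall>i<n. mpeval (\<lambda>j. x $ j) (?F i) = 0))"
        by (simp add: tensor_eigenvalue_def)
      also have "\<dots> \<longleftrightarrow> mpeval (system_coeffs ?F) res = 0"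
        unfolding res_eq_0_iff by (rule common_zero_iff) (intro allI impI, unfold d_def, rule homogeneous_tensor_forms)
      also have "mpeval (system_coeffs ?F) res = poly P l"
        by (simp only: Edet[symmetric] char)
      finally show ?thesis .
    qed
    then show ?thesis by (simp add: tensor_spectrum_def)
  qed
  have "poly P 0 = (- 1) ^ N * Edet m n T"
    by (simp only: P[symmetric] Edet c_def[symmetric] N_def mult_zero_left add_0_left res_scale)
  then have "(- 1) ^ N * poly P 0 = ((- 1) ^ N * (- 1) ^ N) * Edet m n T" by (simp only: mult.assoc)
  also have "(- 1 :: complex) ^ N * (- 1) ^ N = 1" by (simp flip: power_mult_distrib)
  finally have "(- 1) ^ N * poly P 0 = Edet m n T" by simp
  then show ?thesis
    using roots poly_roots_finite[OF roots(1)] Tr1_eq[OF assms(1), of n T]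
    by (simp add: spectrum alg_mult_def charpoly)
qed

end
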